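(* Let $W\in\mathcal{P}(\mathcal{Y}|\mathcal{X})$ be singular and asymmetric. (i) If $\epsilon\in(0,1/2)$, there is a constant $\tilde K(\epsilon,W)>0$ such that for all $N$, $$\ln M^*_{\mathrm{c}}(N,\epsilon)\le N\,C(W)+\sqrt{N\,V_\epsilon(W)}\,\Phi^{-1}(\epsilon)+\tilde K(\epsilon,W).$$ (ii) If $\epsilon\in(1/2,1)$ and $V_\epsilon(W)>0$, there is a constant $\hat K(\epsilon,W)>0$ such that for all $N$, $$\ln M^*_{\mathrm{c}}(N,\epsilon)\le N\,C(W)+\sqrt{N\,V_\epsilon(W)}\,\Phi^{-1}(\epsilon)+\hat K(\epsilon,W).$$
   Context: $\mathcal{X},\mathcal{Y}$ finite; memoryless use. $W$ is asymmetric: it is not symmetric in Gallager's sense (symmetric meaning the outputs can be partitioned into subsets such that within each subset each row of the transition submatrix is a permutation of each other row and each column a permutation of each other column). $W$ is singular: for all $(x,y,z)$ with $W(y|x)W(y|z)>0$, $W(y|x)=W(y|z)$. An $(N,R)$ constant composition code is a code (encoder $f:\{1,\dots,\lceil e^{NR}\rceil\}\to\mathcal{X}^N$, decoder $\varphi:\mathcal{Y}^N\to\mathcal{M}$) all of whose codewords have the same empirical distribution. $M^*_{\mathrm{c}}(N,\epsilon)$ is the largest $\lceil e^{NR}\rceil$ for which an $(N,R)$ constant composition code has average error probability (uniform messages) at most $\epsilon$. $\Phi$ is the standard Gaussian CDF, $C(W)$ the capacity; $q_P(y)=\sum_xP(x)W(y|x)$; $V(P,W)=\sum_{x,y}P(x)W(y|x)[\ln\frac{W(y|x)}{q_P(y)}-\sum_bW(b|x)\ln\frac{W(b|x)}{q_P(b)}]^2$;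 $V_\epsilon(W)=\min_{Q:I(Q;W)=C(W)}V(Q,W)$ for $\epsilon<1/2$ and the corresponding max for $\epsilon\ge1/2$. *)

theory Defs
  imports "HOL-Probability.Probability"
begin

definition channel :: "('x::finite \<Rightarrow> 'y::finite \<Rightarrow> real) \<Rightarrow> bool" where
  "channel W \<longleftrightarrow> (\<forall>x y. 0 \<le> W x y) \<and> (\<forall>x. (\<Sum>y\<in>UNIV. W x y) = 1)"

definition input_dists :: "('x::finite \<Rightarrow> real) set" where
  "input_dists = {P. (\<forall>x. 0 \<le> P x) \<and> (\<Sum>x\<in>UNIV. P x) = 1}"

definition q_out :: "('x::finite \<Rightarrow> real) \<Rightarrow> ('x \<Rightarrow> 'y \<Rightarrow> real) \<Rightarrow> 'y \<Rightarrow> real" where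
  "q_out P W y = (\<Sum>x\<in>UNIV. P x * W x y)"

definition mutual_info :: "('x::finite \<Rightarrow> real) \<Rightarrow> ('x \<Rightarrow> 'y::finite \<Rightarrow> real) \<Rightarrow> real" where
  "mutual_info P W = (\<Sum>x\<in>UNIV. \<Sum>y\<in>UNIV.
     if P x * W x y > 0 then P x * W x y * ln (W x y / q_out P W y) else 0)"

definition capacity :: "('x::finite \<Rightarrow> 'y::finite \<Rightarrow> real) \<Rightarrow> real" where
  "capacity W = (SUP P\<in>input_dists. mutual_info P W)"

definition div_row :: "('x::finite \<Rightarrow> real) \<Rightarrow> ('x \<Rightarrow> 'y::finite \<Rightarrow> real) \<Rightarrow> 'x \<Rightarrow> real" where
  "div_row P W x = (\<Sum>b\<in>UNIV. if W x b > 0 then W x b * ln (W x b / q_out P W b) else 0)"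

definition cond_var :: "('x::finite \<Rightarrow> real) \<Rightarrow> ('x \<Rightarrow> 'y::finite \<Rightarrow> real) \<Rightarrow> real" where
  "cond_var P W = (\<Sum>x\<in>UNIV. \<Sum>y\<in>UNIV.
     if P x * W x y > 0 then P x * W x y * (ln (W x y / q_out P W y) - div_row P W x)\<^sup>2 else 0)"

definition cap_achieving :: "('x::finite \<Rightarrow> 'y::finite \<Rightarrow> real) \<Rightarrow> ('x \<Rightarrow> real) set" where
  "cap_achieving W = {Q \<in> input_dists. mutual_info Q W = capacity W}"

definition V_eps :: "('x::finite \<Rightarrow> 'y::finite \<Rightarrow> real) \<Rightarrow> real \<Rightarrow> real" where
  "V_eps W \<epsilon> = (if \<epsilon> < 1/2 then (INF Q\<in>cap_achieving W. cond_var Q W)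
                  else (SUP Q\<in>cap_achieving W. cond_var Q W))"

definition singular_channel :: "('x \<Rightarrow> 'y \<Rightarrow> real) \<Rightarrow> bool" where
  "singular_channel W \<longleftrightarrow> (\<forall>x y z. W x y * W z y > 0 \<longrightarrow> W x y = W z y)"

definition gallager_symmetric :: "('x::finite \<Rightarrow> 'y::finite \<Rightarrow> real) \<Rightarrow> bool" where
  "gallager_symmetric W \<longleftrightarrow> (\<exists>\<P>. partition_on (UNIV :: 'y set) \<P> \<and>
     (\<forall>B\<in>\<P>.
        (\<forall>x x'. \<exists>\<pi>. \<pi> permutes B \<and> (\<forall>y\<in>B. W x' y = W x (\<pi> y))) \<and>
        (\<forall>y\<in>B. \<forall>y'\<in>B. \<exists>\<sigma>. \<sigma> permutes (UNIV :: 'x set) \<and> (\<forall>x. W x y' = W (\<sigma> x) y))))"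

definition Phi :: "real \<Rightarrow> real" where
  "Phi x = (LBINT t:{..x}. std_normal_density t)"

definition Phi_inv :: "real \<Rightarrow> real" where
  "Phi_inv p = (THE z. Phi z = p)"

definition W_N :: "('x \<Rightarrow> 'y \<Rightarrow> real) \<Rightarrow> 'x list \<Rightarrow> 'y list \<Rightarrow> real" where
  "W_N W xs ys = (\<Prod>i<length xs. W (xs ! i) (ys ! i))"

definition avg_error :: "('x \<Rightarrow> 'y::finite \<Rightarrow> real) \<Rightarrow> nat \<Rightarrow> nat \<Rightarrow> (nat \<Rightarrow> 'x list) \<Rightarrow> ('y list \<Rightarrow> nat) \<Rightarrow> real" where
  "avg_error W N M f dec = (1 / real M) * (\<Sum>m\<in>{1..M}.
      \<Sum>ys\<in>{ys. length ys = N \<and> dec ys \<noteq> m}. W_N W (f m) ys)"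

text \<open>An (N,M) constant composition code with average error at most eps
  (encoder into X^N, decoder Y^N -> messages, all codewords of the same type).\<close>
definition cc_code :: "('x \<Rightarrow> 'y::finite \<Rightarrow> real) \<Rightarrow> nat \<Rightarrow> nat \<Rightarrow> real \<Rightarrow> bool" where
  "cc_code W N M \<epsilon> \<longleftrightarrow> (\<exists>f dec.
      (\<forall>m\<in>{1..M}. length (f m) = N) \<and>
      (\<forall>ys. length ys = N \<longrightarrow> dec ys \<in> {1..M}) \<and>
      (\<forall>m\<in>{1..M}. \<forall>m'\<in>{1..M}. \<forall>a. count_list (f m) a = count_list (f m') a) \<and>
      avg_error W N M f dec \<le> \<epsilon>)"

definition M_star_c :: "('x \<Rightarrow> 'y::finite \<Rightarrow> real) \<Rightarrow> nat \<Rightarrow> real \<Rightarrow> nat" where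
  "M_star_c W N \<epsilon> = Max {M. \<exists>R::real. M = nat \<lceil>exp (real N * R)\<rceil> \<and> cc_code W N M \<epsilon>}"

end

theory Submission
  imports Defs
begin

text \<open>
  On a singular channel \<open>W x y\<close> is either \<open>0\<close> or a number \<open>w y\<close> that does not depend on the
  input, so for every output distribution \<open>q\<close> the information density
  \<open>S = (\<Sum>i<N. ln (w (ys ! i) / q (ys ! i)))\<close> is a function of the output word alone. Each output word is
  decoded to one message, hence a constant composition code with \<open>M\<close> codewords and error at most \<open>\<epsilon>\<close>
  satisfies, for every threshold \<open>l\<close>, that \<open>1 - \<epsilon>\<close> is at most the probability of \<open>S > l\<close> given some
  codeword plus \<open>1/M\<close> times the expectation of \<open>exp S\<close> on \<open>S \<le> l\<close> under the product of \<open>q\<close>.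
  The second term is \<open>O(exp l / (M * sqrt N))\<close> because a sum of \<open>N\<close> independent variables puts mass
  \<open>O(1 / sqrt N)\<close> on a bounded interval; this gain cancels the usual \<open>ln N / 2\<close>. With
  \<open>l = ln M\<close>, the Berry--Esseen theorem (proved by Stein's method) bounds the first term, again up to
  \<open>O(1 / sqrt N)\<close>.

  For a code of type \<open>P\<close> we take \<open>q\<close> to be the average of the capacity-achieving output distribution
  and the output distribution of \<open>P\<close>. Then \<open>q\<close> is bounded away from \<open>0\<close> uniformly in \<open>P\<close>, and
  the mean of \<open>S / N\<close> falls below the capacity linearly in the mass \<open>P\<close> puts on inputs violating
  complementary slackness and quadratically in the output deviation. The dispersion is Lipschitz in the
  same two quantities around its extremal value over the capacity-achieving polytope, so types away from that
  polytope cost only a constant.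
\<close>

section \<open>Standard normal distribution\<close>

text \<open>The type \<open>P\<close> is arbitrary and may vary with \<open>N\<close>, so every
  constant must be uniform over input distributions; this shapes the reference law. Under
  \<open>q_out P W\<close> alone, rare letters make the score unbounded. Under \<open>qs\<close>
  alone, the mean is the sum of \<open>P x * D x\<close>, which does not see a deviation of the
  output law from \<open>qs\<close>, although the dispersion may change with it. The mixture
  \<open>qb P\<close> avoids both defects. A quadratic loss in the deviation is enough: at gap
  \<open>b\<close> the dispersion term gains at most \<open>E * sqrt N * b\<close> and the mean
  loses \<open>c * N * b^2\<close>; the difference never exceeds \<open>E^2 / (4 * c)\<close>,
  whatever \<open>N\<close> is. This needs a dispersion that changes linearly in the distance from
  the optimal inputs, which \<open>exact_penalty\<close> derives from polyhedrality. The sign of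
  \<open>Phi_inv \<epsilon>\<close> decides whether a small or a large dispersion favours the code,
  and so which extremum counts. One inequality, \<open>concentration\<close>, serves twice: a
  clipped linear test function controls the jump in Stein's equation, an exponential one gives the
  factor \<open>1 / sqrt N\<close> that removes the logarithm.\<close>

lemma Phi_eq_cdf: "Phi = cdf std_normal_distribution"
proof
  fix x
  have "cdf std_normal_distribution x = (LINT t|std_normal_distribution. indicator {..x} t)"
    by (simp add: cdf_def2)
  also have "\<dots> = (LBINT t. std_normal_density t * indicator {..x} t)"
    by (subst integral_real_density) auto
  also have "\<dots> = Phi x"
    by (simp add: Phi_def set_lebesgue_integral_def mult.commute)
  finally show "Phi x = cdf std_normal_distribution x" ..
qed

lemma std_normal_density_deriv:
  "(std_normal_density has_real_derivative - x * std_normal_density x) (at x within S)"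
  unfolding std_normal_density_def
  by (auto intro!: derivative_eq_intros simp: field_simps)

lemma continuous_on_std_normal_density: "continuous_on S std_normal_density"
  by (meson DERIV_continuous_on std_normal_density_deriv)

text \<open>Cutting the half-line at \<open>x - 1\<close> leaves an integral over a compact interval
  with moving end point, to which the fundamental theorem of calculus applies.\<close>

lemma Phi_deriv: "(Phi has_real_derivative std_normal_density x) (at x)"
proof -
  let ?f = "std_normal_density"
  let ?a = "x - 1" and ?b = "x + 1"
  have int: "set_integrable lborel S ?f" if "S \<in> sets borel" for S
    unfolding set_integrable_def real_scaleR_def
    using that integrable_real_mult_indicator[of S lborel "std_normal_density"]
    by (simp add: mult.commute)
  have eq: "Phi t = Phi ?a + integral {?a..t} ?f" if "t \<in> {?a..?b}" for t
  proof -
    have "Phi t = (LBINT s:{..?a} \<union> {?a<..t}. ?f s)"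
      unfolding Phi_def using that by (intro arg_cong[where f="\<lambda>A. set_lebesgue_integral lborel A ?f"]) auto
    also have "\<dots> = Phi ?a + (LBINT s:{?a<..t}. ?f s)"
      unfolding Phi_def by (intro set_integral_Un int) auto
    also have "(LBINT s:{?a<..t}. ?f s) = (LBINT s:{?a..t}. ?f s)"
      by (intro set_integral_cong_set) (auto intro!: AE_I[where N="{?a}"] simp: set_borel_measurable_def)
    also have "\<dots> = integral {?a..t} ?f"
      by (intro set_borel_integral_eq_integral int) auto
    finally show ?thesis .
  qed
  have "((\<lambda>t. integral {?a..t} ?f) has_real_derivative ?f x) (at x within {?a..?b})"
    by (rule integral_has_real_derivative) (auto intro: continuous_on_std_normal_density)
  then have "((\<lambda>t. Phi ?a + integral {?a..t} ?f) has_real_derivative ?f x) (at x within {?a..?b})"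
    using DERIV_add[OF DERIV_const[of "Phi ?a"]] by simp
  then have "(Phi has_real_derivative ?f x) (at x within {?a..?b})"
    by (rule has_field_derivative_transform_within[where d=1]) (use eq in \<open>auto simp only: eq[symmetric]\<close>, auto)
  moreover have "at x within {?a..?b} = at x"
    by (rule at_within_interior) auto
  ultimately show ?thesis by simp
qed

lemmas Phi_deriv' [derivative_intros] = DERIV_chain2[OF Phi_deriv]

lemma isCont_Phi: "isCont Phi x"
  using Phi_deriv DERIV_isCont by blast

lemma Phi_strict_mono: "x < y \<Longrightarrow> Phi x < Phi y"
  by (rule DERIV_pos_imp_increasing) (use Phi_deriv normal_density_pos[of 1] in \<open>auto intro!: exI\<close>)

lemma Phi_mono: "x \<le> y \<Longrightarrow> Phi x \<le> Phi y"
  using Phi_strict_mono[of x y] by (cases "x = y") auto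

lemma Phi_less_iff: "Phi x < Phi y \<longleftrightarrow> x < y"
  by (meson Phi_mono Phi_strict_mono not_le)

lemma Phi_le_iff: "Phi x \<le> Phi y \<longleftrightarrow> x \<le> y"
  by (meson Phi_less_iff not_le)

lemma Phi_at_top: "(Phi \<longlongrightarrow> 1) at_top"
  and Phi_at_bot: "(Phi \<longlongrightarrow> 0) at_bot"
proof -
  interpret real_distribution std_normal_distribution by (rule real_dist_normal_dist)
  show "(Phi \<longlongrightarrow> 1) at_top" "(Phi \<longlongrightarrow> 0) at_bot"
    unfolding Phi_eq_cdf using cdf_lim_at_top_prob cdf_lim_at_bot by auto
qed

lemma Phi_ge_0: "0 \<le> Phi x" and Phi_le_1: "Phi x \<le> 1"
proof -
  interpret real_distribution std_normal_distribution by (rule real_dist_normal_dist)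
  show "0 \<le> Phi x" "Phi x \<le> 1"
    unfolding Phi_eq_cdf using cdf_nonneg cdf_bounded_prob by auto
qed

text \<open>The derivative of \<open>Phi x + Phi (- x)\<close> vanishes because the density is even;
  the limit at infinity fixes the constant.\<close>

lemma Phi_minus: "Phi (- x) = 1 - Phi x"
proof -
  have "((\<lambda>x. Phi x + Phi (- x)) has_real_derivative 0) (at x)" for x
    by (auto intro!: derivative_eq_intros simp: std_normal_density_def)
  then have *: "Phi x + Phi (- x) = Phi 0 + Phi (- 0)" for x
    using DERIV_isconst_all by blast
  have "((\<lambda>x. Phi x + Phi (- x)) \<longlongrightarrow> 1 + 0) at_top"
    by (intro tendsto_add Phi_at_top filterlim_compose[OF Phi_at_bot] filterlim_uminus_at_bot_at_top)
  then have "((\<lambda>x::real. Phi 0 + Phi (- 0)) \<longlongrightarrow> 1) at_top"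
    by (subst (asm) *) simp
  then have "Phi 0 + Phi (- 0) = 1"
    by (simp add: tendsto_const_iff)
  with *[of x] show ?thesis by linarith
qed

lemma Phi_0: "Phi 0 = 1 / 2"
  using Phi_minus[of 0] by simp

lemma Phi_Phi_inv:
  assumes "0 < p" "p < 1"
  shows "Phi (Phi_inv p) = p"
proof -
  obtain a where a: "Phi a < p"
    using order_tendstoD(2)[OF Phi_at_bot assms(1)] by (metis eventually_at_bot_linorder order_refl)
  obtain b where b: "p < Phi b"
    using order_tendstoD(1)[OF Phi_at_top assms(2)] by (metis eventually_at_top_linorder order_refl)
  have "a \<le> b" using a b Phi_less_iff by (meson less_trans less_imp_le)
  then obtain z where z: "Phi z = p"
    using IVT[of Phi a p b] a b isCont_Phi by (auto simp: less_imp_le)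
  moreover have "z' = z" if "Phi z' = p" for z'
    using that z by (metis Phi_less_iff less_irrefl linorder_neqE_linordered_idom)
  ultimately show ?thesis
    unfolding Phi_inv_def by (metis (mono_tags, lifting) theI)
qed

lemma Phi_inv_neg: "0 < p \<Longrightarrow> p < 1/2 \<Longrightarrow> Phi_inv p < 0"
  using Phi_Phi_inv[of p] Phi_0 Phi_less_iff[of "Phi_inv p" 0] by simp

lemma Phi_inv_pos: "1/2 < p \<Longrightarrow> p < 1 \<Longrightarrow> 0 < Phi_inv p"
  using Phi_Phi_inv[of p] Phi_0 Phi_less_iff[of 0 "Phi_inv p"] by simp

text \<open>Just to the right of \<open>Phi_inv p\<close> the density has a positive lower bound, so
  an excess \<open>d\<close> in probability shifts the quantile by at most a multiple of
  \<open>d\<close>. With \<open>d\<close> of order \<open>1 / sqrt N\<close>, the shift times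
  \<open>sqrt N\<close> is a constant. The cap \<open>h\<close> keeps the shift inside the unit
  window where the lower bound holds.\<close>

lemma Phi_inv_perturb:
  assumes p: "0 < p" "p < 1"
  obtains c h where "0 < c" "0 < h"
    "\<And>z d. 0 \<le> d \<Longrightarrow> d \<le> h \<Longrightarrow> Phi z \<le> p + d \<Longrightarrow> z \<le> Phi_inv p + c * d"
proof -
  define z0 where "z0 = Phi_inv p"
  have z0: "Phi z0 = p" using Phi_Phi_inv[OF p] z0_def by simp
  define r where "r = std_normal_density (\<bar>z0\<bar> + 1)"
  have r: "0 < r" by (simp add: r_def normal_density_pos)
  have slope: "Phi z0 + r * t \<le> Phi (z0 + t)" if "0 \<le> t" "t \<le> 1" for t
  proof (cases "t = 0")
    case False
    then have "z0 < z0 + t" using that by simp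
    then obtain u where u: "z0 < u" "u < z0 + t" "Phi (z0 + t) - Phi z0 = (z0 + t - z0) * std_normal_density u"
      using MVT2[of z0 "z0 + t" Phi std_normal_density] Phi_deriv by blast
    have "\<bar>u\<bar> \<le> \<bar>z0\<bar> + 1" using u that by linarith
    then have "u\<^sup>2 \<le> (\<bar>z0\<bar> + 1)\<^sup>2" by (metis abs_ge_zero abs_le_square_iff abs_of_nonneg add_nonneg_nonneg zero_le_one)
    then have "r \<le> std_normal_density u"
      by (simp add: r_def std_normal_density_def divide_right_mono)
    then have "r * t \<le> t * std_normal_density u" using that by (metis mult.commute mult_right_mono)
    moreover have "z0 + t - z0 = t" by simp
    ultimately show ?thesis using u(3) by (metis add.commute diff_le_eq diff_diff_eq2 le_diff_eq)
  qed simp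
  have "z \<le> z0 + 1 / r * d" if d: "0 \<le> d" "d \<le> r" "Phi z \<le> p + d" for z d
  proof -
    have "Phi z \<le> Phi (z0 + d / r)"
      using slope[of "d / r"] d r z0 by simp
    then show ?thesis using Phi_le_iff by simp
  qed
  with r show ?thesis
    by (intro that[of "1 / r" r]) (auto simp: z0_def)
qed

text \<open>Density over \<open>x\<close> minus the tail is decreasing on the positive axis and
  tends to 0, hence is nonnegative.\<close>

lemma mills_ratio:
  assumes "0 < x"
  shows "x * (1 - Phi x) \<le> std_normal_density x"
proof -
  define h where "h = (\<lambda>x. std_normal_density x / x - (1 - Phi x))"
  have d: "(h has_real_derivative - std_normal_density y / y\<^sup>2) (at y)" if "0 < y" for y
    unfolding h_def using that
    by (auto intro!: derivative_eq_intros std_normal_density_deriv simp: field_simps power2_eq_square)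
  have anti: "h z \<le> h x" if "x < z" for z
  proof (rule DERIV_nonpos_imp_nonincreasing[OF less_imp_le[OF that]])
    fix y assume "x \<le> y" "y \<le> z"
    then show "\<exists>m. (h has_real_derivative m) (at y) \<and> m \<le> 0"
      using d[of y] assms by (intro exI[of _ "- std_normal_density y / y\<^sup>2"]) auto
  qed
  have sd: "(std_normal_density \<longlongrightarrow> 0) at_top"
    unfolding std_normal_density_def by real_asymp
  have "((\<lambda>y. std_normal_density y * inverse y - (1 - Phi y)) \<longlongrightarrow> 0 * 0 - (1 - 1)) at_top"
    by (intro tendsto_diff tendsto_mult tendsto_const Phi_at_top sd tendsto_inverse_0_at_top filterlim_ident)
  then have "(h \<longlongrightarrow> 0) at_top" by (simp add: h_def divide_inverse)
  then have "0 \<le> h x"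
    by (rule tendsto_upperbound) (auto intro!: eventually_at_top_linorderI[of "x + 1"] anti)
  then show ?thesis using assms by (simp add: h_def field_simps)
qed

text \<open>The Mills bound degenerates at 0, so it is used only beyond 1; on the unit interval the
  density is at least its value at 1.\<close>

lemma mills_ratio_bounded:
  obtains B where "0 < B" "\<And>x. 0 \<le> x \<Longrightarrow> 1 - Phi x \<le> B * std_normal_density x"
proof
  define B where "B = 1 + 1 / std_normal_density 1"
  have p: "0 < std_normal_density x" for x by (simp add: normal_density_pos)
  show "0 < B" using p[of 1] by (simp add: B_def add_pos_pos)
  fix x :: real assume x: "0 \<le> x"
  show "1 - Phi x \<le> B * std_normal_density x"
  proof (cases "x \<le> 1")
    case True
    then have "std_normal_density 1 \<le> std_normal_density x"
      using x by (simp add: std_normal_density_def divide_right_mono power_le_one)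
    then have "1 \<le> 1 / std_normal_density 1 * std_normal_density x" using p[of 1] by simp
    moreover have "1 - Phi x \<le> 1" using Phi_ge_0[of x] by simp
    ultimately show ?thesis using p[of x] unfolding B_def distrib_right by linarith
  next
    case False
    have "1 - Phi x \<le> x * (1 - Phi x)"
      using False Phi_le_1[of x] mult_right_mono[of 1 x "1 - Phi x"] by simp
    also have "\<dots> \<le> std_normal_density x" using mills_ratio[of x] x False by simp
    also have "\<dots> \<le> B * std_normal_density x" using p[of 1] p[of x] by (simp add: B_def)
    finally show ?thesis .
  qed
qed

section \<open>Stein equation for the normal distribution\<close>

text \<open>The bounded solution \<open>f\<close> of Stein's equation: \<open>f' w - w * f w\<close>
  is the indicator of \<open>w \<le> z\<close> minus \<open>Phi z\<close>. The two branches of the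
  classical formula are merged by \<open>min\<close> and \<open>max\<close>.\<close>

definition stein_sol :: "real \<Rightarrow> real \<Rightarrow> real" where
  "stein_sol z w = Phi (min w z) * (1 - Phi (max w z)) / std_normal_density w"

text \<open>Read off from Stein's equation. At the kink \<open>w = z\<close> it is the left
  derivative, so the equation holds at every point and can be inserted under an expectation.\<close>

definition stein_deriv :: "real \<Rightarrow> real \<Rightarrow> real" where
  "stein_deriv z w = w * stein_sol z w + (if w \<le> z then 1 else 0) - Phi z"

lemma std_normal_density_pos': "0 < std_normal_density x"
  by (simp add: normal_density_pos)

lemma stein_sol_nonneg: "0 \<le> stein_sol z w"
  using Phi_ge_0 Phi_le_1 std_normal_density_pos'[of w] by (simp add: stein_sol_def)

lemma stein_sol_le:
  "stein_sol z w \<le> (1 - Phi \<bar>w\<bar>) / std_normal_density w"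
proof -
  have "Phi (min w z) * (1 - Phi (max w z)) \<le> 1 - Phi \<bar>w\<bar>"
  proof (cases "0 \<le> w")
    case True
    have "Phi (min w z) * (1 - Phi (max w z)) \<le> 1 * (1 - Phi w)"
      by (intro mult_mono) (use Phi_ge_0 Phi_le_1 Phi_mono[of w "max w z"] in auto)
    with True show ?thesis by simp
  next
    case False
    have "Phi (min w z) * (1 - Phi (max w z)) \<le> Phi w * 1"
      by (intro mult_mono) (use Phi_ge_0 Phi_le_1 Phi_mono[of "min w z" w] in auto)
    with False show ?thesis using Phi_minus[of w] by simp
  qed
  then show ?thesis
    unfolding stein_sol_def using std_normal_density_pos'[of w] by (intro divide_right_mono) auto
qed

lemma stein_sol_bounded:
  obtains B where "0 < B" "\<And>z w. stein_sol z w \<le> B"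
proof -
  obtain B where B: "0 < B" "\<And>x. 0 \<le> x \<Longrightarrow> 1 - Phi x \<le> B * std_normal_density x"
    using mills_ratio_bounded by blast
  have "stein_sol z w \<le> B" for z w
  proof -
    have "std_normal_density \<bar>w\<bar> = std_normal_density w" by (simp add: std_normal_density_def)
    then show ?thesis using stein_sol_le[of z w] B(2)[of "\<bar>w\<bar>"] std_normal_density_pos'[of w]
      by (smt (verit) divide_le_eq abs_ge_zero)
  qed
  with B that show ?thesis by blast
qed

lemma abs_mult_stein_sol_le: "\<bar>w * stein_sol z w\<bar> \<le> 1"
proof (cases "w = 0")
  case False
  have e: "std_normal_density \<bar>w\<bar> = std_normal_density w" by (simp add: std_normal_density_def)
  have "\<bar>w * stein_sol z w\<bar> = \<bar>w\<bar> * stein_sol z w"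
    using stein_sol_nonneg[of z w] by (simp add: abs_mult)
  also have "\<dots> \<le> \<bar>w\<bar> * ((1 - Phi \<bar>w\<bar>) / std_normal_density w)"
    by (intro mult_left_mono stein_sol_le) auto
  also have "\<dots> \<le> 1"
    using mills_ratio[of "\<bar>w\<bar>"] False e std_normal_density_pos'[of w] by (simp add: field_simps)
  finally show ?thesis .
qed simp

lemma abs_stein_deriv_le: "\<bar>stein_deriv z w\<bar> \<le> 2"
  using abs_mult_stein_sol_le[of w z] Phi_ge_0[of z] Phi_le_1[of z]
  unfolding stein_deriv_def by (auto split: if_splits)

lemma isCont_stein_sol: "isCont (stein_sol z) w"
  unfolding stein_sol_def
  by (intro continuous_intros isCont_o2[OF _ isCont_Phi] DERIV_isCont[OF std_normal_density_deriv])
     (use std_normal_density_pos'[of w] in \<open>auto intro!: continuous_intros\<close>)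

lemma stein_sol_measurable [measurable]: "stein_sol z \<in> borel_measurable borel"
  by (intro borel_measurable_continuous_onI continuous_at_imp_continuous_on ballI isCont_stein_sol)

lemma stein_deriv_measurable [measurable]: "stein_deriv z \<in> borel_measurable borel"
  unfolding stein_deriv_def by measurable

lemma stein_sol_deriv:
  assumes "w \<noteq> z"
  shows "(stein_sol z has_real_derivative stein_deriv z w) (at w)"
proof (cases "w < z")
  case True
  have "((\<lambda>w. Phi w * (1 - Phi z) / std_normal_density w) has_real_derivative stein_deriv z w) (at w)"
    using std_normal_density_pos'[of w] True
    by (auto intro!: derivative_eq_intros std_normal_density_deriv
        simp: stein_deriv_def stein_sol_def field_simps)
  then show ?thesis
    by (rule has_field_derivative_transform_within_open[where S="{..<z}"])
       (use True in \<open>auto simp: stein_sol_def min_def max_def\<close>)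
next
  case False
  have "((\<lambda>w. Phi z * (1 - Phi w) / std_normal_density w) has_real_derivative stein_deriv z w) (at w)"
    using std_normal_density_pos'[of w] False assms
    by (auto intro!: derivative_eq_intros std_normal_density_deriv
        simp: stein_deriv_def stein_sol_def field_simps)
  then show ?thesis
    by (rule has_field_derivative_transform_within_open[where S="{z<..}"])
       (use False assms in \<open>auto simp: stein_sol_def min_def max_def\<close>)
qed

text \<open>The derivative bound 2 applies on each side of the kink; an interval containing
  \<open>z\<close> is split there.\<close>

lemma stein_sol_lipschitz: "\<bar>stein_sol z x - stein_sol z y\<bar> \<le> 2 * \<bar>x - y\<bar>"
proof -
  have *: "\<bar>stein_sol z b - stein_sol z a\<bar> \<le> 2 * (b - a)" if "a \<le> b" "z \<le> a \<or> b \<le> z" for a b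
  proof (cases "a = b")
    case False
    then have "a < b" using that by simp
    moreover have "continuous_on {a..b} (stein_sol z)"
      by (intro continuous_at_imp_continuous_on ballI isCont_stein_sol)
    moreover have "(stein_sol z has_derivative (*) (stein_deriv z x)) (at x)" if "a < x" "x < b" for x
      using stein_sol_deriv[of x z] that \<open>z \<le> a \<or> b \<le> z\<close>
      by (auto simp: has_field_derivative_def)
    ultimately obtain \<xi> where "stein_sol z b - stein_sol z a = stein_deriv z \<xi> * (b - a)"
      using mvt[of a b "stein_sol z" "\<lambda>x. (*) (stein_deriv z x)"] by blast
    then show ?thesis using mult_right_mono[OF abs_stein_deriv_le[of z \<xi>], of "b - a"] \<open>a < b\<close>
      by (simp add: abs_mult)
  qed simp
  have "\<bar>stein_sol z b - stein_sol z a\<bar> \<le> 2 * (b - a)" if "a \<le> b" for a b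
    using that *[of a b] *[of a z] *[of z b] by (smt (verit))
  from this[of x y] this[of y x] show ?thesis by (auto simp: abs_if split: if_splits)
qed

text \<open>By Stein's equation the derivative is \<open>w * stein_sol z w\<close>, which is locally
  Lipschitz, plus a step at \<open>z\<close>. Farther than \<open>\<delta>\<close> from
  \<open>z\<close> the step does not interfere; closer, only the bound 2 on the derivative is
  available, and two such terms give the 4.\<close>

lemma stein_sol_taylor:
  assumes B: "\<And>z w. stein_sol z w \<le> B" and s: "\<bar>s\<bar> \<le> \<delta>"
  shows "\<bar>stein_sol z (w + s) - stein_sol z w - s * stein_deriv z w\<bar>
     \<le> \<bar>s\<bar> * ((2 * \<bar>w\<bar> + B) * \<delta> + (if \<bar>w - z\<bar> \<le> \<delta> then 4 else 0))"
    and "\<bar>stein_deriv z (w + s) - stein_deriv z w\<bar> \<le> (2 * \<bar>w\<bar> + B) * \<delta> + (if \<bar>w - z\<bar> \<le> \<delta> then 4 else 0)"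
proof -
  have prod: "\<bar>(w + u) * stein_sol z (w + u) - w * stein_sol z w\<bar> \<le> (2 * \<bar>w\<bar> + B) * \<delta>"
    if u: "\<bar>u\<bar> \<le> \<delta>" for u
  proof -
    have "(w + u) * stein_sol z (w + u) - w * stein_sol z w
        = w * (stein_sol z (w + u) - stein_sol z w) + u * stein_sol z (w + u)"
      by (simp add: algebra_simps)
    also have "\<bar>\<dots>\<bar> \<le> \<bar>w\<bar> * \<bar>stein_sol z (w + u) - stein_sol z w\<bar> + \<bar>u\<bar> * stein_sol z (w + u)"
      using stein_sol_nonneg[of z "w + u"] abs_triangle_ineq abs_mult by (metis abs_of_nonneg)
    also have "\<dots> \<le> \<bar>w\<bar> * (2 * \<delta>) + \<delta> * B"
      using stein_sol_lipschitz[of z "w + u" w] u B[of z "w + u"] stein_sol_nonneg[of z "w + u"]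
      by (intro add_mono mult_left_mono mult_mono) auto
    finally show ?thesis by (simp add: algebra_simps)
  qed
  \<comment> \<open>Here \<open>w\<close> and \<open>w + u\<close> lie on the same side of
    \<open>z\<close>, so the indicators cancel.\<close>
  have dev: "\<bar>stein_deriv z (w + u) - stein_deriv z w\<bar> \<le> (2 * \<bar>w\<bar> + B) * \<delta>"
    if "\<bar>u\<bar> \<le> \<delta>" "\<delta> < \<bar>w - z\<bar>" for u
    using prod[of u] that unfolding stein_deriv_def by (auto split: if_splits)
  have B0: "0 \<le> (2 * \<bar>w\<bar> + B) * \<delta>"
    using prod[OF s] by (smt (verit))
  show "\<bar>stein_deriv z (w + s) - stein_deriv z w\<bar> \<le> (2 * \<bar>w\<bar> + B) * \<delta> + (if \<bar>w - z\<bar> \<le> \<delta> then 4 else 0)"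
    using dev[OF s] B0 abs_stein_deriv_le[of z "w + s"] abs_stein_deriv_le[of z w] by (auto split: if_splits)
  show "\<bar>stein_sol z (w + s) - stein_sol z w - s * stein_deriv z w\<bar>
     \<le> \<bar>s\<bar> * ((2 * \<bar>w\<bar> + B) * \<delta> + (if \<bar>w - z\<bar> \<le> \<delta> then 4 else 0))"
  proof (cases "\<bar>w - z\<bar> \<le> \<delta>")
    case True
    have "\<bar>stein_sol z (w + s) - stein_sol z w - s * stein_deriv z w\<bar> \<le> 2 * \<bar>s\<bar> + \<bar>s\<bar> * 2"
      using stein_sol_lipschitz[of z "w + s" w] mult_left_mono[OF abs_stein_deriv_le[of z w], of "\<bar>s\<bar>"]
      by (simp add: abs_mult[symmetric])
    then show ?thesis using True mult_nonneg_nonneg[OF abs_ge_zero[of s] B0] by (simp add: distrib_left)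
  next
    case False
    show ?thesis
    proof (cases "s = 0")
      case s0: False
      define a b where "a = min w (w + s)" and "b = max w (w + s)"
      have "a < b" using s0 by (auto simp: a_def b_def)
      moreover have "(stein_sol z has_real_derivative stein_deriv z x) (at x)" if "a \<le> x" "x \<le> b" for x
        using that s False by (intro stein_sol_deriv) (auto simp: a_def b_def)
      ultimately obtain \<xi> where \<xi>: "a < \<xi>" "\<xi> < b"
          "stein_sol z b - stein_sol z a = (b - a) * stein_deriv z \<xi>"
        using MVT2[of a b "stein_sol z" "stein_deriv z"] by blast
      have eq: "stein_sol z (w + s) - stein_sol z w = s * stein_deriv z \<xi>"
        using \<xi>(3) by (auto simp: a_def b_def min_def max_def algebra_simps split: if_splits)
      have "\<bar>stein_deriv z (w + (\<xi> - w)) - stein_deriv z w\<bar> \<le> (2 * \<bar>w\<bar> + B) * \<delta>"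
        using \<xi>(1,2) s False by (intro dev) (auto simp: a_def b_def)
      then have "\<bar>s\<bar> * \<bar>stein_deriv z \<xi> - stein_deriv z w\<bar> \<le> \<bar>s\<bar> * ((2 * \<bar>w\<bar> + B) * \<delta>)"
        by (intro mult_left_mono) auto
      then show ?thesis using False
        by (simp add: eq abs_mult[symmetric] right_diff_distrib)
    qed simp
  qed
qed

section \<open>Normal approximation for bounded independent summands\<close>

text \<open>The arithmetic-geometric mean inequality; it turns second moments into bounds on first
  absolute moments, with \<open>c\<close> chosen to match their size.\<close>

lemma abs_le_square_average:
  fixes a :: real
  assumes "0 < c"
  shows "\<bar>a\<bar> \<le> (a\<^sup>2 / c + c) / 2"
proof -
  have "0 \<le> (\<bar>a\<bar> - c)\<^sup>2" by simp
  then have "2 * \<bar>a\<bar> * c \<le> a\<^sup>2 + c\<^sup>2" by (simp add: power2_diff)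
  then show ?thesis using assms by (simp add: field_simps power2_eq_square)
qed

section \<open>Second moments of bounded independent variables\<close>

context prob_space
begin

lemma integrable_bounded:
  fixes f :: "'a \<Rightarrow> real"
  assumes "f \<in> borel_measurable M" "\<And>\<omega>. \<omega> \<in> space M \<Longrightarrow> \<bar>f \<omega>\<bar> \<le> c"
  shows "integrable M f"
  by (rule integrable_const_bound[where B=c]) (use assms in auto)

lemma expectation_mono_bounded:
  fixes f g :: "'a \<Rightarrow> real"
  assumes "integrable M f" "integrable M g" "\<And>\<omega>. \<omega> \<in> space M \<Longrightarrow> f \<omega> \<le> g \<omega>"
  shows "expectation f \<le> expectation g"
  using assms by (intro integral_mono) auto

lemma expectation_sum_square:
  fixes X :: "'i \<Rightarrow> 'a \<Rightarrow> real"
  assumes "finite J" "indep_vars (\<lambda>_. borel) X J"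
    and "\<And>i \<omega>. i \<in> J \<Longrightarrow> \<omega> \<in> space M \<Longrightarrow> \<bar>X i \<omega>\<bar> \<le> c"
    and "\<And>i. i \<in> J \<Longrightarrow> expectation (X i) = 0"
  shows "expectation (\<lambda>\<omega>. (\<Sum>i\<in>J. X i \<omega>)\<^sup>2) = (\<Sum>i\<in>J. expectation (\<lambda>\<omega>. (X i \<omega>)\<^sup>2))"
  using assms
proof (induction J rule: finite_induct)
  case (insert j J)
  have [measurable]: "X i \<in> borel_measurable M" if "i \<in> insert j J" for i
    using insert.prems(1) that unfolding indep_vars_def by auto
  have c: "\<bar>\<Sum>i\<in>J. X i \<omega>\<bar> \<le> real (card J) * c" if "\<omega> \<in> space M" for \<omega>
    using insert.prems(2)[OF _ that] by (intro sum_norm_bound[where 'a=real, unfolded real_norm_def]) auto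
  have sq: "\<bar>a\<bar> \<le> b \<Longrightarrow> \<bar>a\<^sup>2\<bar> \<le> b\<^sup>2" for a b :: real by (metis abs_le_square_iff abs_of_nonneg abs_ge_zero order_trans abs_power2)
  have i1: "integrable M (\<lambda>\<omega>. \<Sum>i\<in>J. X i \<omega>)"
    by (rule integrable_bounded[OF _ c]) auto
  have i2: "integrable M (X j)"
    using insert.prems(2) by (intro integrable_bounded[where c=c]) auto
  have i3: "integrable M (\<lambda>\<omega>. (\<Sum>i\<in>J. X i \<omega>)\<^sup>2)"
    using sq[OF c] by (intro integrable_bounded[where c="(real (card J) * c)\<^sup>2"]) auto
  have i4: "integrable M (\<lambda>\<omega>. (X j \<omega>)\<^sup>2)"
    using sq[OF insert.prems(2)] by (intro integrable_bounded[where c="c\<^sup>2"]) auto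
  have ind: "indep_var borel (X j) borel (\<lambda>\<omega>. \<Sum>i\<in>J. X i \<omega>)"
    using insert by (intro indep_vars_sum) auto
  note cross = indep_var_lebesgue_integral[OF ind i2 i1] indep_var_integrable[OF ind i2 i1]
  have "expectation (\<lambda>\<omega>. (\<Sum>i\<in>insert j J. X i \<omega>)\<^sup>2) =
        expectation (\<lambda>\<omega>. (X j \<omega>)\<^sup>2 + (\<Sum>i\<in>J. X i \<omega>)\<^sup>2 + 2 * (X j \<omega> * (\<Sum>i\<in>J. X i \<omega>)))"
    using insert by (simp add: power2_sum algebra_simps)
  also have "\<dots> = expectation (\<lambda>\<omega>. (X j \<omega>)\<^sup>2) + expectation (\<lambda>\<omega>. (\<Sum>i\<in>J. X i \<omega>)\<^sup>2)"
    using i3 i4 cross insert.prems(3)[of j] by simp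
  also have "expectation (\<lambda>\<omega>. (\<Sum>i\<in>J. X i \<omega>)\<^sup>2) = (\<Sum>i\<in>J. expectation (\<lambda>\<omega>. (X i \<omega>)\<^sup>2))"
    using insert.prems by (intro insert.IH) (auto intro: indep_vars_subset)
  finally show ?case using insert by simp
qed simp

end

locale bounded_indep_sum = prob_space +
  fixes X :: "'i \<Rightarrow> 'a \<Rightarrow> real" and I :: "'i set" and \<delta> :: real
  assumes fin: "finite I"
    and indep: "indep_vars (\<lambda>_. borel) X I"
    and bounded: "\<And>i \<omega>. i \<in> I \<Longrightarrow> \<omega> \<in> space M \<Longrightarrow> \<bar>X i \<omega>\<bar> \<le> \<delta>"
    and centered: "\<And>i. i \<in> I \<Longrightarrow> expectation (X i) = 0"
    and normalized: "(\<Sum>i\<in>I. expectation (\<lambda>\<omega>. (X i \<omega>)\<^sup>2)) = 1"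
begin

definition "S \<omega> = (\<Sum>i\<in>I. X i \<omega>)"
text \<open>Leave-one-out sum: for \<open>i\<close> in \<open>I\<close> it is independent of
  \<open>X i\<close> and within \<open>\<delta>\<close> of \<open>S\<close>, which makes it the
  comparison variable of Stein's method.\<close>

definition "R i \<omega> = (\<Sum>j\<in>I - {i}. X j \<omega>)"
definition "v i = expectation (\<lambda>\<omega>. (X i \<omega>)\<^sup>2)"

lemma X_measurable [measurable]: "i \<in> I \<Longrightarrow> X i \<in> borel_measurable M"
  using indep unfolding indep_vars_def by auto

lemma S_measurable [measurable]: "S \<in> borel_measurable M"
  unfolding S_def by measurable

lemma R_measurable [measurable]: "R i \<in> borel_measurable M"
  unfolding R_def by measurable

lemma S_eq: "i \<in> I \<Longrightarrow> S \<omega> = R i \<omega> + X i \<omega>"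
  unfolding S_def R_def using fin by (simp add: sum.remove add.commute)

lemma delta_pos: "0 < \<delta>"
proof -
  have "\<exists>i\<in>I. expectation (\<lambda>\<omega>. (X i \<omega>)\<^sup>2) \<noteq> 0"
    by (rule ccontr) (use normalized in auto)
  then obtain i where i: "i \<in> I" "expectation (\<lambda>\<omega>. (X i \<omega>)\<^sup>2) \<noteq> 0"
    by blast
  have "\<exists>\<omega>\<in>space M. X i \<omega> \<noteq> 0"
  proof (rule ccontr)
    assume "\<not> ?thesis"
    then have "expectation (\<lambda>\<omega>. (X i \<omega>)\<^sup>2) = expectation (\<lambda>\<omega>. 0)"
      by (intro Bochner_Integration.integral_cong) auto
    with i show False by simp
  qed
  then show ?thesis using bounded[OF i(1)] by (smt (verit))
qed

lemma square_le: "i \<in> I \<Longrightarrow> \<omega> \<in> space M \<Longrightarrow> (X i \<omega>)\<^sup>2 \<le> \<delta>\<^sup>2"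
  using bounded delta_pos by (metis abs_le_square_iff abs_of_pos)

lemma sum_abs_le: "J \<subseteq> I \<Longrightarrow> \<omega> \<in> space M \<Longrightarrow> \<bar>\<Sum>j\<in>J. X j \<omega>\<bar> \<le> real (card I) * \<delta>"
proof -
  assume J: "J \<subseteq> I" "\<omega> \<in> space M"
  have "\<bar>\<Sum>j\<in>J. X j \<omega>\<bar> \<le> (\<Sum>j\<in>J. \<bar>X j \<omega>\<bar>)" by (rule sum_abs)
  also have "\<dots> \<le> (\<Sum>j\<in>I. \<bar>X j \<omega>\<bar>)" using fin J by (intro sum_mono2) auto
  also have "\<dots> \<le> real (card I) * \<delta>" using bounded J(2) by (intro sum_bounded_above) auto
  finally show ?thesis .
qed

lemma S_abs_le: "\<omega> \<in> space M \<Longrightarrow> \<bar>S \<omega>\<bar> \<le> real (card I) * \<delta>"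
  unfolding S_def by (rule sum_abs_le) auto

lemma R_abs_le: "\<omega> \<in> space M \<Longrightarrow> \<bar>R i \<omega>\<bar> \<le> real (card I) * \<delta>"
  unfolding R_def by (rule sum_abs_le) auto

lemma integrable_X: "i \<in> I \<Longrightarrow> integrable M (X i)"
  using bounded by (intro integrable_bounded) auto

lemma integrable_X2: "i \<in> I \<Longrightarrow> integrable M (\<lambda>\<omega>. (X i \<omega>)\<^sup>2)"
  using square_le by (intro integrable_bounded) auto

lemma v_nonneg: "0 \<le> v i"
  unfolding v_def by simp

lemma sum_v: "(\<Sum>i\<in>I. v i) = 1"
  using normalized by (simp add: v_def)

lemma expectation_abs_sum_le:
  assumes "J \<subseteq> I"
  shows "expectation (\<lambda>\<omega>. \<bar>\<Sum>j\<in>J. X j \<omega>\<bar>) \<le> 1"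
proof -
  let ?T = "\<lambda>\<omega>. \<Sum>j\<in>J. X j \<omega>"
  have finJ: "finite J" using assms fin finite_subset by auto
  have [measurable]: "?T \<in> borel_measurable M"
    using assms by (intro borel_measurable_sum) auto
  have b: "\<bar>?T \<omega>\<bar> \<le> real (card I) * \<delta>" if "\<omega> \<in> space M" for \<omega>
    using sum_abs_le[OF assms that] .
  have b2: "\<bar>(?T \<omega>)\<^sup>2\<bar> \<le> (real (card I) * \<delta>)\<^sup>2" if "\<omega> \<in> space M" for \<omega>
    using power_mono[OF b[OF that], of 2] by simp
  have i2: "integrable M (\<lambda>\<omega>. (?T \<omega>)\<^sup>2)" by (rule integrable_bounded[OF _ b2]) auto
  have i1: "integrable M (\<lambda>\<omega>. \<bar>?T \<omega>\<bar>)" using b by (intro integrable_bounded) auto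
  have "expectation (\<lambda>\<omega>. \<bar>?T \<omega>\<bar>) \<le> expectation (\<lambda>\<omega>. ((?T \<omega>)\<^sup>2 + 1) / 2)"
    using i2 abs_le_square_average[of 1] by (intro expectation_mono_bounded i1) auto
  also have "\<dots> = (expectation (\<lambda>\<omega>. (?T \<omega>)\<^sup>2) + 1) / 2"
    using i2 by (simp add: prob_space)
  also have "expectation (\<lambda>\<omega>. (?T \<omega>)\<^sup>2) = (\<Sum>j\<in>J. v j)"
    unfolding v_def using finJ assms bounded centered
    by (intro expectation_sum_square) (auto intro: indep_vars_subset[OF indep])
  also have "(\<Sum>j\<in>J. v j) \<le> 1"
    using sum_mono2[OF fin assms, of v] v_nonneg sum_v by simp
  finally show ?thesis by simp
qed

lemma expectation_abs_S: "expectation (\<lambda>\<omega>. \<bar>S \<omega>\<bar>) \<le> 1"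
  and expectation_abs_R: "expectation (\<lambda>\<omega>. \<bar>R i \<omega>\<bar>) \<le> 1"
  unfolding S_def R_def by (rule expectation_abs_sum_le, auto)+

text \<open>The centred squares are independent with second moments at most
  \<open>\<delta>\<^sup>2 * v i\<close>, so their sum has variance at most
  \<open>\<delta>\<^sup>2\<close>; \<open>abs_le_square_average\<close> with weight
  \<open>\<delta>\<close> does the rest.\<close>

lemma expectation_abs_sum_squares:
  "expectation (\<lambda>\<omega>. \<bar>(\<Sum>i\<in>I. (X i \<omega>)\<^sup>2) - 1\<bar>) \<le> \<delta>"
proof -
  define Y where "Y i \<omega> = (X i \<omega>)\<^sup>2 - v i" for i \<omega>
  have v_le: "v i \<le> \<delta>\<^sup>2" if "i \<in> I" for i
  proof -
    have "v i \<le> expectation (\<lambda>_. \<delta>\<^sup>2)"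
      unfolding v_def using that square_le integrable_X2 by (intro expectation_mono_bounded) auto
    then show ?thesis by (simp add: prob_space)
  qed
  have Yb: "\<bar>Y i \<omega>\<bar> \<le> \<delta>\<^sup>2" if "i \<in> I" "\<omega> \<in> space M" for i \<omega>
    using square_le[OF that] v_le[OF that(1)] v_nonneg[of i] zero_le_power2[of "X i \<omega>"]
    unfolding Y_def by (smt (verit))
  have Ym [measurable]: "Y i \<in> borel_measurable M" if "i \<in> I" for i
    unfolding Y_def using that by measurable
  have Y0: "expectation (Y i) = 0" if "i \<in> I" for i
    unfolding Y_def using integrable_X2[OF that] by (simp add: prob_space v_def)
  have Yind: "indep_vars (\<lambda>_. borel) Y I"
    using indep_vars_compose2[OF indep, of "\<lambda>i x. x\<^sup>2 - v i" "\<lambda>_. borel"] by (simp add: Y_def[abs_def])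
  have Y2: "expectation (\<lambda>\<omega>. (Y i \<omega>)\<^sup>2) \<le> \<delta>\<^sup>2 * v i" if i: "i \<in> I" for i
  proof -
    have "(Y i \<omega>)\<^sup>2 \<le> \<delta>\<^sup>2 * (X i \<omega>)\<^sup>2 - 2 * v i * (X i \<omega>)\<^sup>2 + (v i)\<^sup>2" if "\<omega> \<in> space M" for \<omega>
      using mult_right_mono[OF square_le[OF i that] zero_le_power2[of "X i \<omega>"]]
      unfolding Y_def by (simp add: power2_diff power2_eq_square algebra_simps)
    moreover have "\<bar>(Y i \<omega>)\<^sup>2\<bar> \<le> (\<delta>\<^sup>2)\<^sup>2" if "\<omega> \<in> space M" for \<omega>
      using power_mono[OF Yb[OF i that], of 2] by simp
    ultimately have "expectation (\<lambda>\<omega>. (Y i \<omega>)\<^sup>2) \<le>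
        expectation (\<lambda>\<omega>. \<delta>\<^sup>2 * (X i \<omega>)\<^sup>2 - 2 * v i * (X i \<omega>)\<^sup>2 + (v i)\<^sup>2)"
      using integrable_X2[OF i] Ym[OF i] integrable_bounded[of "\<lambda>\<omega>. (Y i \<omega>)\<^sup>2" "(\<delta>\<^sup>2)\<^sup>2"]
      by (intro expectation_mono_bounded) auto
    also have "\<dots> = \<delta>\<^sup>2 * v i - 2 * v i * v i + (v i)\<^sup>2"
      using integrable_X2[OF i] by (simp add: v_def prob_space)
    also have "\<dots> \<le> \<delta>\<^sup>2 * v i" by (simp add: power2_eq_square)
    finally show ?thesis .
  qed
  have eq: "(\<Sum>i\<in>I. (X i \<omega>)\<^sup>2) - 1 = (\<Sum>i\<in>I. Y i \<omega>)" for \<omega>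
    by (simp add: Y_def sum_subtractf sum_v)
  have b: "\<bar>\<Sum>i\<in>I. Y i \<omega>\<bar> \<le> real (card I) * \<delta>\<^sup>2" if "\<omega> \<in> space M" for \<omega>
    using Yb[OF _ that] by (intro sum_norm_bound[where 'a=real, unfolded real_norm_def]) auto
  have b2: "\<bar>(\<Sum>i\<in>I. Y i \<omega>)\<^sup>2\<bar> \<le> (real (card I) * \<delta>\<^sup>2)\<^sup>2" if "\<omega> \<in> space M" for \<omega>
    using power_mono[OF b[OF that], of 2] by simp
  have i2: "integrable M (\<lambda>\<omega>. (\<Sum>i\<in>I. Y i \<omega>)\<^sup>2)" by (rule integrable_bounded[OF _ b2]) auto
  have i1: "integrable M (\<lambda>\<omega>. \<bar>\<Sum>i\<in>I. Y i \<omega>\<bar>)" using b by (intro integrable_bounded) auto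
  have "expectation (\<lambda>\<omega>. \<bar>\<Sum>i\<in>I. Y i \<omega>\<bar>) \<le> expectation (\<lambda>\<omega>. ((\<Sum>i\<in>I. Y i \<omega>)\<^sup>2 / \<delta> + \<delta>) / 2)"
  proof (rule expectation_mono_bounded[OF i1])
    show "integrable M (\<lambda>\<omega>. ((\<Sum>i\<in>I. Y i \<omega>)\<^sup>2 / \<delta> + \<delta>) / 2)" using i2 by auto
  qed (rule abs_le_square_average[OF delta_pos])
  also have "\<dots> = (expectation (\<lambda>\<omega>. (\<Sum>i\<in>I. Y i \<omega>)\<^sup>2) / \<delta> + \<delta>) / 2"
    using i2 by (simp add: prob_space)
  also have "expectation (\<lambda>\<omega>. (\<Sum>i\<in>I. Y i \<omega>)\<^sup>2) = (\<Sum>i\<in>I. expectation (\<lambda>\<omega>. (Y i \<omega>)\<^sup>2))"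
    using fin Yind Yb Y0 by (intro expectation_sum_square) auto
  also have "\<dots> \<le> (\<Sum>i\<in>I. \<delta>\<^sup>2 * v i)" using Y2 by (rule sum_mono)
  also have "\<dots> = \<delta>\<^sup>2" using sum_v by (simp add: sum_distrib_left[symmetric])
  also have "(\<delta>\<^sup>2 / \<delta> + \<delta>) / 2 = \<delta>" using delta_pos by (simp add: power2_eq_square)
  finally show ?thesis using delta_pos by (simp add: eq divide_right_mono)
qed

lemma indep_split:
  assumes i: "i \<in> I" and [measurable]: "g \<in> borel_measurable borel" "h \<in> borel_measurable borel"
    and int: "integrable M (\<lambda>\<omega>. g (X i \<omega>) :: real)" "integrable M (\<lambda>\<omega>. h (R i \<omega>))"
  shows "expectation (\<lambda>\<omega>. g (X i \<omega>) * h (R i \<omega>)) =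
    expectation (\<lambda>\<omega>. g (X i \<omega>)) * expectation (\<lambda>\<omega>. h (R i \<omega>))"
proof -
  have "indep_var borel (X i) borel (R i)"
    unfolding R_def using i fin indep by (intro indep_vars_sum) (auto simp: insert_absorb)
  then have "indep_var borel (g \<circ> X i) borel (h \<circ> R i)"
    by (rule indep_var_compose) auto
  from indep_var_lebesgue_integral[OF this] int show ?thesis by (simp add: comp_def)
qed

text \<open>As \<open>X i\<close> is centred and independent of \<open>R i\<close>, the mean of
  \<open>S * f S\<close> is that of the sum of \<open>X i * (f S - f (R i))\<close>. By
  \<open>slope\<close> this sum dominates \<open>g S\<close> times the sum of squares, which is 1 up
  to \<open>\<delta>\<close> in mean. Conversely \<open>S * f S\<close> has mean at most
  \<open>b\<close>, because \<open>\<bar>S\<bar>\<close> has mean at most 1.\<close>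

lemma concentration:
  assumes [measurable]: "f \<in> borel_measurable borel" "g \<in> borel_measurable borel"
    and f: "\<And>w. \<bar>f w\<bar> \<le> b" and g: "\<And>w. 0 \<le> g w" "\<And>w. g w \<le> 1"
    and slope: "\<And>w s. \<bar>s\<bar> \<le> \<delta> \<Longrightarrow> s\<^sup>2 * g w \<le> s * (f w - f (w - s))"
  shows "expectation (\<lambda>\<omega>. g (S \<omega>)) \<le> b + \<delta>"
proof -
  have b0: "0 \<le> b" using f[of 0] by linarith
  have fi: "integrable M (\<lambda>\<omega>. X i \<omega> * f (R i \<omega>))" "integrable M (\<lambda>\<omega>. X i \<omega> * f (S \<omega>))" if "i \<in> I" for i
    using that bounded f delta_pos
    by (auto intro!: integrable_bounded[where c="\<delta> * b"] mult_mono simp: abs_mult)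
  have zero: "expectation (\<lambda>\<omega>. X i \<omega> * f (R i \<omega>)) = 0" if "i \<in> I" for i
    using indep_split[of i "\<lambda>x. x" f] that centered integrable_X f
    by (simp add: integrable_bounded[where c=b])
  have sqb: "\<bar>(\<Sum>i\<in>I. (X i \<omega>)\<^sup>2) - 1\<bar> \<le> real (card I) * \<delta>\<^sup>2 + 1" if "\<omega> \<in> space M" for \<omega>
  proof -
    have "(\<Sum>i\<in>I. (X i \<omega>)\<^sup>2) \<le> real (card I) * \<delta>\<^sup>2" using square_le that by (intro sum_bounded_above) auto
    moreover have "0 \<le> (\<Sum>i\<in>I. (X i \<omega>)\<^sup>2)" by (intro sum_nonneg) auto
    ultimately show ?thesis by auto
  qed
  have sqi: "integrable M (\<lambda>\<omega>. \<bar>(\<Sum>i\<in>I. (X i \<omega>)\<^sup>2) - 1\<bar>)"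
    using sqb by (intro integrable_bounded) auto
  have Sfi: "integrable M (\<lambda>\<omega>. b * \<bar>S \<omega>\<bar>)"
    using S_abs_le b0 by (intro integrable_bounded[where c="b * (real (card I) * \<delta>)"]) (auto simp: abs_mult mult_left_mono)
  have gi: "integrable M (\<lambda>\<omega>. g (S \<omega>))" using g by (intro integrable_bounded[where c=1]) auto
  have pt: "g (S \<omega>) \<le> (\<Sum>i\<in>I. X i \<omega> * f (S \<omega>) - X i \<omega> * f (R i \<omega>)) + \<bar>(\<Sum>i\<in>I. (X i \<omega>)\<^sup>2) - 1\<bar>"
    if "\<omega> \<in> space M" for \<omega>
  proof -
    let ?Q = "\<Sum>i\<in>I. (X i \<omega>)\<^sup>2"
    have "?Q * g (S \<omega>) = (\<Sum>i\<in>I. (X i \<omega>)\<^sup>2 * g (S \<omega>))" by (simp add: sum_distrib_right)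
    also have "\<dots> \<le> (\<Sum>i\<in>I. X i \<omega> * f (S \<omega>) - X i \<omega> * f (R i \<omega>))"
    proof (rule sum_mono)
      fix i assume i: "i \<in> I"
      show "(X i \<omega>)\<^sup>2 * g (S \<omega>) \<le> X i \<omega> * f (S \<omega>) - X i \<omega> * f (R i \<omega>)"
        using slope[OF bounded[OF i that], of "S \<omega>"] S_eq[OF i, of \<omega>] by (simp add: right_diff_distrib)
    qed
    finally have 1: "?Q * g (S \<omega>) \<le> (\<Sum>i\<in>I. X i \<omega> * f (S \<omega>) - X i \<omega> * f (R i \<omega>))" .
    have "(1 - ?Q) * g (S \<omega>) \<le> \<bar>?Q - 1\<bar> * 1" using g by (intro mult_mono) auto
    with 1 show ?thesis by (simp add: left_diff_distrib)
  qed
  have "expectation (\<lambda>\<omega>. g (S \<omega>)) \<le> expectation (\<lambda>\<omega>. (\<Sum>i\<in>I. X i \<omega> * f (S \<omega>) - X i \<omega> * f (R i \<omega>)) + \<bar>(\<Sum>i\<in>I. (X i \<omega>)\<^sup>2) - 1\<bar>)"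
    using gi fi sqi pt by (intro expectation_mono_bounded) auto
  also have "\<dots> = expectation (\<lambda>\<omega>. \<Sum>i\<in>I. X i \<omega> * f (S \<omega>)) + expectation (\<lambda>\<omega>. \<bar>(\<Sum>i\<in>I. (X i \<omega>)\<^sup>2) - 1\<bar>)"
    using fi sqi zero by simp
  also have "expectation (\<lambda>\<omega>. \<Sum>i\<in>I. X i \<omega> * f (S \<omega>)) \<le> expectation (\<lambda>\<omega>. b * \<bar>S \<omega>\<bar>)"
  proof (rule expectation_mono_bounded[OF _ Sfi])
    show "integrable M (\<lambda>\<omega>. \<Sum>i\<in>I. X i \<omega> * f (S \<omega>))" using fi by auto
    fix \<omega>
    have "(\<Sum>i\<in>I. X i \<omega> * f (S \<omega>)) = S \<omega> * f (S \<omega>)" by (simp add: S_def sum_distrib_right)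
    also have "\<dots> \<le> \<bar>S \<omega>\<bar> * \<bar>f (S \<omega>)\<bar>" by (simp add: abs_mult[symmetric])
    also have "\<dots> \<le> \<bar>S \<omega>\<bar> * b" using f by (intro mult_left_mono) auto
    finally show "(\<Sum>i\<in>I. X i \<omega> * f (S \<omega>)) \<le> b * \<bar>S \<omega>\<bar>" by (simp add: mult.commute)
  qed
  also have "expectation (\<lambda>\<omega>. b * \<bar>S \<omega>\<bar>) \<le> b"
    using expectation_abs_S b0 mult_left_le[of "expectation (\<lambda>\<omega>. \<bar>S \<omega>\<bar>)" b] by simp
  finally show ?thesis using expectation_abs_sum_squares by linarith
qed

end

section \<open>Concentration estimates and the Berry--Esseen bound\<close>

context bounded_indep_sum
begin

lemma interval_concentration:
  assumes "0 \<le> r"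
  shows "prob {\<omega> \<in> space M. \<bar>S \<omega> - z\<bar> \<le> r} \<le> r + 2 * \<delta>"
proof -
  \<comment> \<open>Slope 1 on the interval, continued for another \<open>\<delta>\<close> on both
    sides so that removing one summand stays on the linear piece.\<close>
  define f where "f w = max (- (r + \<delta>)) (min (r + \<delta>) (w - z))" for w
  define g where "g w = (if \<bar>w - z\<bar> \<le> r then 1 else 0 :: real)" for w
  have [measurable]: "f \<in> borel_measurable borel" "g \<in> borel_measurable borel"
    unfolding f_def[abs_def] g_def[abs_def] by measurable
  have "expectation (\<lambda>\<omega>. g (S \<omega>)) \<le> (r + \<delta>) + \<delta>"
  proof (rule concentration[of f g])
    show "s\<^sup>2 * g w \<le> s * (f w - f (w - s))" if s: "\<bar>s\<bar> \<le> \<delta>" for w s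
    proof (cases "\<bar>w - z\<bar> \<le> r")
      case True
      then have "f w = w - z" "f (w - s) = w - s - z"
        using s by (auto simp: f_def min_def max_def abs_if split: if_splits)
      then show ?thesis using True by (simp add: g_def power2_eq_square)
    next
      case False
      have "0 \<le> s * (f w - f (w - s))"
        by (cases "0 \<le> s") (auto simp: f_def intro!: mult_nonneg_nonneg mult_nonpos_nonpos)
      with False show ?thesis by (simp add: g_def)
    qed
  qed (use assms delta_pos in \<open>auto simp: f_def g_def\<close>)
  also have "(\<lambda>\<omega>. g (S \<omega>)) = (\<lambda>\<omega>. indicator {\<omega>. \<bar>S \<omega> - z\<bar> \<le> r} \<omega>)"
    by (auto simp: g_def indicator_def)
  also have "expectation \<dots> = prob {\<omega> \<in> space M. \<bar>S \<omega> - z\<bar> \<le> r}"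
    by (simp add: Int_def conj_commute)
  finally show ?thesis by simp
qed

text \<open>Only a window of length about \<open>1 / c\<close> below \<open>l\<close> carries
  weight. With \<open>c\<close> the standard deviation of the unnormalised sum and
  \<open>\<delta>\<close> of order \<open>1 / c\<close>, the whole bound is of order
  \<open>1 / c\<close>.\<close>

lemma exponential_concentration:
  assumes c: "0 < c"
  shows "expectation (\<lambda>\<omega>. if S \<omega> \<le> l then exp (c * (S \<omega> - l)) else 0) \<le> exp (2 * c * \<delta>) * (1 / c + \<delta>)"
proof -
  \<comment> \<open>Up to \<open>l + \<delta>\<close> the derivative of \<open>f\<close> is
    \<open>exp (c * (w - l - \<delta>))\<close>; beyond, \<open>f\<close> is constant. For
    \<open>w \<le> l\<close>, \<open>g w\<close> is the least value of that derivative on the window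
    of length \<open>\<delta>\<close> to the left of \<open>w\<close>, hence the loss
    \<open>2 * c * \<delta>\<close> in the exponent.\<close>
  define f where "f w = exp (c * (min w (l + \<delta>) - l - \<delta>)) / c" for w
  define g where "g w = (if w \<le> l then exp (c * (w - l) - 2 * c * \<delta>) else 0)" for w
  have [measurable]: "f \<in> borel_measurable borel" "g \<in> borel_measurable borel"
    unfolding f_def[abs_def] g_def[abs_def] by measurable
  have tangent: "exp b * (a - b) \<le> exp a - exp b" for a b :: real
    using mult_left_mono[OF exp_ge_add_one_self[of "a - b"], of "exp b"]
    by (simp add: exp_diff algebra_simps)
  have mono: "f x \<le> f y" if "x \<le> y" for x y
    using that c by (auto simp: f_def intro!: divide_right_mono mult_left_mono)
  have "expectation (\<lambda>\<omega>. g (S \<omega>)) \<le> 1 / c + \<delta>"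
  proof (rule concentration[of f g])
    show "s\<^sup>2 * g w \<le> s * (f w - f (w - s))" if s: "\<bar>s\<bar> \<le> \<delta>" for w s
    proof (cases "w \<le> l")
      case False
      have "0 \<le> s * (f w - f (w - s))"
        using mono by (cases "0 \<le> s") (auto intro!: mult_nonneg_nonneg mult_nonpos_nonpos)
      with False show ?thesis by (simp add: g_def)
    next
      case True
      let ?a = "c * (w - l - \<delta>)" and ?b = "c * (w - s - l - \<delta>)"
      have fw: "f w = exp ?a / c" "f (w - s) = exp ?b / c"
        using True s by (auto simp: f_def min_def)
      have low: "g w \<le> exp ?a" "g w \<le> exp ?b"
        using True s c mult_left_mono[of s \<delta> c] by (auto simp: g_def algebra_simps)
      show ?thesis
      proof (cases "0 \<le> s")
        case s0: True
        have "g w * s \<le> exp ?b * s" using low s0 by (intro mult_right_mono) auto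
        also have "\<dots> = exp ?b * (?a - ?b) / c" using c by (simp add: field_simps)
        also have "\<dots> \<le> f w - f (w - s)"
          unfolding fw using tangent[of ?b ?a] c by (simp add: divide_right_mono flip: diff_divide_distrib)
        finally have "s * (g w * s) \<le> s * (f w - f (w - s))" using s0 by (rule mult_left_mono)
        then show ?thesis by (simp add: power2_eq_square mult_ac)
      next
        case s0: False
        have "g w * (- s) \<le> exp ?a * (- s)" using low s0 by (intro mult_right_mono) auto
        also have "\<dots> = exp ?a * (?b - ?a) / c" using c by (simp add: field_simps)
        also have "\<dots> \<le> f (w - s) - f w"
          unfolding fw using tangent[of ?a ?b] c by (simp add: divide_right_mono flip: diff_divide_distrib)
        finally have "(- s) * (g w * (- s)) \<le> (- s) * (f (w - s) - f w)"
          using s0 by (intro mult_left_mono) auto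
        then show ?thesis by (simp add: power2_eq_square algebra_simps)
      qed
    qed
    show "\<bar>f w\<bar> \<le> 1 / c" for w
      using c by (auto simp: f_def divide_right_mono mult_le_0_iff)
    show "g w \<le> 1" for w
    proof -
      have "c * (w - l) - 2 * c * \<delta> \<le> 0" if "w \<le> l"
        using that c delta_pos mult_nonneg_nonpos[of c "w - l"] mult_pos_pos[of c \<delta>] by simp
      then show ?thesis by (simp add: g_def)
    qed
  qed (auto simp: g_def)
  moreover have "(\<lambda>\<omega>. if S \<omega> \<le> l then exp (c * (S \<omega> - l)) else 0) = (\<lambda>\<omega>. exp (2 * c * \<delta>) * g (S \<omega>))"
    by (auto simp: g_def exp_diff)
  ultimately show ?thesis by (simp add: mult_left_mono)
qed

text \<open>Expanding \<open>f S\<close> around \<open>R i\<close>, independence gives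
  \<open>v i\<close> times the mean of the derivative at \<open>R i\<close>, then at
  \<open>S\<close>, up to an error. Summing over \<open>i\<close> and inserting Stein's equation
  leaves exactly the distance to \<open>Phi z\<close>. The delicate error is the step of the
  derivative at \<open>z\<close>, which \<open>interval_concentration\<close> controls.\<close>

lemma berry_esseen:
  assumes B: "\<And>z w. stein_sol z w \<le> B"
  shows "\<bar>prob {\<omega> \<in> space M. S \<omega> \<le> z} - Phi z\<bar> \<le> (36 + 2 * B) * \<delta>"
proof -
  let ?f = "stein_sol z" and ?h = "stein_deriv z"
  define e where "e w = (2 * \<bar>w\<bar> + B) * \<delta> + (if \<bar>w - z\<bar> \<le> \<delta> then 4 else 0)" for w
  have [measurable]: "e \<in> borel_measurable borel" unfolding e_def[abs_def] by measurable
  have B0: "0 \<le> B" using B[of 0 0] stein_sol_nonneg[of 0 0] by linarith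
  have absf: "\<bar>?f w\<bar> \<le> B" for w using B stein_sol_nonneg[of z w] by (simp add: abs_of_nonneg)
  have e0: "0 \<le> e w" for w using B0 delta_pos by (simp add: e_def)
  have eR_le: "\<bar>e (R i \<omega>)\<bar> \<le> (2 * (real (card I) * \<delta>) + B) * \<delta> + 4" if "\<omega> \<in> space M" for i \<omega>
  proof -
    have "(2 * \<bar>R i \<omega>\<bar> + B) * \<delta> \<le> (2 * (real (card I) * \<delta>) + B) * \<delta>"
      using R_abs_le[OF that, of i] delta_pos by (intro mult_right_mono add_mono mult_left_mono) auto
    then show ?thesis using e0[of "R i \<omega>"] unfolding e_def by simp
  qed
  have i_e: "integrable M (\<lambda>\<omega>. e (R i \<omega>))" for i
    using eR_le by (intro integrable_bounded) auto
  have i_hR: "integrable M (\<lambda>\<omega>. ?h (R i \<omega>))" for i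
    using abs_stein_deriv_le by (intro integrable_bounded[where c=2]) auto
  have i_hS: "integrable M (\<lambda>\<omega>. ?h (S \<omega>))"
    using abs_stein_deriv_le by (intro integrable_bounded[where c=2]) auto
  have i_fR: "integrable M (\<lambda>\<omega>. ?f (R i \<omega>))" for i
    using absf by (intro integrable_bounded[where c=B]) auto
  have i_X2e: "integrable M (\<lambda>\<omega>. (X i \<omega>)\<^sup>2 * e (R i \<omega>))" if i: "i \<in> I" for i
    using i eR_le square_le[OF i] e0
    by (intro integrable_bounded[where c="\<delta>\<^sup>2 * ((2 * (real (card I) * \<delta>) + B) * \<delta> + 4)"])
       (auto simp: abs_mult intro!: mult_mono)
  have i_X2h: "integrable M (\<lambda>\<omega>. (X i \<omega>)\<^sup>2 * ?h (R i \<omega>))" if i: "i \<in> I" for i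
    using i square_le[OF i] abs_stein_deriv_le
    by (intro integrable_bounded[where c="\<delta>\<^sup>2 * 2"]) (auto simp: abs_mult intro!: mult_mono)
  have i_XfS: "integrable M (\<lambda>\<omega>. X i \<omega> * ?f (S \<omega>))" if i: "i \<in> I" for i
    using i bounded[OF i] absf delta_pos
    by (intro integrable_bounded[where c="\<delta> * B"]) (auto simp: abs_mult intro!: mult_mono)
  have i_XfR: "integrable M (\<lambda>\<omega>. X i \<omega> * ?f (R i \<omega>))" if i: "i \<in> I" for i
    using i bounded[OF i] absf delta_pos
    by (intro integrable_bounded[where c="\<delta> * B"]) (auto simp: abs_mult intro!: mult_mono)
  \<comment> \<open>If \<open>R i\<close> is within \<open>\<delta>\<close> of \<open>z\<close>,
    then \<open>S\<close> is within \<open>2 * \<delta>\<close>, an event of probability at most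
    \<open>4 * \<delta>\<close>. Weighted by 4 this gives 16; the mean of
    \<open>\<bar>R i\<bar>\<close> contributes the other 2.\<close>
  have Ee: "expectation (\<lambda>\<omega>. e (R i \<omega>)) \<le> (18 + B) * \<delta>" if i: "i \<in> I" for i
  proof -
    define k where "k \<omega> = (2 * \<bar>R i \<omega>\<bar> + B) * \<delta> + 4 * indicator {\<omega>. \<bar>S \<omega> - z\<bar> \<le> 2 * \<delta>} \<omega>" for \<omega>
    have i_R: "integrable M (\<lambda>\<omega>. \<bar>R i \<omega>\<bar>)" using R_abs_le by (intro integrable_bounded) auto
    have i_ind: "integrable M (indicator {\<omega>. \<bar>S \<omega> - z\<bar> \<le> 2 * \<delta>} :: 'a \<Rightarrow> real)"
      by (rule integrable_bounded[where c=1]) auto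
    have "expectation (\<lambda>\<omega>. e (R i \<omega>)) \<le> expectation k"
    proof (rule expectation_mono_bounded[OF i_e])
      show "integrable M k" unfolding k_def using i_R i_ind by auto
      show "e (R i \<omega>) \<le> k \<omega>" if "\<omega> \<in> space M" for \<omega>
        using bounded[OF i that] S_eq[OF i, of \<omega>] by (auto simp: e_def k_def indicator_def)
    qed
    also have "\<dots> = (2 * expectation (\<lambda>\<omega>. \<bar>R i \<omega>\<bar>) + B) * \<delta> + 4 * prob {\<omega> \<in> space M. \<bar>S \<omega> - z\<bar> \<le> 2 * \<delta>}"
      unfolding k_def using i_R i_ind by (simp add: prob_space Int_def conj_commute)
    also have "\<dots> \<le> (2 * 1 + B) * \<delta> + 4 * (2 * \<delta> + 2 * \<delta>)"
      using expectation_abs_R[of i] interval_concentration[of "2 * \<delta>" z] delta_pos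
      by (intro add_mono mult_right_mono mult_left_mono) auto
    finally show ?thesis by (simp add: algebra_simps)
  qed
  have each: "\<bar>expectation (\<lambda>\<omega>. X i \<omega> * ?f (S \<omega>)) - v i * expectation (\<lambda>\<omega>. ?h (S \<omega>))\<bar> \<le> v i * ((36 + 2 * B) * \<delta>)"
    if i: "i \<in> I" for i
  proof -
    have pt: "\<bar>X i \<omega> * ?f (S \<omega>) - X i \<omega> * ?f (R i \<omega>) - (X i \<omega>)\<^sup>2 * ?h (R i \<omega>)\<bar> \<le> (X i \<omega>)\<^sup>2 * e (R i \<omega>)"
      if "\<omega> \<in> space M" for \<omega>
    proof -
      have "\<bar>X i \<omega>\<bar> * \<bar>?f (R i \<omega> + X i \<omega>) - ?f (R i \<omega>) - X i \<omega> * ?h (R i \<omega>)\<bar> \<le> \<bar>X i \<omega>\<bar> * (\<bar>X i \<omega>\<bar> * e (R i \<omega>))"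
        unfolding e_def by (intro mult_left_mono stein_sol_taylor(1)[OF B] bounded i that) auto
      moreover have "X i \<omega> * ?f (S \<omega>) - X i \<omega> * ?f (R i \<omega>) - (X i \<omega>)\<^sup>2 * ?h (R i \<omega>)
          = X i \<omega> * (?f (R i \<omega> + X i \<omega>) - ?f (R i \<omega>) - X i \<omega> * ?h (R i \<omega>))"
        by (simp only: S_eq[OF i] power2_eq_square right_diff_distrib mult.assoc)
      moreover have "\<bar>X i \<omega>\<bar> * (\<bar>X i \<omega>\<bar> * e (R i \<omega>)) = (X i \<omega>)\<^sup>2 * e (R i \<omega>)"
        by (simp only: mult.assoc[symmetric] abs_mult_self_eq power2_eq_square)
      ultimately show ?thesis by (simp only: abs_mult)
    qed
    have zero: "expectation (\<lambda>\<omega>. X i \<omega> * ?f (R i \<omega>)) = 0"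
      using indep_split[OF i, of "\<lambda>x. x" ?f] integrable_X[OF i] i_fR centered[OF i] by simp
    have "\<bar>expectation (\<lambda>\<omega>. X i \<omega> * ?f (S \<omega>) - X i \<omega> * ?f (R i \<omega>) - (X i \<omega>)\<^sup>2 * ?h (R i \<omega>))\<bar>
        \<le> expectation (\<lambda>\<omega>. \<bar>X i \<omega> * ?f (S \<omega>) - X i \<omega> * ?f (R i \<omega>) - (X i \<omega>)\<^sup>2 * ?h (R i \<omega>)\<bar>)"
      by (rule integral_abs_bound)
    also have "\<dots> \<le> expectation (\<lambda>\<omega>. (X i \<omega>)\<^sup>2 * e (R i \<omega>))"
      using i_XfS[OF i] i_XfR[OF i] i_X2h[OF i] i_X2e[OF i] pt by (intro expectation_mono_bounded) auto
    also have "\<dots> = v i * expectation (\<lambda>\<omega>. e (R i \<omega>))"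
      unfolding v_def using integrable_X2[OF i] i_e by (intro indep_split[OF i, of "\<lambda>x. x\<^sup>2"]) auto
    also have "expectation (\<lambda>\<omega>. X i \<omega> * ?f (S \<omega>) - X i \<omega> * ?f (R i \<omega>) - (X i \<omega>)\<^sup>2 * ?h (R i \<omega>))
        = expectation (\<lambda>\<omega>. X i \<omega> * ?f (S \<omega>)) - expectation (\<lambda>\<omega>. (X i \<omega>)\<^sup>2 * ?h (R i \<omega>))"
      using i_XfS[OF i] i_XfR[OF i] i_X2h[OF i] zero by simp
    also have "expectation (\<lambda>\<omega>. (X i \<omega>)\<^sup>2 * ?h (R i \<omega>)) = v i * expectation (\<lambda>\<omega>. ?h (R i \<omega>))"
      unfolding v_def using integrable_X2[OF i] i_hR by (intro indep_split[OF i, of "\<lambda>x. x\<^sup>2"]) auto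
    finally have 1: "\<bar>expectation (\<lambda>\<omega>. X i \<omega> * ?f (S \<omega>)) - v i * expectation (\<lambda>\<omega>. ?h (R i \<omega>))\<bar>
        \<le> v i * expectation (\<lambda>\<omega>. e (R i \<omega>))" .
    \<comment> \<open>Passing from \<open>R i\<close> to \<open>S\<close> inside the derivative
      costs the same error once more; this doubles \<open>18 + B\<close>.\<close>
    have "\<bar>expectation (\<lambda>\<omega>. ?h (S \<omega>) - ?h (R i \<omega>))\<bar> \<le> expectation (\<lambda>\<omega>. \<bar>?h (S \<omega>) - ?h (R i \<omega>)\<bar>)"
      by (rule integral_abs_bound)
    also have "\<dots> \<le> expectation (\<lambda>\<omega>. e (R i \<omega>))"
      using i_hS i_hR i_e stein_sol_taylor(2)[OF B bounded[OF i], of _ z "R i _"]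
      by (intro expectation_mono_bounded) (auto simp: S_eq[OF i] e_def)
    finally have 2: "\<bar>expectation (\<lambda>\<omega>. ?h (S \<omega>)) - expectation (\<lambda>\<omega>. ?h (R i \<omega>))\<bar> \<le> expectation (\<lambda>\<omega>. e (R i \<omega>))"
      using i_hS i_hR by simp
    have "\<bar>v i * expectation (\<lambda>\<omega>. ?h (S \<omega>)) - v i * expectation (\<lambda>\<omega>. ?h (R i \<omega>))\<bar> \<le> v i * expectation (\<lambda>\<omega>. e (R i \<omega>))"
      using mult_left_mono[OF 2 v_nonneg[of i]] v_nonneg[of i]
      by (simp add: abs_mult flip: right_diff_distrib)
    with 1 have "\<bar>expectation (\<lambda>\<omega>. X i \<omega> * ?f (S \<omega>)) - v i * expectation (\<lambda>\<omega>. ?h (S \<omega>))\<bar>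
        \<le> v i * (2 * expectation (\<lambda>\<omega>. e (R i \<omega>)))" by (simp add: algebra_simps)
    also have "\<dots> \<le> v i * ((36 + 2 * B) * \<delta>)"
      using Ee[OF i] v_nonneg[of i] by (intro mult_left_mono) (auto simp: algebra_simps)
    finally show ?thesis .
  qed
  have i_SfS: "integrable M (\<lambda>\<omega>. S \<omega> * ?f (S \<omega>))"
    using i_XfS by (simp add: S_def sum_distrib_right)
  have ES: "expectation (\<lambda>\<omega>. S \<omega> * ?f (S \<omega>)) = (\<Sum>i\<in>I. expectation (\<lambda>\<omega>. X i \<omega> * ?f (S \<omega>)))"
    using i_XfS by (simp add: S_def sum_distrib_right)
  have "\<bar>expectation (\<lambda>\<omega>. S \<omega> * ?f (S \<omega>)) - expectation (\<lambda>\<omega>. ?h (S \<omega>))\<bar>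
      = \<bar>\<Sum>i\<in>I. expectation (\<lambda>\<omega>. X i \<omega> * ?f (S \<omega>)) - v i * expectation (\<lambda>\<omega>. ?h (S \<omega>))\<bar>"
    by (simp add: ES sum_subtractf sum_v flip: sum_distrib_right)
  also have "\<dots> \<le> (\<Sum>i\<in>I. v i * ((36 + 2 * B) * \<delta>))"
    using each by (intro order_trans[OF sum_abs] sum_mono) auto
  also have "\<dots> = (36 + 2 * B) * \<delta>" by (simp add: sum_v flip: sum_distrib_right)
  finally have main: "\<bar>expectation (\<lambda>\<omega>. S \<omega> * ?f (S \<omega>)) - expectation (\<lambda>\<omega>. ?h (S \<omega>))\<bar> \<le> (36 + 2 * B) * \<delta>" .
  have i_ind: "integrable M (indicator {\<omega>. S \<omega> \<le> z} :: 'a \<Rightarrow> real)"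
    by (rule integrable_bounded[where c=1]) auto
  have "expectation (\<lambda>\<omega>. ?h (S \<omega>)) = expectation (\<lambda>\<omega>. S \<omega> * ?f (S \<omega>) + (indicator {\<omega>. S \<omega> \<le> z} \<omega> - Phi z))"
    by (intro Bochner_Integration.integral_cong) (auto simp: stein_deriv_def indicator_def)
  also have "\<dots> = expectation (\<lambda>\<omega>. S \<omega> * ?f (S \<omega>)) + (prob {\<omega> \<in> space M. S \<omega> \<le> z} - Phi z)"
    using i_SfS i_ind by (simp add: prob_space Int_def conj_commute)
  finally show ?thesis using main by linarith
qed

end

section \<open>Product distributions on words\<close>

context prob_space
begin

text \<open>Dividing the centred summands by \<open>sqrt V\<close> gives the normalised locale with
  \<open>\<delta> = 2 * b / sqrt V\<close>; in the exponential statement \<open>c = sqrt V\<close>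
  undoes the scaling. Chebyshev also covers \<open>V = 0\<close>, which types of zero dispersion
  require.\<close>

lemma
  fixes Y :: "'i \<Rightarrow> 'a \<Rightarrow> real"
  assumes fin: "finite J" and ind: "indep_vars (\<lambda>_. borel) Y J"
    and bnd: "\<And>i \<omega>. i \<in> J \<Longrightarrow> \<omega> \<in> space M \<Longrightarrow> \<bar>Y i \<omega>\<bar> \<le> b"
    and m: "m = (\<Sum>i\<in>J. expectation (Y i))"
    and V: "V = (\<Sum>i\<in>J. variance (Y i))"
  shows chebyshev_sum: "0 < t \<Longrightarrow> prob {\<omega> \<in> space M. m + t < (\<Sum>i\<in>J. Y i \<omega>)} \<le> V / t\<^sup>2"
    and berry_esseen_sum: "0 < V \<Longrightarrow> (\<And>z w. stein_sol z w \<le> B) \<Longrightarrow>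
      \<bar>prob {\<omega> \<in> space M. (\<Sum>i\<in>J. Y i \<omega>) \<le> l} - Phi ((l - m) / sqrt V)\<bar> \<le> (36 + 2 * B) * (2 * b / sqrt V)"
    and exponential_sum: "0 < V \<Longrightarrow>
      expectation (\<lambda>\<omega>. if (\<Sum>i\<in>J. Y i \<omega>) \<le> l then exp ((\<Sum>i\<in>J. Y i \<omega>) - l) else 0)
        \<le> exp (4 * b) * (1 + 2 * b) / sqrt V"
proof -
  define \<mu> where "\<mu> i = expectation (Y i)" for i
  have [measurable]: "Y i \<in> borel_measurable M" if "i \<in> J" for i
    using ind that unfolding indep_vars_def by auto
  have intY: "integrable M (Y i)" if "i \<in> J" for i
    using that bnd by (intro integrable_bounded) auto
  have mub: "\<bar>\<mu> i\<bar> \<le> b" if "i \<in> J" for i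
  proof -
    have "\<bar>\<mu> i\<bar> \<le> expectation (\<lambda>\<omega>. \<bar>Y i \<omega>\<bar>)" unfolding \<mu>_def by (rule integral_abs_bound)
    also have "\<dots> \<le> expectation (\<lambda>_. b)"
      using that bnd intY by (intro expectation_mono_bounded) auto
    finally show ?thesis by (simp add: prob_space)
  qed
  have cb: "\<bar>Y i \<omega> - \<mu> i\<bar> \<le> 2 * b" if "i \<in> J" "\<omega> \<in> space M" for i \<omega>
    using bnd[OF that] mub[OF that(1)] by linarith
  have m': "m = (\<Sum>i\<in>J. \<mu> i)" by (simp add: m \<mu>_def)
  have V': "V = (\<Sum>i\<in>J. expectation (\<lambda>\<omega>. (Y i \<omega> - \<mu> i)\<^sup>2))" by (simp add: V \<mu>_def)
  have ind': "indep_vars (\<lambda>_. borel) (\<lambda>i \<omega>. (Y i \<omega> - \<mu> i) / c) J" for c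
    using indep_vars_compose2[OF ind, of "\<lambda>i x. (x - \<mu> i) / c" "\<lambda>_. borel"] by simp
  show "prob {\<omega> \<in> space M. m + t < (\<Sum>i\<in>J. Y i \<omega>)} \<le> V / t\<^sup>2" if t: "0 < t"
  proof -
    let ?T = "\<lambda>\<omega>. \<Sum>i\<in>J. Y i \<omega> - \<mu> i"
    have b: "\<bar>?T \<omega>\<bar> \<le> real (card J) * (2 * b)" if "\<omega> \<in> space M" for \<omega>
      using cb[OF _ that] by (intro sum_norm_bound[where 'a=real, unfolded real_norm_def]) auto
    have i2: "integrable M (\<lambda>\<omega>. (?T \<omega>)\<^sup>2)"
      using power_mono[OF b, of _ 2] by (intro integrable_bounded[where c="(real (card J) * (2 * b))\<^sup>2"]) auto
    have "prob {\<omega> \<in> space M. m + t < (\<Sum>i\<in>J. Y i \<omega>)} = expectation (indicator {\<omega>. m + t < (\<Sum>i\<in>J. Y i \<omega>)})"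
      by (simp add: Int_def conj_commute)
    also have "\<dots> \<le> expectation (\<lambda>\<omega>. (?T \<omega>)\<^sup>2 / t\<^sup>2)"
    proof (rule expectation_mono_bounded)
      show "integrable M (indicator {\<omega>. m + t < (\<Sum>i\<in>J. Y i \<omega>)} :: 'a \<Rightarrow> real)"
        by (rule integrable_bounded[where c=1]) auto
      show "integrable M (\<lambda>\<omega>. (?T \<omega>)\<^sup>2 / t\<^sup>2)" using i2 by auto
      fix \<omega>
      show "indicator {\<omega>. m + t < (\<Sum>i\<in>J. Y i \<omega>)} \<omega> \<le> (?T \<omega>)\<^sup>2 / t\<^sup>2"
      proof (cases "m + t < (\<Sum>i\<in>J. Y i \<omega>)")
        case True
        then have "t\<^sup>2 \<le> (?T \<omega>)\<^sup>2" using t by (intro power_mono) (auto simp: m' sum_subtractf)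
        then show ?thesis using t True by simp
      qed simp
    qed
    also have "\<dots> = expectation (\<lambda>\<omega>. (?T \<omega>)\<^sup>2) / t\<^sup>2" by simp
    also have "expectation (\<lambda>\<omega>. (?T \<omega>)\<^sup>2) = V"
      unfolding V' using fin ind'[of 1] cb intY
      by (intro expectation_sum_square[where c="2 * b"]) (auto simp: \<mu>_def prob_space)
    finally show ?thesis .
  qed
  assume V0: "0 < V"
  interpret bounded_indep_sum M "\<lambda>i \<omega>. (Y i \<omega> - \<mu> i) / sqrt V" J "2 * b / sqrt V"
  proof
    show "(\<Sum>i\<in>J. expectation (\<lambda>\<omega>. ((Y i \<omega> - \<mu> i) / sqrt V)\<^sup>2)) = 1"
      using V0 V' by (simp add: power_divide flip: sum_divide_distrib)
  qed (use fin ind' cb intY V0 in \<open>auto simp: divide_right_mono \<mu>_def prob_space\<close>)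
  have S: "S \<omega> = ((\<Sum>i\<in>J. Y i \<omega>) - m) / sqrt V" for \<omega>
    unfolding S_def by (simp add: m' sum_subtractf flip: sum_divide_distrib)
  have le_iff: "S \<omega> \<le> (l - m) / sqrt V \<longleftrightarrow> (\<Sum>i\<in>J. Y i \<omega>) \<le> l" for \<omega> l
    using V0 by (simp add: S divide_le_cancel)
  show "\<bar>prob {\<omega> \<in> space M. (\<Sum>i\<in>J. Y i \<omega>) \<le> l} - Phi ((l - m) / sqrt V)\<bar> \<le> (36 + 2 * B) * (2 * b / sqrt V)"
    if "\<And>z w. stein_sol z w \<le> B"
    using berry_esseen[OF that, of "(l - m) / sqrt V"] by (simp add: le_iff)
  have e: "sqrt V * (S \<omega> - (l - m) / sqrt V) = (\<Sum>i\<in>J. Y i \<omega>) - l" for \<omega>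
    using V0 by (simp add: S field_simps)
  have "exp (2 * sqrt V * (2 * b / sqrt V)) * (1 / sqrt V + 2 * b / sqrt V) = exp (4 * b) * (1 + 2 * b) / sqrt V"
    using V0 by (simp add: add_divide_distrib distrib_left)
  with exponential_concentration[of "sqrt V" "(l - m) / sqrt V"]
  show "expectation (\<lambda>\<omega>. if (\<Sum>i\<in>J. Y i \<omega>) \<le> l then exp ((\<Sum>i\<in>J. Y i \<omega>) - l) else 0)
        \<le> exp (4 * b) * (1 + 2 * b) / sqrt V"
    using V0 by (simp add: le_iff e cong: if_cong)
qed

end

section \<open>Expectations over words with independent letters\<close>

definition prob_vec :: "('y::finite \<Rightarrow> real) \<Rightarrow> bool" where
  "prob_vec p \<longleftrightarrow> (\<forall>y. 0 \<le> p y) \<and> (\<Sum>y\<in>UNIV. p y) = 1"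

definition mean :: "('y::finite \<Rightarrow> real) \<Rightarrow> ('y \<Rightarrow> real) \<Rightarrow> real" where
  "mean p s = (\<Sum>y\<in>UNIV. p y * s y)"

definition var :: "('y::finite \<Rightarrow> real) \<Rightarrow> ('y \<Rightarrow> real) \<Rightarrow> real" where
  "var p s = (\<Sum>y\<in>UNIV. p y * (s y - mean p s)\<^sup>2)"

text \<open>Expectation under independent letters with laws \<open>p i\<close>, as a finite sum over
  lists so that it matches \<open>W_N\<close> and \<open>avg_error\<close>.\<close>

definition word_sum :: "nat \<Rightarrow> (nat \<Rightarrow> 'y::finite \<Rightarrow> real) \<Rightarrow> ('y list \<Rightarrow> real) \<Rightarrow> real" where
  "word_sum N p F = (\<Sum>ys\<in>{ys. length ys = N}. (\<Prod>i<N. p i (ys ! i)) * F ys)"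

definition word_score :: "('y \<Rightarrow> real) \<Rightarrow> 'y list \<Rightarrow> real" where
  "word_score s ys = (\<Sum>i<length ys. s (ys ! i))"

lemma finite_words [simp]: "finite {ys :: 'y::finite list. length ys = N}"
  using finite_lists_length_eq[of "UNIV :: 'y set" N] by simp

lemma pmf_of_prob_vec:
  assumes "prob_vec (p :: 'y::finite \<Rightarrow> real)"
  shows "pmf (embed_pmf p) y = p y"
proof (rule pmf_embed_pmf)
  show "0 \<le> p x" for x using assms by (simp add: prob_vec_def)
  have "(\<integral>\<^sup>+ x. ennreal (p x) \<partial>count_space UNIV) = ennreal (\<Sum>x\<in>UNIV. p x)"
    using assms by (simp add: nn_integral_count_space_finite prob_vec_def)
  then show "(\<integral>\<^sup>+ x. ennreal (p x) \<partial>count_space UNIV) = 1"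
    using assms by (simp add: prob_vec_def)
qed

text \<open>Outcomes of \<open>Pi_pmf\<close> are functions with a default value from
  \<open>N\<close> on; they correspond bijectively to words, so independence under
  \<open>Pi_pmf\<close> becomes available for lists.\<close>

lemma word_sum_eq_expectation:
  assumes p: "\<And>i. i < N \<Longrightarrow> prob_vec (p i :: 'y::finite \<Rightarrow> real)"
  shows "word_sum N p (\<lambda>ys. F (word_score s ys)) =
    measure_pmf.expectation (Pi_pmf {..<N} undefined (\<lambda>i. embed_pmf (p i))) (\<lambda>\<omega>. F (\<Sum>i<N. s (\<omega> i)))"
proof -
  let ?P = "Pi_pmf {..<N} undefined (\<lambda>i. embed_pmf (p i))"
  let ?A = "PiE_dflt {..<N} undefined (\<lambda>_. UNIV :: 'y set)"
  have fin: "finite ?A" by (intro finite_PiE_dflt) auto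
  have sub: "set_pmf ?P \<subseteq> ?A"
    using set_Pi_pmf_subset[of "{..<N}" undefined "\<lambda>i. embed_pmf (p i)"] by (auto simp: PiE_dflt_def)
  have bij: "bij_betw (\<lambda>\<omega>. map \<omega> [0..<N]) ?A {ys. length ys = N}"
  proof (rule bij_betw_byWitness[where f'="\<lambda>ys i. if i < N then ys ! i else undefined"])
    show "\<forall>\<omega>\<in>?A. (\<lambda>i. if i < N then map \<omega> [0..<N] ! i else undefined) = \<omega>"
      by (auto simp: PiE_dflt_def fun_eq_iff)
    show "\<forall>ys\<in>{ys. length ys = N}. map (\<lambda>i. if i < N then ys ! i else undefined) [0..<N] = ys"
      by (auto intro: nth_equalityI)
  qed (auto simp: PiE_dflt_def)
  have "measure_pmf.expectation ?P (\<lambda>\<omega>. F (\<Sum>i<N. s (\<omega> i))) = (\<Sum>\<omega>\<in>?A. F (\<Sum>i<N. s (\<omega> i)) * pmf ?P \<omega>)"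
    using fin sub by (intro integral_measure_pmf_real) auto
  also have "\<dots> = (\<Sum>\<omega>\<in>?A. (\<Prod>i<N. p i (map \<omega> [0..<N] ! i)) * F (word_score s (map \<omega> [0..<N])))"
  proof (rule sum.cong[OF refl])
    fix \<omega> assume "\<omega> \<in> ?A"
    then have "pmf ?P \<omega> = (\<Prod>i<N. pmf (embed_pmf (p i)) (\<omega> i))"
      by (intro pmf_Pi') (auto simp: PiE_dflt_def)
    also have "\<dots> = (\<Prod>i<N. p i (map \<omega> [0..<N] ! i))"
      using p by (intro prod.cong) (auto simp: pmf_of_prob_vec)
    finally show "F (\<Sum>i<N. s (\<omega> i)) * pmf ?P \<omega> = (\<Prod>i<N. p i (map \<omega> [0..<N] ! i)) * F (word_score s (map \<omega> [0..<N]))"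
      by (simp add: word_score_def)
  qed
  also have "\<dots> = word_sum N p (\<lambda>ys. F (word_score s ys))"
    unfolding word_sum_def by (rule sum.reindex_bij_betw[OF bij])
  finally show ?thesis ..
qed

lemma
  fixes p :: "nat \<Rightarrow> 'y::finite \<Rightarrow> real"
  assumes p: "\<And>i. i < N \<Longrightarrow> prob_vec (p i)"
    and s: "\<And>y. \<bar>s y\<bar> \<le> b"
    and m: "m = (\<Sum>i<N. mean (p i) s)" and V: "V = (\<Sum>i<N. var (p i) s)"
  shows word_chebyshev: "0 < t \<Longrightarrow>
      word_sum N p (\<lambda>ys. if word_score s ys > m + t then 1 else 0) \<le> V / t\<^sup>2"
    and word_berry_esseen: "0 < V \<Longrightarrow> (\<And>z w. stein_sol z w \<le> B) \<Longrightarrow>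
      word_sum N p (\<lambda>ys. if word_score s ys > l then 1 else 0)
        \<le> 1 - Phi ((l - m) / sqrt V) + (36 + 2 * B) * (2 * b / sqrt V)"
    and word_exponential: "0 < V \<Longrightarrow>
      word_sum N p (\<lambda>ys. if word_score s ys \<le> l then exp (word_score s ys - l) else 0)
        \<le> exp (4 * b) * (1 + 2 * b) / sqrt V"
proof -
  let ?P = "Pi_pmf {..<N} undefined (\<lambda>i. embed_pmf (p i))"
  let ?Y = "\<lambda>i \<omega>. s (\<omega> i)"
  have E: "measure_pmf.expectation ?P (\<lambda>\<omega>. g (\<omega> i)) = (\<Sum>y\<in>UNIV. p i y * g y)" if "i < N" for g :: "'y \<Rightarrow> real" and i
  proof -
    have "measure_pmf.expectation ?P (\<lambda>\<omega>. g (\<omega> i)) = measure_pmf.expectation (map_pmf (\<lambda>\<omega>. \<omega> i) ?P) g"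
      by simp
    also have "map_pmf (\<lambda>\<omega>. \<omega> i) ?P = embed_pmf (p i)"
      using that by (subst Pi_pmf_component) auto
    also have "measure_pmf.expectation (embed_pmf (p i)) g = (\<Sum>y\<in>UNIV. p i y * g y)"
      using p[OF that] by (subst integral_measure_pmf_real[where A=UNIV]) (auto simp: pmf_of_prob_vec mult.commute)
    finally show ?thesis .
  qed
  have ind: "prob_space.indep_vars (measure_pmf ?P) (\<lambda>_. borel) ?Y {..<N}"
    using prob_space.indep_vars_compose2[OF prob_space_measure_pmf indep_vars_Pi_pmf[of "{..<N}" undefined "\<lambda>i. embed_pmf (p i)"], of "\<lambda>_. s" "\<lambda>_. borel"]
    by simp
  have m': "m = (\<Sum>i<N. measure_pmf.expectation ?P (?Y i))" unfolding m using E by (simp add: mean_def)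
  have V': "V = (\<Sum>i<N. measure_pmf.variance ?P (?Y i))"
    unfolding V var_def
  proof (intro sum.cong refl)
    fix i assume "i \<in> {..<N}"
    then have i: "i < N" by simp
    show "(\<Sum>y\<in>UNIV. p i y * (s y - mean (p i) s)\<^sup>2) = measure_pmf.variance ?P (?Y i)"
      using E[OF i, of s] E[OF i, of "\<lambda>y. (s y - mean (p i) s)\<^sup>2"] by (simp add: mean_def)
  qed
  note facts = finite_lessThan ind s m' V'
  have P: "measure_pmf.expectation ?P (\<lambda>\<omega>. if Q \<omega> then 1 else 0) = measure_pmf.prob ?P {\<omega>\<in>space ?P. Q \<omega>}" for Q
  proof -
    have "(\<lambda>\<omega>. if Q \<omega> then 1 else 0 :: real) = indicator {\<omega>. Q \<omega>}" by (auto simp: indicator_def)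
    then show ?thesis by simp
  qed
  show "word_sum N p (\<lambda>ys. if word_score s ys > m + t then 1 else 0) \<le> V / t\<^sup>2" if "0 < t"
    using prob_space.chebyshev_sum[OF prob_space_measure_pmf facts that] word_sum_eq_expectation[where F="\<lambda>x. if x > m + t then 1 else 0" and s=s, OF p]
    by (simp add: P)
  assume V0: "0 < V"
  show "word_sum N p (\<lambda>ys. if word_score s ys \<le> l then exp (word_score s ys - l) else 0)
        \<le> exp (4 * b) * (1 + 2 * b) / sqrt V"
    using prob_space.exponential_sum[OF prob_space_measure_pmf facts V0, of l]
      word_sum_eq_expectation[where F="\<lambda>x. if x \<le> l then exp (x - l) else 0" and s=s, OF p] by simp
  assume B: "\<And>z w. stein_sol z w \<le> B"
  have "measure_pmf.prob ?P {\<omega>\<in>space ?P. l < (\<Sum>i<N. ?Y i \<omega>)} = 1 - measure_pmf.prob ?P {\<omega>\<in>space ?P. (\<Sum>i<N. ?Y i \<omega>) \<le> l}"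
    by (subst measure_pmf.prob_compl[symmetric]) (auto intro!: arg_cong[where f="measure_pmf.prob ?P"])
  then show "word_sum N p (\<lambda>ys. if word_score s ys > l then 1 else 0)
        \<le> 1 - Phi ((l - m) / sqrt V) + (36 + 2 * B) * (2 * b / sqrt V)"
    using prob_space.berry_esseen_sum[OF prob_space_measure_pmf facts V0 B, of l] word_sum_eq_expectation[where F="\<lambda>x. if x > l then 1 else 0" and s=s, OF p]
    by (simp add: P)
qed

section \<open>Linear programming penalty and variances\<close>

lemma finite_positive_lower_bound:
  fixes f :: "'a::finite \<Rightarrow> real"
  obtains k where "0 < k" "k \<le> 1" "\<And>x. 0 < f x \<Longrightarrow> k \<le> f x"
proof
  \<comment> \<open>The inserted 1 keeps the set nonempty when \<open>f\<close> has no positive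
    value.\<close>
  let ?A = "insert 1 (f ` {x. 0 < f x})"
  show "0 < Min ?A" by (subst Min_gr_iff) auto
  show "Min ?A \<le> 1" by (rule Min_le) auto
  show "Min ?A \<le> f x" if "0 < f x" for x using that by (intro Min_le) auto
qed

text \<open>The attainable pairs of constraint value and cost form a polytope \<open>D\<close>. A
  supporting halfspace at its lowest point over \<open>u0\<close> that is not vertical has finite
  slope, and this slope bounds how fast the optimum improves as the constraint is violated. For a
  general convex set it could be infinite; finitely many facets rule that out.\<close>

lemma exact_penalty:
  fixes T :: "'x::finite \<Rightarrow> 'u::euclidean_space" and c :: "'x \<Rightarrow> real" and u0 :: 'u
  defines "F \<equiv> {P. prob_vec P \<and> (\<Sum>x\<in>UNIV. P x *\<^sub>R T x) = u0}"
  assumes "F \<noteq> {}"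
  obtains K where "0 \<le> K"
    "\<And>P. prob_vec P \<Longrightarrow> (INF Q\<in>F. \<Sum>x\<in>UNIV. Q x * c x)
        - K * norm ((\<Sum>x\<in>UNIV. P x *\<^sub>R T x) - u0) \<le> (\<Sum>x\<in>UNIV. P x * c x)"
proof -
  define G where "G x = (T x, c x)" for x
  define D where "D = convex hull (range G)"
  have D_eq: "D = {\<Sum>x\<in>UNIV. P x *\<^sub>R G x | P. prob_vec P}"
  proof
    show "{\<Sum>x\<in>UNIV. P x *\<^sub>R G x | P. prob_vec P} \<subseteq> D"
    proof
      fix p assume "p \<in> {\<Sum>x\<in>UNIV. P x *\<^sub>R G x | P. prob_vec P}"
      then obtain P where P: "p = (\<Sum>x\<in>UNIV. P x *\<^sub>R G x)" "prob_vec P" by blast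
      then show "p \<in> D"
        unfolding D_def prob_vec_def P(1) by (intro convex_sum convex_convex_hull) (auto intro: hull_inc)
    qed
    have "convex {\<Sum>x\<in>UNIV. P x *\<^sub>R G x | P. prob_vec P}"
    proof (rule convexI)
      fix a b and u v :: real
      assume uv: "0 \<le> u" "0 \<le> v" "u + v = 1"
      assume "a \<in> {\<Sum>x\<in>UNIV. P x *\<^sub>R G x | P. prob_vec P}" "b \<in> {\<Sum>x\<in>UNIV. P x *\<^sub>R G x | P. prob_vec P}"
      then obtain P Q where PQ: "prob_vec P" "a = (\<Sum>x\<in>UNIV. P x *\<^sub>R G x)" "prob_vec Q" "b = (\<Sum>x\<in>UNIV. Q x *\<^sub>R G x)"
        by blast
      have "prob_vec (\<lambda>x. u * P x + v * Q x)"
        using PQ uv by (auto simp: prob_vec_def sum.distrib simp flip: sum_distrib_left)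
      moreover have "u *\<^sub>R a + v *\<^sub>R b = (\<Sum>x\<in>UNIV. (u * P x + v * Q x) *\<^sub>R G x)"
        by (simp add: PQ scaleR_sum_right scaleR_add_left sum.distrib)
      ultimately show "u *\<^sub>R a + v *\<^sub>R b \<in> {\<Sum>x\<in>UNIV. P x *\<^sub>R G x | P. prob_vec P}"
        by (intro CollectI exI[of _ "\<lambda>x. u * P x + v * Q x"] conjI)
    qed
    moreover have "G x \<in> {\<Sum>x\<in>UNIV. P x *\<^sub>R G x | P. prob_vec P}" for x
      by (rule CollectI, rule exI[of _ "\<lambda>z. if z = x then 1 else 0"])
         (auto simp: prob_vec_def if_distrib[of "\<lambda>r. r *\<^sub>R _"] cong: if_cong)
    ultimately show "D \<subseteq> {\<Sum>x\<in>UNIV. P x *\<^sub>R G x | P. prob_vec P}"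
      unfolding D_def by (intro hull_minimal) auto
  qed
  have G_sum: "(\<Sum>x\<in>UNIV. P x *\<^sub>R G x) = (\<Sum>x\<in>UNIV. P x *\<^sub>R T x, \<Sum>x\<in>UNIV. P x * c x)" for P
    by (simp add: G_def sum_prod)
  have sec: "(u0, h) \<in> D \<longleftrightarrow> h \<in> (\<lambda>Q. \<Sum>x\<in>UNIV. Q x * c x) ` F" for h
    unfolding D_eq G_sum F_def by auto
  define V where "V = (INF Q\<in>F. \<Sum>x\<in>UNIV. Q x * c x)"
  have cD: "compact D" unfolding D_def by (intro compact_convex_hull finite_imp_compact) auto
  have "compact (D \<inter> {p. fst p = u0})"
    by (intro compact_Int_closed cD closed_Collect_eq continuous_intros)
  then have "compact (snd ` (D \<inter> {p. fst p = u0}))"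
    by (intro compact_continuous_image continuous_intros)
  moreover have "snd ` (D \<inter> {p. fst p = u0}) = (\<lambda>Q. \<Sum>x\<in>UNIV. Q x * c x) ` F"
    using sec by force
  ultimately have comp: "compact ((\<lambda>Q. \<Sum>x\<in>UNIV. Q x * c x) ` F)" by simp
  have "V \<in> (\<lambda>Q. \<Sum>x\<in>UNIV. Q x * c x) ` F"
    unfolding V_def using comp assms(2) by (intro closed_contains_Inf compact_imp_closed bounded_imp_bdd_below compact_imp_bounded) auto
  then have VD: "(u0, V) \<in> D" by (simp add: sec)
  have Vmin: "V \<le> h" if "(u0, h) \<in> D" for h
    using that comp unfolding sec V_def
    by (intro cInf_lower bounded_imp_bdd_below compact_imp_bounded)
  have "polyhedron D" unfolding D_def by (intro polyhedron_convex_hull) auto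
  then obtain H where H: "finite H" "D = \<Inter> H" "\<And>h. h \<in> H \<Longrightarrow> \<exists>a b. a \<noteq> 0 \<and> h = {x. a \<bullet> x \<le> b}"
    unfolding polyhedron_def by auto
  define al be where "al h = (SOME a. \<exists>b. h = {x. a \<bullet> x \<le> b})"
    and "be h = (SOME b. h = {x. al h \<bullet> x \<le> b})" for h :: "('u \<times> real) set"
  have half: "h = {x. al h \<bullet> x \<le> be h}" if "h \<in> H" for h
  proof -
    have "\<exists>b. h = {x. al h \<bullet> x \<le> b}"
      unfolding al_def by (rule someI_ex) (use H(3)[OF that] in blast)
    then show ?thesis unfolding be_def by (rule someI_ex)
  qed
  have D_iff: "p \<in> D \<longleftrightarrow> (\<forall>h\<in>H. al h \<bullet> p \<le> be h)" for p
    using half H(2) by blast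
  \<comment> \<open>Some constraint active at the minimum must block the downward direction; it is the required penalty.\<close>
  have "\<exists>h\<in>H. al h \<bullet> (u0, V) = be h \<and> snd (al h) < 0"
  proof (rule ccontr)
    assume neg: "\<not> ?thesis"
    define slack where "slack h = be h - al h \<bullet> (u0, V)" for h
    \<comment> \<open>A downward step so short that no inactive constraint is violated; the active
      ones have nonnegative vertical component by \<open>neg\<close> and are not tightened.\<close>
    define e where "e = Min (insert 1 ((\<lambda>h. slack h / (\<bar>snd (al h)\<bar> + 1)) ` {h\<in>H. 0 < slack h}))"
    have e0: "0 < e" unfolding e_def using H(1) by (subst Min_gr_iff) auto
    have "al h \<bullet> (u0, V - e) \<le> be h" if h: "h \<in> H" for h
    proof -
      have eq: "al h \<bullet> (u0, V - e) = al h \<bullet> (u0, V) - e * snd (al h)"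
        by (simp add: inner_prod_def algebra_simps)
      have s0: "0 \<le> slack h" using VD h unfolding D_iff slack_def by auto
      show ?thesis
      proof (cases "slack h = 0")
        case True
        then have "0 \<le> snd (al h)" using neg h by (force simp: slack_def)
        then show ?thesis using e0 s0 unfolding eq slack_def by (smt (verit) mult_nonneg_nonneg)
      next
        case False
        then have "e \<le> slack h / (\<bar>snd (al h)\<bar> + 1)"
          unfolding e_def using h s0 H(1) by (intro Min_le) auto
        then have "e * (\<bar>snd (al h)\<bar> + 1) \<le> slack h" by (simp add: pos_le_divide_eq)
        moreover have "e * (- snd (al h)) \<le> e * (\<bar>snd (al h)\<bar> + 1)" using e0 by (intro mult_left_mono) auto
        ultimately show ?thesis unfolding eq slack_def by simp
      qed
    qed
    then have "(u0, V - e) \<in> D" by (simp add: D_iff)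
    with Vmin e0 show False by fastforce
  qed
  then obtain h where h: "h \<in> H" "al h \<bullet> (u0, V) = be h" "snd (al h) < 0" by blast
  \<comment> \<open>Steepness of the blocking constraint: size of its horizontal part relative to
    its vertical one.\<close>
  define K where "K = norm (fst (al h)) / (- snd (al h))"
  show ?thesis
  proof
    show "0 \<le> K" unfolding K_def using h by (intro divide_nonneg_pos) auto
    fix P :: "'x \<Rightarrow> real" assume P: "prob_vec P"
    define u r where "u = (\<Sum>x\<in>UNIV. P x *\<^sub>R T x)" and "r = (\<Sum>x\<in>UNIV. P x * c x)"
    have "(u, r) \<in> D" unfolding D_eq u_def r_def G_sum[symmetric] using P by blast
    then have "al h \<bullet> (u, r) \<le> al h \<bullet> (u0, V)" using h D_iff by auto
    then have "(- snd (al h)) * (V - r) \<le> - (fst (al h) \<bullet> (u - u0))"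
      by (simp add: inner_prod_def inner_diff_right algebra_simps)
    also have "\<dots> \<le> norm (fst (al h)) * norm (u - u0)"
      using Cauchy_Schwarz_ineq2[of "fst (al h)" "u - u0"] by linarith
    also have "\<dots> = (- snd (al h)) * (K * norm (u - u0))" using h by (simp add: K_def)
    finally have "V - r \<le> K * norm (u - u0)" using h(3) by (simp add: mult_le_cancel_left)
    then show "(INF Q\<in>F. \<Sum>x\<in>UNIV. Q x * c x) - K * norm ((\<Sum>x\<in>UNIV. P x *\<^sub>R T x) - u0) \<le> (\<Sum>x\<in>UNIV. P x * c x)"
      by (simp add: V_def u_def r_def)
  qed
qed

section \<open>Means and variances under a probability vector\<close>

lemma mean_bounds:
  assumes p: "prob_vec p" and s: "\<And>y. \<bar>s y\<bar> \<le> b"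
  shows "\<bar>mean p s\<bar> \<le> b"
proof -
  have "\<bar>mean p s\<bar> \<le> (\<Sum>y\<in>UNIV. \<bar>p y * s y\<bar>)" unfolding mean_def by (rule sum_abs)
  also have "\<dots> \<le> (\<Sum>y\<in>UNIV. p y * b)"
    using p s by (intro sum_mono) (auto simp: abs_mult prob_vec_def intro!: mult_left_mono)
  also have "\<dots> = b" using p by (simp add: prob_vec_def flip: sum_distrib_right)
  finally show ?thesis .
qed

lemma mean_diff: "mean p s - mean p t = mean p (\<lambda>y. s y - t y)"
  by (simp add: mean_def right_diff_distrib sum_subtractf)

lemma sum_square_dev:
  assumes "prob_vec p"
  shows "(\<Sum>y\<in>UNIV. p y * (s y - a)\<^sup>2) = var p s + (mean p s - a)\<^sup>2"
proof -
  have "(\<Sum>y\<in>UNIV. p y * (s y - a)\<^sup>2) =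
     (\<Sum>y\<in>UNIV. p y * (s y - mean p s)\<^sup>2 + 2 * (mean p s - a) * (p y * s y) + p y * (a\<^sup>2 - (mean p s)\<^sup>2))"
    by (intro sum.cong refl) (simp add: power2_eq_square algebra_simps)
  also have "\<dots> = var p s + 2 * (mean p s - a) * mean p s + (a\<^sup>2 - (mean p s)\<^sup>2)"
    using assms by (simp add: sum.distrib var_def prob_vec_def flip: sum_distrib_left sum_distrib_right mean_def)
  finally show ?thesis by (simp add: power2_eq_square algebra_simps)
qed

lemma var_eq: "prob_vec p \<Longrightarrow> var p s = mean p (\<lambda>y. (s y)\<^sup>2) - (mean p s)\<^sup>2"
  using sum_square_dev[of p s 0] by (simp add: mean_def)

lemma var_nonneg: "prob_vec p \<Longrightarrow> 0 \<le> var p s"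
  unfolding var_def prob_vec_def by (intro sum_nonneg mult_nonneg_nonneg) auto

lemma var_le: "prob_vec p \<Longrightarrow> (\<And>y. \<bar>s y\<bar> \<le> b) \<Longrightarrow> var p s \<le> b\<^sup>2"
proof -
  assume p: "prob_vec p" and s: "\<And>y. \<bar>s y\<bar> \<le> b"
  have "\<bar>(s y)\<^sup>2\<bar> \<le> b\<^sup>2" for y using power_mono[OF s[of y], of 2] by simp
  then have "mean p (\<lambda>y. (s y)\<^sup>2) \<le> b\<^sup>2" using mean_bounds[OF p, of "\<lambda>y. (s y)\<^sup>2" "b\<^sup>2"] by auto
  then show ?thesis using var_eq[OF p, of s] zero_le_power2[of "mean p s"] by linarith
qed

lemma var_lipschitz:
  assumes p: "prob_vec p" and s: "\<And>y. \<bar>s y\<bar> \<le> b" "\<And>y. \<bar>t y\<bar> \<le> b" and st: "\<And>y. \<bar>s y - t y\<bar> \<le> d"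
  shows "\<bar>var p s - var p t\<bar> \<le> 4 * b * d"
proof -
  have sq: "\<bar>x\<^sup>2 - z\<^sup>2\<bar> \<le> 2 * b * d" if "\<bar>x\<bar> \<le> b" "\<bar>z\<bar> \<le> b" "\<bar>x - z\<bar> \<le> d" for x z :: real
  proof -
    have "\<bar>x\<^sup>2 - z\<^sup>2\<bar> = \<bar>x + z\<bar> * \<bar>x - z\<bar>" by (simp add: abs_mult[symmetric] power2_eq_square algebra_simps)
    also have "\<dots> \<le> (2 * b) * d" using that by (intro mult_mono) auto
    finally show ?thesis .
  qed
  have 1: "\<bar>mean p (\<lambda>y. (s y)\<^sup>2) - mean p (\<lambda>y. (t y)\<^sup>2)\<bar> \<le> 2 * b * d"
    unfolding mean_diff using s st by (intro mean_bounds p sq) auto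
  have 2: "\<bar>(mean p s)\<^sup>2 - (mean p t)\<^sup>2\<bar> \<le> 2 * b * d"
    using mean_bounds[OF p s(1)] mean_bounds[OF p s(2)] mean_bounds[OF p st]
    by (intro sq) (auto simp: mean_diff)
  show ?thesis using 1 2 unfolding var_eq[OF p] by linarith
qed

text \<open>The variance under \<open>p\<close> is the least second moment about any centre, in
  particular about the mean under \<open>q\<close>, and \<open>q\<close> dominates
  \<open>p / 2\<close>.\<close>

lemma var_mono_half:
  assumes "prob_vec p" "prob_vec q" "\<And>y. p y / 2 \<le> q y"
  shows "var p s / 2 \<le> var q s"
proof -
  have "var p s / 2 \<le> (\<Sum>y\<in>UNIV. p y * (s y - mean q s)\<^sup>2) / 2"
    unfolding sum_square_dev[OF assms(1)] by simp
  also have "\<dots> = (\<Sum>y\<in>UNIV. p y / 2 * (s y - mean q s)\<^sup>2)" by (simp add: sum_divide_distrib)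
  also have "\<dots> \<le> var q s"
    unfolding var_def using assms(3) by (intro sum_mono mult_right_mono) auto
  finally show ?thesis .
qed

section \<open>Capacity\<close>

text \<open>Continuity at 0 is the point: output probabilities may vanish on the boundary of the
  simplex.\<close>

lemma continuous_on_xlnx: "continuous_on {0..} (\<lambda>x::real. x * ln x)"
proof -
  have "((\<lambda>x::real. x * ln x) \<longlongrightarrow> x * ln x) (at x within {0..})" if "0 \<le> x" for x
  proof (cases "x = 0")
    case True
    have "((\<lambda>x::real. x * ln x) \<longlongrightarrow> 0) (at_right 0)" by real_asymp
    moreover have "at (0::real) within {0..} = at_right 0" 
      unfolding at_within_def by (intro arg_cong[where f="\<lambda>A. inf _ (principal A)"]) auto
    ultimately show ?thesis using True by simp
  next
    case False
    then show ?thesis using that by (intro tendsto_intros) auto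
  qed
  then show ?thesis unfolding continuous_on_def by simp
qed

text \<open>A letter with \<open>p y > 0\<close> and \<open>q y = 0\<close> contributes 0 instead of
  infinity, by totalised division and logarithm; absolute continuity therefore appears as a
  hypothesis where divergences are compared.\<close>

definition kl :: "('y::finite \<Rightarrow> real) \<Rightarrow> ('y \<Rightarrow> real) \<Rightarrow> real" where
  "kl p q = (\<Sum>y\<in>UNIV. p y * ln (p y / q y))"

lemma kl_nonneg:
  assumes p: "prob_vec p" and q: "prob_vec q" and ac: "\<And>y. 0 < p y \<Longrightarrow> 0 < q y"
  shows "0 \<le> kl p q"
proof -
  have "p y - q y \<le> p y * ln (p y / q y)" for y
  proof (cases "p y = 0")
    case True
    then show ?thesis using q by (simp add: prob_vec_def)
  next
    case False
    then have py: "0 < p y" using p by (simp add: prob_vec_def order_less_le)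
    then have "1 - q y / p y \<le> ln (p y / q y)"
      using ln_le_minus_one[of "q y / p y"] ac[of y] by (simp add: ln_div)
    then have "p y * (1 - q y / p y) \<le> p y * ln (p y / q y)" using py by (intro mult_left_mono) auto
    then show ?thesis using py by (simp add: right_diff_distrib)
  qed
  then have "(\<Sum>y\<in>UNIV. p y - q y) \<le> kl p q" unfolding kl_def by (intro sum_mono)
  then show ?thesis using p q by (simp add: sum_subtractf prob_vec_def)
qed

section \<open>Mutual information and optimality conditions for capacity\<close>

locale dmc =
  fixes W :: "'x::finite \<Rightarrow> 'y::finite \<Rightarrow> real"
  assumes channel: "channel W"
begin

lemma W_nonneg: "0 \<le> W x y" and prob_W: "prob_vec (W x)"
  using channel by (auto simp: channel_def prob_vec_def)

lemma prob_vec_q_out: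
  assumes "prob_vec P"
  shows "prob_vec (q_out P W)"
proof -
  have "(\<Sum>y\<in>UNIV. q_out P W y) = (\<Sum>x\<in>UNIV. P x * (\<Sum>y\<in>UNIV. W x y))"
    unfolding q_out_def by (subst sum.swap) (simp add: sum_distrib_left)
  then show ?thesis
    using assms prob_W W_nonneg by (auto simp: prob_vec_def q_out_def intro!: sum_nonneg)
qed

lemma q_out_pos:
  assumes "prob_vec P" "0 < P x" "0 < W x y"
  shows "0 < q_out P W y"
proof -
  have "P x * W x y \<le> q_out P W y"
    unfolding q_out_def using assms W_nonneg
    by (intro member_le_sum) (auto simp: prob_vec_def)
  then show ?thesis using assms mult_pos_pos[of "P x" "W x y"] by linarith
qed

lemma q_out_pos_iff:
  assumes "prob_vec P"
  shows "0 < q_out P W y \<longleftrightarrow> (\<exists>x. 0 < P x \<and> 0 < W x y)"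
proof
  assume "0 < q_out P W y"
  then have "(\<Sum>x\<in>UNIV. P x * W x y) \<noteq> 0" by (simp add: q_out_def)
  then obtain x where "P x * W x y \<noteq> 0" by (rule sum.not_neutral_contains_not_neutral)
  then show "\<exists>x. 0 < P x \<and> 0 < W x y"
    using assms W_nonneg[of x y] by (intro exI[of _ x]) (auto simp: prob_vec_def order_less_le)
qed (use q_out_pos[OF assms] in blast)

lemma mutual_info_eq:
  assumes "prob_vec P"
  shows "mutual_info P W = (\<Sum>x\<in>UNIV. P x * kl (W x) (q_out P W))"
  unfolding mutual_info_def kl_def sum_distrib_left
proof (intro sum.cong refl)
  fix x y
  have "0 \<le> P x * W x y" using assms W_nonneg[of x y] by (simp add: prob_vec_def)
  then have "0 < P x * W x y \<or> P x = 0 \<or> W x y = 0" by (auto simp: order_less_le)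
  then show "(if 0 < P x * W x y then P x * W x y * ln (W x y / q_out P W y) else 0) =
      P x * (W x y * ln (W x y / q_out P W y))"
    by auto
qed

text \<open>Compensation identity: exchanging \<open>q_out P W\<close> for \<open>q\<close> adds a
  logarithm that depends on the output only and averages to a divergence.\<close>

lemma kl_mixture:
  assumes P: "prob_vec P" and ac: "\<And>x y. 0 < P x \<Longrightarrow> 0 < W x y \<Longrightarrow> 0 < q y"
  shows "(\<Sum>x\<in>UNIV. P x * kl (W x) q) = mutual_info P W + kl (q_out P W) q"
proof -
  have "P x * (W x y * ln (W x y / q y)) =
      P x * (W x y * ln (W x y / q_out P W y)) + P x * W x y * ln (q_out P W y / q y)" for x y
  proof (cases "0 < P x \<and> 0 < W x y")
    case True
    then show ?thesis using ac[of x y] q_out_pos[OF P, of x y] by (simp add: ln_div algebra_simps)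
  next
    case False
    then have "P x = 0 \<or> W x y = 0" using P W_nonneg[of x y] by (auto simp: prob_vec_def order_less_le)
    then show ?thesis by auto
  qed
  then have "(\<Sum>x\<in>UNIV. P x * kl (W x) q) =
      mutual_info P W + (\<Sum>x\<in>UNIV. \<Sum>y\<in>UNIV. P x * W x y * ln (q_out P W y / q y))"
    by (simp add: mutual_info_eq[OF P] kl_def sum_distrib_left sum.distrib)
  also have "(\<Sum>x\<in>UNIV. \<Sum>y\<in>UNIV. P x * W x y * ln (q_out P W y / q y)) = kl (q_out P W) q"
    unfolding kl_def by (subst sum.swap) (simp add: q_out_def sum_distrib_right)
  finally show ?thesis .
qed

lemma mutual_info_le:
  assumes P: "prob_vec P" and q: "prob_vec q" and ac: "\<And>x y. 0 < P x \<Longrightarrow> 0 < W x y \<Longrightarrow> 0 < q y"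
  shows "mutual_info P W \<le> (\<Sum>x\<in>UNIV. P x * kl (W x) q)"
proof -
  have "0 \<le> kl (q_out P W) q"
    using ac q_out_pos_iff[OF P] by (intro kl_nonneg prob_vec_q_out P q) blast
  moreover have "(\<Sum>x\<in>UNIV. P x * kl (W x) q) = mutual_info P W + kl (q_out P W) q"
    using ac by (rule kl_mixture[OF P])
  ultimately show ?thesis by simp
qed

lemma input_dists_eq: "input_dists = {P :: 'x \<Rightarrow> real. prob_vec P}"
  by (auto simp: input_dists_def prob_vec_def)

lemma capacity_attained:
  "\<exists>Q. prob_vec Q \<and> mutual_info Q W = capacity W \<and> (\<forall>P. prob_vec P \<longrightarrow> mutual_info P W \<le> capacity W)"
proof -
  define K where "K = {v :: real^'x. prob_vec (\<lambda>x. v $ x)}"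
  define F where "F v = mutual_info (\<lambda>x. v $ x) W" for v :: "real^'x"
  have "K = {v. \<forall>x. 0 \<le> v $ x} \<inter> {v. (\<Sum>x\<in>UNIV. v $ x) = 1}"
    by (auto simp: K_def prob_vec_def)
  moreover have "closed {v :: real^'x. \<forall>x. 0 \<le> v $ x}"
    by (intro closed_Collect_all closed_Collect_le continuous_intros)
  moreover have "closed {v :: real^'x. (\<Sum>x\<in>UNIV. v $ x) = 1}"
    by (intro closed_Collect_eq continuous_intros)
  ultimately have "closed K" by auto
  moreover have "bounded K"
  proof (rule boundedI)
    fix v assume "v \<in> K"
    then have "(\<Sum>x\<in>UNIV. \<bar>v $ x\<bar>) = 1" by (simp add: K_def prob_vec_def)
    then show "norm v \<le> 1" using norm_le_l1_cart[of v] by simp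
  qed
  ultimately have "compact K" by (simp add: compact_eq_bounded_closed)
  \<comment> \<open>In this form the output law enters only through \<open>q * ln q\<close>, which
    stays continuous where output probabilities vanish; on the compact simplex a maximum then
    exists.\<close>
  have F_eq: "F v = (\<Sum>x\<in>UNIV. v $ x * (\<Sum>y\<in>UNIV. W x y * ln (W x y)))
      - (\<Sum>y\<in>UNIV. q_out (\<lambda>x. v $ x) W y * ln (q_out (\<lambda>x. v $ x) W y))" if "v \<in> K" for v
  proof -
    let ?P = "\<lambda>x. v $ x"
    have P: "prob_vec ?P" using that by (simp add: K_def)
    have "?P x * (W x y * ln (W x y / q_out ?P W y)) =
      ?P x * (W x y * ln (W x y)) - ?P x * W x y * ln (q_out ?P W y)" for x y
    proof (cases "0 < ?P x \<and> 0 < W x y")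
      case True
      then show ?thesis using q_out_pos[OF P, of x y] by (simp add: ln_div algebra_simps)
    next
      case False
      then have "?P x = 0 \<or> W x y = 0" using P W_nonneg[of x y] by (auto simp: prob_vec_def order_less_le)
      then show ?thesis by auto
    qed
    then have "F v = (\<Sum>x\<in>UNIV. v $ x * (\<Sum>y\<in>UNIV. W x y * ln (W x y)))
        - (\<Sum>x\<in>UNIV. \<Sum>y\<in>UNIV. ?P x * W x y * ln (q_out ?P W y))"
      by (simp add: F_def mutual_info_eq[OF P] kl_def sum_distrib_left sum_subtractf)
    also have "(\<Sum>x\<in>UNIV. \<Sum>y\<in>UNIV. ?P x * W x y * ln (q_out ?P W y)) = (\<Sum>y\<in>UNIV. q_out ?P W y * ln (q_out ?P W y))"
      by (subst sum.swap) (simp add: q_out_def sum_distrib_right)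
    finally show ?thesis .
  qed
  have contq: "continuous_on K (\<lambda>v. q_out (\<lambda>x. v $ x) W y)" for y
    unfolding q_out_def by (intro continuous_intros)
  have qnn: "0 \<le> q_out (\<lambda>x. v $ x) W y" if "v \<in> K" for v y
    using prob_vec_q_out[of "\<lambda>x. v $ x"] that by (simp add: K_def prob_vec_def)
  have "continuous_on K (\<lambda>v. q_out (\<lambda>x. v $ x) W y * ln (q_out (\<lambda>x. v $ x) W y))" for y
    using continuous_on_compose2[OF continuous_on_xlnx contq] qnn by auto
  note c = this
  have "continuous_on K (\<lambda>v. (\<Sum>x\<in>UNIV. v $ x * (\<Sum>y\<in>UNIV. W x y * ln (W x y)))
      - (\<Sum>y\<in>UNIV. q_out (\<lambda>x. v $ x) W y * ln (q_out (\<lambda>x. v $ x) W y)))"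
    by (intro continuous_on_diff continuous_on_sum c) (intro continuous_intros)
  then have "continuous_on K F" using F_eq by (simp cong: continuous_on_cong)
  moreover have "K \<noteq> {}"
  proof -
    have "axis a 1 \<in> K" for a :: 'x
      by (auto simp: K_def prob_vec_def axis_def)
    then show ?thesis by blast
  qed
  ultimately obtain v where v: "v \<in> K" "\<And>u. u \<in> K \<Longrightarrow> F u \<le> F v"
    using continuous_attains_sup[OF \<open>compact K\<close>] by blast
  let ?Q = "\<lambda>x. v $ x"
  have le: "mutual_info P W \<le> mutual_info ?Q W" if "prob_vec P" for P
  proof -
    have "($) (vec_lambda P) = P" by (rule ext) simp
    then show ?thesis using v(2)[of "\<chi> x. P x"] that by (simp add: K_def F_def)
  qed
  have "capacity W = mutual_info ?Q W"
    unfolding capacity_def input_dists_eq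
    using v(1) le by (intro cSup_eq_maximum) (auto simp: K_def)
  with le v(1) show ?thesis by (intro exI[of _ ?Q]) (auto simp: K_def)
qed

lemma mutual_info_le_capacity: "prob_vec P \<Longrightarrow> mutual_info P W \<le> capacity W"
  using capacity_attained by blast

text \<open>Proved by moving the capacity-achieving input towards a point mass.\<close>
lemma kuhn_tucker:
  assumes Q: "prob_vec Q" "mutual_info Q W = capacity W"
  shows "0 < W x y \<Longrightarrow> 0 < q_out Q W y" "kl (W x) (q_out Q W) \<le> capacity W"
proof -
  let ?q = "q_out Q W"
  define qt where "qt t y = (1 - t) * ?q y + t * W x y" for t y
  have q: "prob_vec ?q" by (rule prob_vec_q_out[OF Q(1)])
  have qt: "prob_vec (qt t)" if "0 \<le> t" "t \<le> 1" for t
    using q prob_W[of x] that unfolding qt_def prob_vec_def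
    by (auto simp: sum.distrib simp flip: sum_distrib_left)
  \<comment> \<open>The capacity bounds the mutual information of the mixture \<open>Qt\<close>,
    while the share of \<open>Q\<close> is already at least \<open>1 - t\<close> times the capacity
    by \<open>mutual_info_le\<close>. What remains is \<open>t\<close> times the divergence of
    \<open>W x\<close>.\<close>
  have kl_le: "kl (W x) (qt t) \<le> capacity W" if t: "0 < t" "t < 1" for t
  proof -
    define Qt where "Qt z = (1 - t) * Q z + t * (if z = x then 1 else 0)" for z
    have Qt: "prob_vec Qt"
      using Q(1) t unfolding Qt_def prob_vec_def by (auto simp: sum.distrib simp flip: sum_distrib_left)
    have out: "q_out Qt W = qt t"
      by (rule ext) (simp add: q_out_def Qt_def qt_def distrib_right sum.distrib sum_distrib_left mult.assoc
          if_distrib[of "\<lambda>r. r * _"] if_distrib[of "\<lambda>r. _ * r"] cong: if_cong)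
    have ac: "0 < qt t y" if "0 < Q z" "0 < W z y" for z y
      using q_out_pos[OF Q(1) that] t W_nonneg[of x y] by (simp add: qt_def add_pos_nonneg)
    have "capacity W \<ge> mutual_info Qt W" by (rule mutual_info_le_capacity[OF Qt])
    also have "mutual_info Qt W = (\<Sum>z\<in>UNIV. Qt z * kl (W z) (qt t))"
      by (simp add: mutual_info_eq[OF Qt] out)
    also have "\<dots> = (1 - t) * (\<Sum>z\<in>UNIV. Q z * kl (W z) (qt t)) + t * kl (W x) (qt t)"
      by (simp add: Qt_def distrib_right sum.distrib sum_distrib_left mult.assoc
          if_distrib[of "\<lambda>r. r * _"] if_distrib[of "\<lambda>r. _ * r"] cong: if_cong)
    finally have "(1 - t) * (\<Sum>z\<in>UNIV. Q z * kl (W z) (qt t)) + t * kl (W x) (qt t) \<le> capacity W" .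
    moreover have "(1 - t) * capacity W \<le> (1 - t) * (\<Sum>z\<in>UNIV. Q z * kl (W z) (qt t))"
      using mutual_info_le[OF Q(1) qt ac] t Q(2) by (intro mult_left_mono) auto
    ultimately have "t * kl (W x) (qt t) \<le> t * capacity W" by (simp add: algebra_simps)
    then show ?thesis using t by simp
  qed
  show pos: "0 < ?q y" if W: "0 < W x y" for y
  proof (rule ccontr)
    assume "\<not> 0 < ?q y"
    then have q0: "?q y = 0" using q by (simp add: prob_vec_def order_less_le)
    \<comment> \<open>If \<open>Q\<close> never produced \<open>y\<close>, then
      \<open>qt t y = t * W x y\<close> and the divergence would contain
      \<open>W x y * ln (1 / t)\<close>. The choice of \<open>t\<close> makes this term
      \<open>\<bar>A\<bar> + 1\<close>, more than \<open>kl_le\<close> allows.\<close>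
    define A where "A = capacity W - (\<Sum>z\<in>UNIV. W x z * ln (W x z))"
    define t where "t = exp (- (\<bar>A\<bar> + 1) / W x y)"
    have t: "0 < t" "t < 1" using W by (auto simp: t_def divide_less_0_iff)
    have low: "W x z * ln (W x z) - (if z = y then W x y * ln t else 0) - (if z = y then W x y * ln (W x y) else 0)
        \<le> W x z * ln (W x z / qt t z)" for z
    proof (cases "W x z = 0")
      case False
      then have Wz: "0 < W x z" using W_nonneg[of x z] by simp
      have qz: "0 < qt t z" unfolding qt_def
        using q t Wz by (intro add_nonneg_pos) (auto simp: prob_vec_def)
      show ?thesis
      proof (cases "z = y")
        case True
        then show ?thesis using t W by (simp add: qt_def q0 ln_div ln_mult)
      next
        case False
        have "qt t z \<le> 1" using qt[of t] t unfolding prob_vec_def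
          by (metis UNIV_I finite less_imp_le member_le_sum)
        then have "ln (qt t z) \<le> 0" using qz by simp
        then have "W x z * ln (qt t z) \<le> 0" using Wz by (simp add: mult_le_0_iff)
        then show ?thesis using False Wz qz by (simp add: ln_div right_diff_distrib)
      qed
    qed (use W in auto)
    have "W x y * ln (W x y) \<le> 0"
    proof -
      have "W x y \<le> 1" using prob_W[of x] unfolding prob_vec_def by (metis UNIV_I finite member_le_sum)
      then show ?thesis using W by (simp add: mult_le_0_iff)
    qed
    moreover have "(\<Sum>z\<in>UNIV. W x z * ln (W x z) - (if z = y then W x y * ln t else 0)
        - (if z = y then W x y * ln (W x y) else 0)) \<le> kl (W x) (qt t)"
      unfolding kl_def by (intro sum_mono low)
    ultimately have "- (W x y * ln t) \<le> A" using kl_le[OF t] by (simp add: A_def sum_subtractf)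
    moreover have "W x y * ln t = - (\<bar>A\<bar> + 1)" using W by (simp add: t_def)
    ultimately show False by linarith
  qed
  have "((\<lambda>t. kl (W x) (qt t)) \<longlongrightarrow> kl (W x) (qt 0)) (at_right 0)"
    unfolding kl_def
  proof (intro tendsto_sum)
    fix y
    show "((\<lambda>t. W x y * ln (W x y / qt t y)) \<longlongrightarrow> W x y * ln (W x y / qt 0 y)) (at_right 0)"
    proof (cases "W x y = 0")
      case False
      then have "0 < W x y" using W_nonneg[of x y] by simp
      then show ?thesis using pos[of y] unfolding qt_def by (intro tendsto_eq_intros) (auto intro!: tendsto_eq_intros)
    qed simp
  qed
  moreover have "eventually (\<lambda>t. kl (W x) (qt t) \<le> capacity W) (at_right (0::real))"
    using kl_le by (intro eventually_at_rightI[of 0 1]) auto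
  ultimately have "kl (W x) (qt 0) \<le> capacity W"
    by (intro tendsto_upperbound) auto
  then show "kl (W x) ?q \<le> capacity W" by (simp add: qt_def[abs_def])
qed

end

section \<open>Averaged output distributions\<close>

lemma ln_lipschitz:
  fixes a b :: real
  assumes "0 < k" "k \<le> a" "k \<le> b"
  shows "\<bar>ln a - ln b\<bar> \<le> \<bar>a - b\<bar> / k"
proof -
  have *: "ln x - ln y \<le> (x - y) / k" if "k \<le> y" "y \<le> x" for x y
  proof -
    have "ln x - ln y = ln (x / y)" using assms that by (simp add: ln_div)
    also have "\<dots> \<le> x / y - 1" using assms that by (intro ln_le_minus_one) auto
    also have "\<dots> = (x - y) / y" using assms that by (simp add: diff_divide_distrib)
    also have "\<dots> \<le> (x - y) / k" using assms that by (intro divide_left_mono) auto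
    finally show ?thesis .
  qed
  show ?thesis
  proof (cases "b \<le> a")
    case True
    then show ?thesis using *[of b a] assms by simp
  next
    case False
    then have "ln b - ln a \<le> (b - a) / k" "ln a \<le> ln b" using *[of a b] assms by auto
    then show ?thesis using False by simp
  qed
qed

locale optimal_dmc = dmc W for W :: "'x::finite \<Rightarrow> 'y::finite \<Rightarrow> real" +
  fixes Qs :: "'x \<Rightarrow> real"
  assumes singular: "singular_channel W"
    and prob_Qs: "prob_vec Qs" and Qs_opt: "mutual_info Qs W = capacity W"
begin

definition "qs = q_out Qs W"
definition "C = capacity W"
text \<open>On a singular channel the maximum is the common positive entry of the column; it is 0
  exactly for unreachable outputs.\<close>

definition "w y = (MAX x. W x y)"
definition "D x = kl (W x) qs"

lemma W_le_w: "W x y \<le> w y"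
  unfolding w_def by (intro Max_ge) auto

lemma W_eq_w: "0 < W x y \<Longrightarrow> W x y = w y"
proof -
  assume W: "0 < W x y"
  have "w y \<in> range (\<lambda>x. W x y)" unfolding w_def by (intro Max_in) auto
  then obtain z where z: "w y = W z y" by auto
  then have "0 < W z y" using W W_le_w[of x y] by simp
  then have "0 < W x y * W z y" using W by simp
  then show ?thesis using singular z unfolding singular_channel_def by simp
qed

lemma w_nonneg: "0 \<le> w y"
  using W_le_w[of undefined y] W_nonneg[of undefined y] by linarith

lemma w_pos_ex: "0 < w y \<Longrightarrow> \<exists>x. 0 < W x y"
proof -
  assume "0 < w y"
  moreover have "w y \<in> range (\<lambda>x. W x y)" unfolding w_def by (intro Max_in) auto
  ultimately show ?thesis by auto
qed

lemma w_le_1: "w y \<le> 1"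
proof -
  have "w y \<in> range (\<lambda>x. W x y)" unfolding w_def by (intro Max_in) auto
  then obtain z where z: "w y = W z y" by auto
  then show ?thesis using prob_W[of z] unfolding prob_vec_def by (metis UNIV_I finite member_le_sum)
qed

lemma prob_qs: "prob_vec qs"
  unfolding qs_def by (rule prob_vec_q_out[OF prob_Qs])

text \<open>By \<open>kuhn_tucker\<close> an optimal input reaches every reachable output, which
  gives \<open>qs\<close> a positive floor on all letters that can occur.\<close>

lemma qs_pos_iff: "0 < qs y \<longleftrightarrow> 0 < w y"
proof
  assume "0 < qs y"
  then obtain x where "0 < W x y" unfolding qs_def q_out_pos_iff[OF prob_Qs] by blast
  then show "0 < w y" using W_le_w[of x y] by simp
next
  assume "0 < w y"
  then show "0 < qs y" unfolding qs_def using w_pos_ex kuhn_tucker(1)[OF prob_Qs Qs_opt] by blast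
qed

lemma D_le: "D x \<le> C"
  unfolding D_def C_def qs_def by (rule kuhn_tucker(2)[OF prob_Qs Qs_opt])

lemma kl_eq_mean: "kl (W x) q = mean (W x) (\<lambda>y. ln (w y / q y))"
  unfolding kl_def mean_def
proof (intro sum.cong refl)
  fix y show "W x y * ln (W x y / q y) = W x y * ln (w y / q y)"
    using W_eq_w[of x y] W_nonneg[of x y] by (cases "0 < W x y") auto
qed

text \<open>\<open>excess P\<close> is the mass on inputs violating complementary slackness; together with \<open>gap P\<close> it
  measures the distance of \<open>P\<close> from the set of capacity-achieving inputs.\<close>
definition "excess P = (\<Sum>x\<in>UNIV. P x * (if D x < C then 1 else 0))"
definition "gap P = (\<Sum>y\<in>UNIV. \<bar>q_out P W y - qs y\<bar>)"

definition "qb P y = (qs y + q_out P W y) / 2"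
definition "score q y = ln (w y / q y)"
definition "rate P = (\<Sum>x\<in>UNIV. P x * mean (W x) (score (qb P)))"
definition "disp P = (\<Sum>x\<in>UNIV. P x * var (W x) (score (qb P)))"
definition "disp0 P = (\<Sum>x\<in>UNIV. P x * var (W x) (score qs))"

section \<open>Uniform score bounds, the penalised rate, and dispersion near the optimum\<close>

lemma excess_bounds: "prob_vec P \<Longrightarrow> 0 \<le> excess P" "prob_vec P \<Longrightarrow> excess P \<le> 1"
proof -
  assume P: "prob_vec P"
  then show "0 \<le> excess P" unfolding excess_def prob_vec_def by (intro sum_nonneg) auto
  have "excess P \<le> (\<Sum>x\<in>UNIV. P x)" using P unfolding excess_def prob_vec_def by (intro sum_mono) auto
  then show "excess P \<le> 1" using P by (simp add: prob_vec_def)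
qed

lemma gap_nonneg: "0 \<le> gap P"
  unfolding gap_def by (intro sum_nonneg) auto

lemma prob_qb: "prob_vec P \<Longrightarrow> prob_vec (qb P)"
  using prob_qs prob_vec_q_out[of P] unfolding qb_def prob_vec_def
  by (auto simp: sum.distrib simp flip: sum_divide_distrib)

lemma qb_ge: "prob_vec P \<Longrightarrow> qs y / 2 \<le> qb P y"
  using prob_vec_q_out[of P] unfolding qb_def prob_vec_def by (simp add: add_divide_distrib)

lemma q_out_eq_0: "prob_vec P \<Longrightarrow> w y = 0 \<Longrightarrow> q_out P W y = 0"
proof -
  assume P: "prob_vec P" "w y = 0"
  then have "W x y = 0" for x using W_le_w[of x y] W_nonneg[of x y] by simp
  then show ?thesis by (simp add: q_out_def)
qed

lemma qb_le_1: "prob_vec P \<Longrightarrow> qb P y \<le> 1"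
  using prob_qb[of P] unfolding prob_vec_def by (metis UNIV_I finite member_le_sum)

text \<open>Change of measure for one letter; multiplied along a word it bounds the product of
  \<open>w\<close> by the product of \<open>qb P\<close> tilted by the score.\<close>

lemma w_le_exp: "prob_vec P \<Longrightarrow> w y \<le> qb P y * exp (score (qb P) y)"
proof (cases "w y = 0")
  case True
  assume "prob_vec P"
  with True show ?thesis using prob_qb[of P] by (simp add: prob_vec_def)
next
  case False
  assume P: "prob_vec P"
  from False have "0 < w y" using w_nonneg[of y] by simp
  then have "0 < qb P y" using qb_ge[OF P, of y] qs_pos_iff[of y] by linarith
  then show ?thesis using \<open>0 < w y\<close> by (simp add: score_def)
qed

text \<open>Uniform in \<open>P\<close>, because \<open>qb P\<close> inherits a floor from
  \<open>qs\<close>. The constant \<open>b\<close> collects two logarithms for the size of the score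
  and \<open>1 / k\<close> for the Lipschitz constant of \<open>ln\<close> above the floor.\<close>

lemma score_bounded:
  obtains b where "0 < b" "\<And>P y. prob_vec P \<Longrightarrow> \<bar>score (qb P) y\<bar> \<le> b" "\<And>y. \<bar>score qs y\<bar> \<le> b"
    "\<And>P y. prob_vec P \<Longrightarrow> \<bar>score (qb P) y - score qs y\<bar> \<le> b * gap P"
proof -
  obtain k1 where k1: "0 < k1" "k1 \<le> 1" "\<And>y. 0 < w y \<Longrightarrow> k1 \<le> w y" using finite_positive_lower_bound[of w] by blast
  obtain k2 where k2: "0 < k2" "k2 \<le> 1" "\<And>y. 0 < qs y \<Longrightarrow> k2 \<le> qs y" using finite_positive_lower_bound[of qs] by blast
  define k where "k = min k1 k2 / 2"
  have k: "0 < k" "k \<le> 1" using k1 k2 by (auto simp: k_def)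
  have qk: "2 * k \<le> qs y" "k \<le> qs y" "k \<le> w y" if "0 < w y" for y
  proof -
    have "k1 \<le> w y" "k2 \<le> qs y" using k1(3)[OF that] k2(3)[of y] that qs_pos_iff[of y] by auto
    then show "2 * k \<le> qs y" "k \<le> qs y" "k \<le> w y" using k1(1) k2(1) by (auto simp: k_def min_def)
  qed
  have qs1: "qs y \<le> 1" for y using prob_qs unfolding prob_vec_def by (metis UNIV_I finite member_le_sum)
  define b where "b = \<bar>ln k\<bar> + \<bar>ln k\<bar> + 1 / k"
  have bnd: "\<bar>ln (w y / q)\<bar> \<le> \<bar>ln k\<bar> + \<bar>ln k\<bar>" if "0 < w y" "k \<le> q" "q \<le> 1" for y q
  proof -
    have "ln k \<le> ln (w y)" "ln (w y) \<le> 0" "ln k \<le> ln q" "ln q \<le> 0"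
      using k qk[OF that(1)] that w_le_1[of y] by auto
    moreover have "ln (w y / q) = ln (w y) - ln q" using that k by (simp add: ln_div)
    ultimately show ?thesis by linarith
  qed
  \<comment> \<open>At unreachable outputs \<open>ln 0 = 0\<close> makes every score vanish.\<close>
  have z: "score q y = 0" if "\<not> 0 < w y" for q y
    using that w_nonneg[of y] by (simp add: score_def order_less_le)
  have b0: "0 < b" "\<bar>ln k\<bar> + \<bar>ln k\<bar> \<le> b" "1 / k \<le> b" 
  proof -
    have "0 < 1 / k" using k by simp
    then show "0 < b" "\<bar>ln k\<bar> + \<bar>ln k\<bar> \<le> b" "1 / k \<le> b" unfolding b_def by linarith+
  qed
  show ?thesis
  proof
    show "0 < b" by (rule b0)
    show "\<bar>score (qb P) y\<bar> \<le> b" if "prob_vec P" for P y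
    proof (cases "0 < w y")
      case True
      then show ?thesis using bnd[OF True, of "qb P y"] qb_ge[OF that, of y] qb_le_1[OF that, of y] qk[OF True] b0
        by (auto simp: score_def)
    qed (use z b0 in auto)
    show "\<bar>score qs y\<bar> \<le> b" for y
    proof (cases "0 < w y")
      case True
      then show ?thesis using bnd[OF True, of "qs y"] qs1[of y] qk[OF True] b0
        by (auto simp: score_def)
    qed (use z b0 in auto)
    show "\<bar>score (qb P) y - score qs y\<bar> \<le> b * gap P" if P: "prob_vec P" for P y
    proof (cases "0 < w y")
      case True
      have ge: "k \<le> qb P y" "k \<le> qs y" using qb_ge[OF P, of y] qk[OF True] by auto
      have "score (qb P) y - score qs y = ln (qs y) - ln (qb P y)"
        using True ge k by (simp add: score_def ln_div)
      also have "\<bar>\<dots>\<bar> \<le> \<bar>qs y - qb P y\<bar> / k" using ln_lipschitz[OF k(1) ge(2,1)] .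
      also have "\<bar>qs y - qb P y\<bar> \<le> \<bar>q_out P W y - qs y\<bar>" unfolding qb_def by (simp add: abs_if field_simps)
      also have "\<dots> \<le> gap P" unfolding gap_def by (intro member_le_sum) auto
      also have "gap P / k = 1 / k * gap P" by simp
      also have "\<dots> \<le> b * gap P" using b0 gap_nonneg by (intro mult_right_mono) auto
      finally show ?thesis using k by (simp add: divide_right_mono)
    qed (use z b0 gap_nonneg in auto)
  qed
qed

text \<open>Replacing \<open>qs\<close> by the average lowers the mean score by the sum of
  \<open>q_out P W y * ln (qb P y / qs y)\<close>. The tangent bound on \<open>ln\<close> splits
  this into a linear part, which sums to zero, and a quadratic part. The \<open>excess\<close> term
  comes from the least positive slack \<open>C - D x\<close>.\<close>

lemma rate_le:
  obtains g c where "0 < g" "0 < c"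
    "\<And>P. prob_vec P \<Longrightarrow> rate P \<le> C - g * excess P - c * (gap P)\<^sup>2"
proof -
  obtain g where g: "0 < g" "\<And>x. 0 < C - D x \<Longrightarrow> g \<le> C - D x"
    using finite_positive_lower_bound[of "\<lambda>x. C - D x"] by blast
  \<comment> \<open>The 4 comes from the pointwise bound \<open>pt\<close>, the alphabet size from
    Cauchy--Schwarz between a sum of absolute values and a sum of squares.\<close>
  define c where "c = 1 / (4 * real CARD('y))"
  have c: "0 < c" by (simp add: c_def)
  have "rate P \<le> C - g * excess P - c * (gap P)\<^sup>2" if P: "prob_vec P" for P
  proof -
    let ?q = "q_out P W"
    have q: "prob_vec ?q" by (rule prob_vec_q_out[OF P])
    have pt: "(?q y - qs y) / 2 + (?q y - qs y)\<^sup>2 / 4 \<le> ?q y * (score qs y - score (qb P) y)" for y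
    proof (cases "0 < w y")
      case False
      then have "w y = 0" using w_nonneg[of y] by simp
      then have "?q y = 0" "qs y = 0" using q_out_eq_0[OF P] q_out_eq_0[OF prob_Qs] by (auto simp: qs_def)
      then show ?thesis by simp
    next
      case True
      then have pos: "0 < qs y" "0 < qb P y" using qs_pos_iff[of y] qb_ge[OF P, of y] by linarith+
      have q0: "0 \<le> ?q y" using q by (simp add: prob_vec_def)
      \<comment> \<open>Writing the output law as \<open>qb P\<close> plus half the deviation
        separates the linear from the quadratic part.\<close>
      have qe: "?q y = qb P y + (?q y - qs y) / 2" by (simp add: qb_def field_simps)
      have "score qs y - score (qb P) y = - ln (qs y / qb P y)"
        using True pos by (simp add: score_def ln_div)
      moreover have "ln (qs y / qb P y) \<le> qs y / qb P y - 1" using pos by (intro ln_le_minus_one) auto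
      moreover have "1 - qs y / qb P y = (?q y - qs y) / (2 * qb P y)" using pos by (simp add: qb_def field_simps)
      ultimately have "(?q y - qs y) / (2 * qb P y) \<le> score qs y - score (qb P) y" by linarith
      then have "?q y * ((?q y - qs y) / (2 * qb P y)) \<le> ?q y * (score qs y - score (qb P) y)"
        using q0 by (intro mult_left_mono)
      moreover have "?q y * ((?q y - qs y) / (2 * qb P y)) = (?q y - qs y) / 2 + (?q y - qs y)\<^sup>2 / (4 * qb P y)"
        by (subst qe) (use pos in \<open>simp add: field_simps power2_eq_square\<close>)
      moreover have "(?q y - qs y)\<^sup>2 / 4 \<le> (?q y - qs y)\<^sup>2 / (4 * qb P y)"
        using pos qb_le_1[OF P, of y] by (intro divide_left_mono) auto
      ultimately show ?thesis by linarith
    qed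
    have "(gap P)\<^sup>2 \<le> real CARD('y) * (\<Sum>y\<in>UNIV. (?q y - qs y)\<^sup>2)"
      using Cauchy_Schwarz_ineq_sum[of "\<lambda>y. \<bar>?q y - qs y\<bar>" "\<lambda>_. 1" UNIV] by (simp add: gap_def mult.commute)
    then have "c * (gap P)\<^sup>2 \<le> (\<Sum>y\<in>UNIV. (?q y - qs y)\<^sup>2 / 4)"
      by (simp add: c_def field_simps flip: sum_divide_distrib)
    also have "\<dots> = (\<Sum>y\<in>UNIV. (?q y - qs y) / 2 + (?q y - qs y)\<^sup>2 / 4)"
      using q prob_qs by (simp add: sum.distrib sum_subtractf prob_vec_def flip: sum_divide_distrib)
    also have "\<dots> \<le> (\<Sum>y\<in>UNIV. ?q y * (score qs y - score (qb P) y))" by (intro sum_mono pt)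
    also have "\<dots> = (\<Sum>x\<in>UNIV. P x * mean (W x) (\<lambda>y. score qs y - score (qb P) y))"
      unfolding q_out_def mean_def sum_distrib_left sum_distrib_right
      by (subst sum.swap) (simp add: mult.assoc)
    also have "\<dots> = (\<Sum>x\<in>UNIV. P x * D x) - rate P"
      unfolding rate_def D_def kl_eq_mean score_def[symmetric] mean_diff[symmetric]
      by (simp add: right_diff_distrib sum_subtractf)
    finally have 1: "rate P \<le> (\<Sum>x\<in>UNIV. P x * D x) - c * (gap P)\<^sup>2" by simp
    have "P x * D x \<le> P x * C - g * (P x * (if D x < C then 1 else 0))" for x
    proof -
      have "D x \<le> C - g * (if D x < C then 1 else 0)" using D_le[of x] g(2)[of x] by auto
      then have "P x * D x \<le> P x * (C - g * (if D x < C then 1 else 0))"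
        using P by (intro mult_left_mono) (auto simp: prob_vec_def)
      then show ?thesis by (simp add: algebra_simps)
    qed
    then have "(\<Sum>x\<in>UNIV. P x * D x) \<le> (\<Sum>x\<in>UNIV. P x * C - g * (P x * (if D x < C then 1 else 0)))"
      by (intro sum_mono)
    also have "\<dots> = C - g * excess P"
      using P by (simp only: sum_subtractf excess_def prob_vec_def mult_1 flip: sum_distrib_left sum_distrib_right)
    finally show ?thesis using 1 by linarith
  qed
  with g c that show ?thesis by blast
qed

text \<open>For optimal \<open>P\<close> the mutual information \<open>C\<close> is at most
  \<open>rate P\<close>, so both penalties in \<open>rate_le\<close> vanish. Conversely, with output
  law \<open>qs\<close> and all mass on inputs with \<open>D x = C\<close>, the mutual information
  is an average of values \<open>C\<close>. Both conditions amount to linear equations, so the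
  optimal inputs form a polytope.\<close>

lemma cap_achieving_iff: "P \<in> cap_achieving W \<longleftrightarrow> prob_vec P \<and> excess P = 0 \<and> gap P = 0"
proof -
  have fw: "excess P = 0 \<and> gap P = 0" if P: "prob_vec P" and opt: "mutual_info P W = capacity W"
  proof -
    obtain g c where gc: "0 < g" "0 < c" "rate P \<le> C - g * excess P - c * (gap P)\<^sup>2" using rate_le P by metis
    have ac: "0 < qb P y" if "0 < W x y" for x y
    proof -
      have "0 < qs y" using that W_le_w[of x y] qs_pos_iff[of y] by simp
      then show ?thesis using qb_ge[OF P, of y] by linarith
    qed
    have "mutual_info P W \<le> rate P"
      using mutual_info_le[OF P prob_qb[OF P]] ac by (simp add: rate_def kl_eq_mean score_def[abs_def])
    then have "g * excess P + c * (gap P)\<^sup>2 \<le> 0" using gc opt by (simp add: C_def)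
    moreover have "0 \<le> g * excess P" "0 \<le> c * (gap P)\<^sup>2" using gc excess_bounds[OF P] by auto
    ultimately have "g * excess P = 0" "c * (gap P)\<^sup>2 = 0" by linarith+
    then show ?thesis using gc by simp
  qed
  have bw: "mutual_info P W = capacity W" if P: "prob_vec P" and "excess P = 0" "gap P = 0"
  proof -
    have q: "q_out P W = qs"
      using that(3) unfolding gap_def by (subst (asm) sum_nonneg_eq_0_iff) auto
    have "P x * D x = P x * C" for x
    proof -
      have "P x * (if D x < C then 1 else 0) = 0"
        using that(2) P unfolding excess_def prob_vec_def by (subst (asm) sum_nonneg_eq_0_iff) auto
      then show ?thesis using D_le[of x] by (auto split: if_splits)
    qed
    then have "(\<Sum>x\<in>UNIV. P x * D x) = (\<Sum>x\<in>UNIV. P x * C)" by (intro sum.cong refl)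
    also have "\<dots> = C" using P by (simp add: prob_vec_def flip: sum_distrib_right)
    finally show ?thesis using P by (simp add: mutual_info_eq q D_def C_def)
  qed
  show ?thesis unfolding cap_achieving_def input_dists_eq using fw bw by blast
qed

text \<open>In general \<open>cond_var\<close> depends on \<open>P\<close> also through the output
  law. On optimal inputs that law is \<open>qs\<close>, and the dispersion becomes linear in
  \<open>P\<close>, as \<open>exact_penalty\<close> requires.\<close>

lemma cond_var_eq:
  assumes "P \<in> cap_achieving W"
  shows "cond_var P W = disp0 P"
proof -
  have P: "prob_vec P" and "gap P = 0" using assms by (auto simp: cap_achieving_iff)
  then have q: "q_out P W = qs"
    unfolding gap_def by (subst (asm) sum_nonneg_eq_0_iff) auto
  have D: "div_row P W x = mean (W x) (score qs)" for x
    unfolding div_row_def mean_def q score_def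
  proof (intro sum.cong refl)
    fix y show "(if 0 < W x y then W x y * ln (W x y / qs y) else 0) = W x y * ln (w y / qs y)"
      using W_eq_w[of x y] W_nonneg[of x y] by (cases "0 < W x y") auto
  qed
  show ?thesis
    unfolding cond_var_def disp0_def var_def D sum_distrib_left q
  proof (intro sum.cong refl)
    fix x y
    show "(if 0 < P x * W x y then P x * W x y * (ln (W x y / qs y) - mean (W x) (score qs))\<^sup>2 else 0) =
        P x * (W x y * (score qs y - mean (W x) (score qs))\<^sup>2)"
    proof (cases "P x = 0 \<or> W x y = 0")
      case False
      then have pos: "0 < P x" "0 < W x y"
        using P W_nonneg[of x y] by (auto simp: prob_vec_def order_less_le)
      show ?thesis unfolding score_def W_eq_w[OF pos(2), symmetric] using pos by simp
    qed auto
  qed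
qed

text \<open>The sign \<open>s\<close> treats the minimum and the maximum of the dispersion as one
  linear program.\<close>

lemma dispersion_penalty:
  fixes s :: real
  assumes s: "s = 1 \<or> s = -1"
  obtains K where "0 \<le> K"
    "\<And>P. prob_vec P \<Longrightarrow> (INF Q\<in>cap_achieving W. s * disp0 Q) - K * (excess P + gap P) \<le> s * disp0 P"
proof -
  \<comment> \<open>The two conditions of \<open>cap_achieving_iff\<close> as one vector-valued
    linear constraint; its residual has norm at most \<open>excess P + gap P\<close>.\<close>
  define T where "T x = (if D x < C then 1 else 0 :: real, \<chi> y. W x y)" for x
  define u0 where "u0 = (0 :: real, \<chi> y. qs y)"
  have T_sum: "(\<Sum>x\<in>UNIV. P x *\<^sub>R T x) = (excess P, \<chi> y. q_out P W y)" for P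
    by (simp add: T_def sum_prod excess_def q_out_def vec_eq_iff)
  have nrm: "norm ((\<Sum>x\<in>UNIV. P x *\<^sub>R T x) - u0) \<le> excess P + gap P" if "prob_vec P" for P
  proof -
    have "(\<Sum>x\<in>UNIV. P x *\<^sub>R T x) - u0 = (excess P, \<chi> y. q_out P W y - qs y)"
      by (simp add: T_sum u0_def vec_eq_iff)
    then have "norm ((\<Sum>x\<in>UNIV. P x *\<^sub>R T x) - u0) \<le> \<bar>excess P\<bar> + norm (\<chi> y. q_out P W y - qs y)"
      using norm_Pair_le[of "excess P"] by simp
    also have "norm (\<chi> y. q_out P W y - qs y) \<le> gap P"
      using norm_le_l1_cart[of "\<chi> y. q_out P W y - qs y"] by (simp add: gap_def)
    finally show ?thesis using excess_bounds[OF that] by simp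
  qed
  have gap0: "gap P = 0 \<longleftrightarrow> (\<forall>y. q_out P W y = qs y)" for P
    unfolding gap_def by (subst sum_nonneg_eq_0_iff) auto
  have F: "{P. prob_vec P \<and> (\<Sum>x\<in>UNIV. P x *\<^sub>R T x) = u0} = cap_achieving W"
    unfolding T_sum u0_def by (auto simp: cap_achieving_iff gap0 vec_eq_iff)
  have ne: "cap_achieving W \<noteq> {}"
    using prob_Qs Qs_opt by (auto simp: cap_achieving_def input_dists_eq)
  have disp: "(\<Sum>x\<in>UNIV. Q x * (s * var (W x) (score qs))) = s * disp0 Q" for Q
    by (simp add: disp0_def sum_distrib_left mult_ac)
  obtain K where K: "0 \<le> K" "\<And>P. prob_vec P \<Longrightarrow> (INF Q\<in>cap_achieving W. s * disp0 Q)
        - K * norm ((\<Sum>x\<in>UNIV. P x *\<^sub>R T x) - u0) \<le> s * disp0 P"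
    using exact_penalty[where T=T and ?u0.0=u0 and c="\<lambda>x. s * var (W x) (score qs)", unfolded F disp, OF ne] by blast
  show ?thesis
  proof
    show "0 \<le> K" by (rule K)
    fix P :: "'x \<Rightarrow> real" assume P: "prob_vec P"
    show "(INF Q\<in>cap_achieving W. s * disp0 Q) - K * (excess P + gap P) \<le> s * disp0 P"
      using K(2)[OF P] mult_left_mono[OF nrm[OF P] K(1)] by linarith
  qed
qed

lemma V_eps_eq:
  "\<epsilon> < 1/2 \<Longrightarrow> V_eps W \<epsilon> = (INF Q\<in>cap_achieving W. 1 * disp0 Q)"
  "1/2 < \<epsilon> \<Longrightarrow> V_eps W \<epsilon> = - (INF Q\<in>cap_achieving W. (-1) * disp0 Q)"
  by (simp_all add: V_eps_def cond_var_eq Inf_real_def image_image cong: image_cong)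

text \<open>Moving the score from \<open>qs\<close> to \<open>qb P\<close> costs a multiple of
  \<open>gap P\<close>. The second bound keeps the variance under the reference law away from 0, as
  the \<open>1 / sqrt N\<close> gain requires; its half comes from \<open>qb P\<close> dominating
  \<open>qs / 2\<close>.\<close>

lemma disp_close:
  obtains L where "0 \<le> L" "\<And>P. prob_vec P \<Longrightarrow> \<bar>disp P - disp0 P\<bar> \<le> L * gap P"
    "\<And>P. prob_vec P \<Longrightarrow> var qs (score qs) / 2 - L * gap P \<le> var (qb P) (score (qb P))"
proof -
  obtain b where b: "0 < b" "\<And>P y. prob_vec P \<Longrightarrow> \<bar>score (qb P) y\<bar> \<le> b" "\<And>y. \<bar>score qs y\<bar> \<le> b"
    "\<And>P y. prob_vec P \<Longrightarrow> \<bar>score (qb P) y - score qs y\<bar> \<le> b * gap P" using score_bounded by blast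
  define L where "L = 4 * b * b"
  have lip: "\<bar>var p (score (qb P)) - var p (score qs)\<bar> \<le> L * gap P" if "prob_vec p" "prob_vec P" for p P
    using var_lipschitz[OF that(1) b(2)[OF that(2)] b(3) b(4)[OF that(2)]] by (simp add: L_def mult_ac)
  show ?thesis
  proof
    show "0 \<le> L" using b by (simp add: L_def)
    show "\<bar>disp P - disp0 P\<bar> \<le> L * gap P" if P: "prob_vec P" for P
    proof -
      have "disp P - disp0 P = mean P (\<lambda>x. var (W x) (score (qb P)) - var (W x) (score qs))"
        by (simp add: disp_def disp0_def mean_def right_diff_distrib sum_subtractf)
      then show ?thesis using lip[OF prob_W P] by (simp add: mean_bounds[OF P])
    qed
    show "var qs (score qs) / 2 - L * gap P \<le> var (qb P) (score (qb P))" if P: "prob_vec P" for P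
      using lip[OF prob_qs P] var_mono_half[OF prob_qs prob_qb[OF P] qb_ge[OF P], of "score (qb P)"]
        mult_nonneg_nonneg[OF \<open>0 \<le> L\<close> gap_nonneg[of P]] by linarith
  qed
qed

text \<open>A score that is constant under \<open>qs\<close> is constant on all reachable outputs,
  hence under every row. By contraposition, a nonzero \<open>V_eps\<close> forces positive variance
  under \<open>qs\<close>.\<close>

lemma disp0_eq_0: "var qs (score qs) = 0 \<Longrightarrow> disp0 P = 0"
proof -
  assume "var qs (score qs) = 0"
  then have "\<forall>y. qs y * (score qs y - mean qs (score qs))\<^sup>2 = 0"
    using prob_qs unfolding var_def prob_vec_def by (subst (asm) sum_nonneg_eq_0_iff) auto
  then have eq: "score qs y = mean qs (score qs)" if "0 < W x y" for x y
    using that qs_pos_iff[of y] W_le_w[of x y] by force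
  have "var (W x) (score qs) = 0" for x
  proof -
    have "var (W x) (score qs) \<le> (\<Sum>y\<in>UNIV. W x y * (score qs y - mean qs (score qs))\<^sup>2)"
      unfolding sum_square_dev[OF prob_W] by simp
    also have "\<dots> = 0" using eq W_nonneg by (intro sum.neutral) (auto simp: order_less_le)
    finally show ?thesis using var_nonneg[OF prob_W, of x "score qs"] by simp
  qed
  then show ?thesis by (simp add: disp0_def)
qed

end

section \<open>Converse bound for constant composition codes\<close>

lemma sum_list_count:
  fixes g :: "'x::finite \<Rightarrow> real"
  shows "(\<Sum>i<length xs. g (xs ! i)) = (\<Sum>x\<in>UNIV. real (count_list xs x) * g x)"
proof -
  have "sum_list (map g xs) = (\<Sum>x\<in>UNIV. real (count_list xs x) * g x)"
  proof (induction xs)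
    case (Cons a xs)
    have "real (count_list (a # xs) x) * g x = (if a = x then g x else 0) + real (count_list xs x) * g x" for x
      by (auto simp: distrib_right)
    with Cons show ?case by (simp only: sum.distrib) simp
  qed simp
  then show ?thesis by (simp add: sum_list_sum_nth atLeast0LessThan)
qed

lemma word_sum_const:
  assumes "\<And>i. i < N \<Longrightarrow> prob_vec (p i)"
  shows "word_sum N p (\<lambda>_. c) = c"
  using word_sum_eq_expectation[where F="\<lambda>_. c" and s="\<lambda>_. 0", OF assms] by simp

lemma word_sum_mono:
  assumes "\<And>i y. i < N \<Longrightarrow> 0 \<le> p i y" "\<And>ys. length ys = N \<Longrightarrow> F ys \<le> G ys"
  shows "word_sum N p F \<le> word_sum N p G"
  unfolding word_sum_def using assms by (intro sum_mono mult_left_mono prod_nonneg) auto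

context optimal_dmc
begin

lemma W_N_eq: "length xs = N \<Longrightarrow> W_N W xs ys = (\<Prod>i<N. W (xs ! i) (ys ! i))"
  by (simp add: W_N_def)

text \<open>Averaging over messages yields one codeword for which the inequality holds. It may
  depend on \<open>l\<close>, but its composition does not, so \<open>P\<close> is fixed before
  \<open>l\<close>.\<close>

lemma code_bound:
  assumes N: "0 < N" and M: "0 < M" and code: "cc_code W N M \<epsilon>"
  obtains P where "prob_vec P"
    "\<And>l. \<exists>xs. length xs = N \<and> (\<forall>x. real (count_list xs x) = real N * P x) \<and>
      1 - \<epsilon> \<le> word_sum N (\<lambda>i. W (xs ! i)) (\<lambda>ys. if word_score (score (qb P)) ys > l then 1 else 0)
        + word_sum N (\<lambda>_. qb P) (\<lambda>ys. if word_score (score (qb P)) ys \<le> l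
            then exp (word_score (score (qb P)) ys) else 0) / real M"
proof -
  obtain f dec where len: "\<And>m. m \<in> {1..M} \<Longrightarrow> length (f m) = N"
    and dec: "\<And>ys. length ys = N \<Longrightarrow> dec ys \<in> {1..M}"
    and cc: "\<And>m m' a. m \<in> {1..M} \<Longrightarrow> m' \<in> {1..M} \<Longrightarrow> count_list (f m) a = count_list (f m') a"
    and err: "avg_error W N M f dec \<le> \<epsilon>"
    using code unfolding cc_code_def by blast
  define P where "P x = real (count_list (f 1) x) / real N" for x
  have one: "1 \<in> {1..M}" using M by simp
  have type: "real (count_list (f m) x) = real N * P x" if "m \<in> {1..M}" for m x
    using cc[OF that one, of x] N by (simp add: P_def)
  have P: "prob_vec P"
    using sum_list_count[of "\<lambda>_. 1" "f 1"] len[OF one] N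
    by (simp add: prob_vec_def P_def flip: sum_divide_distrib)
  let ?s = "word_score (score (qb P))"
  have "\<exists>xs. length xs = N \<and> (\<forall>x. real (count_list xs x) = real N * P x) \<and>
      1 - \<epsilon> \<le> word_sum N (\<lambda>i. W (xs ! i)) (\<lambda>ys. if ?s ys > l then 1 else 0)
        + word_sum N (\<lambda>_. qb P) (\<lambda>ys. if ?s ys \<le> l then exp (?s ys) else 0) / real M" for l
  proof (rule ccontr)
    assume neg: "\<not> ?thesis"
    define A where "A m = word_sum N (\<lambda>i. W (f m ! i)) (\<lambda>ys. if ?s ys > l then 1 else 0)" for m
    define E where "E = word_sum N (\<lambda>_. qb P) (\<lambda>ys. if ?s ys \<le> l then exp (?s ys) else 0)"
    have A_less: "A m < 1 - \<epsilon> - E / real M" if "m \<in> {1..M}" for m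
      using neg len[OF that] type[OF that] unfolding A_def E_def by force
    let ?Y = "{ys :: 'y list. length ys = N}"
    have total: "(\<Sum>ys\<in>?Y. W_N W (f m) ys) = 1" if "m \<in> {1..M}" for m
      using word_sum_const[of N "\<lambda>i. W (f m ! i)" 1] prob_W by (simp add: word_sum_def W_N_eq[OF len[OF that]])
    have W_N_nonneg: "0 \<le> W_N W xs ys" for xs ys
      unfolding W_N_def using W_nonneg by (intro prod_nonneg) auto
    \<comment> \<open>Words above the threshold are all counted in \<open>A m\<close>; below it the
      channel probability is replaced by the product of \<open>w\<close>, which no longer depends on
      the codeword.\<close>
    have split: "1 - (\<Sum>ys\<in>{ys. length ys = N \<and> dec ys \<noteq> m}. W_N W (f m) ys)
        \<le> A m + (\<Sum>ys\<in>?Y. if dec ys = m then (if ?s ys \<le> l then \<Prod>i<N. w (ys ! i) else 0) else 0)"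
      if m: "m \<in> {1..M}" for m
    proof -
      have "{ys \<in> ?Y. dec ys \<noteq> m} = {ys. length ys = N \<and> dec ys \<noteq> m}" by auto
      then have "(\<Sum>ys\<in>?Y. if dec ys \<noteq> m then W_N W (f m) ys else 0)
          = (\<Sum>ys\<in>{ys. length ys = N \<and> dec ys \<noteq> m}. W_N W (f m) ys)"
        by (simp add: sum.If_cases Int_def)
      then have "1 - (\<Sum>ys\<in>{ys. length ys = N \<and> dec ys \<noteq> m}. W_N W (f m) ys)
          = (\<Sum>ys\<in>?Y. W_N W (f m) ys - (if dec ys \<noteq> m then W_N W (f m) ys else 0))"
        by (simp add: sum_subtractf total[OF m])
      also have "\<dots> \<le> (\<Sum>ys\<in>?Y. (\<Prod>i<N. W (f m ! i) (ys ! i)) * (if ?s ys > l then 1 else 0)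
          + (if dec ys = m then (if ?s ys \<le> l then \<Prod>i<N. w (ys ! i) else 0) else 0))"
      proof (rule sum_mono)
        fix ys
        have eq: "W_N W (f m) ys = (\<Prod>i<N. W (f m ! i) (ys ! i))" by (rule W_N_eq[OF len[OF m]])
        have "(\<Prod>i<N. W (f m ! i) (ys ! i)) \<le> (\<Prod>i<N. w (ys ! i))"
          using W_nonneg W_le_w by (intro prod_mono) auto
        moreover have "0 \<le> (\<Prod>i<N. w (ys ! i))" using w_nonneg by (intro prod_nonneg) auto
        ultimately show "W_N W (f m) ys - (if dec ys \<noteq> m then W_N W (f m) ys else 0)
          \<le> (\<Prod>i<N. W (f m ! i) (ys ! i)) * (if ?s ys > l then 1 else 0)
          + (if dec ys = m then (if ?s ys \<le> l then \<Prod>i<N. w (ys ! i) else 0) else 0)"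
          using W_N_nonneg[of "f m" ys] unfolding eq by auto
      qed
      also have "\<dots> = A m + (\<Sum>ys\<in>?Y. if dec ys = m then (if ?s ys \<le> l then \<Prod>i<N. w (ys ! i) else 0) else 0)"
        by (simp only: sum.distrib A_def word_sum_def)
      finally show ?thesis .
    qed
    have "real M * (1 - \<epsilon>) \<le> real M * (1 - avg_error W N M f dec)"
      using err by (intro mult_left_mono) auto
    also have "\<dots> = (\<Sum>m\<in>{1..M}. 1 - (\<Sum>ys\<in>{ys. length ys = N \<and> dec ys \<noteq> m}. W_N W (f m) ys))"
      using M by (simp add: avg_error_def sum_subtractf right_diff_distrib)
    also have "\<dots> \<le> (\<Sum>m\<in>{1..M}. A m + (\<Sum>ys\<in>?Y. if dec ys = m then (if ?s ys \<le> l then \<Prod>i<N. w (ys ! i) else 0) else 0))"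
      by (intro sum_mono split)
    also have "\<dots> = (\<Sum>m\<in>{1..M}. A m) + (\<Sum>ys\<in>?Y. \<Sum>m\<in>{1..M}. if dec ys = m then (if ?s ys \<le> l then \<Prod>i<N. w (ys ! i) else 0) else 0)"
      by (subst sum.swap) (simp add: sum.distrib)
    \<comment> \<open>The inner sum has exactly one nonzero candidate, \<open>m = dec ys\<close>;
      this is where a factor \<open>M\<close> is saved.\<close>
    also have "(\<Sum>ys\<in>?Y. \<Sum>m\<in>{1..M}. if dec ys = m then (if ?s ys \<le> l then \<Prod>i<N. w (ys ! i) else 0) else 0)
        = (\<Sum>ys\<in>?Y. if ?s ys \<le> l then \<Prod>i<N. w (ys ! i) else 0)"
      using dec by (intro sum.cong refl) (auto simp: sum.delta)
    also have "\<dots> \<le> E"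
      unfolding E_def word_sum_def
    proof (rule sum_mono)
      fix ys assume "ys \<in> ?Y"
      then have l: "length ys = N" by simp
      have "(\<Prod>i<N. w (ys ! i)) \<le> (\<Prod>i<N. qb P (ys ! i) * exp (score (qb P) (ys ! i)))"
        using w_le_exp[OF P] w_nonneg by (intro prod_mono) auto
      also have "\<dots> = (\<Prod>i<N. qb P (ys ! i)) * exp (?s ys)"
        by (simp add: prod.distrib exp_sum word_score_def l)
      finally show "(if ?s ys \<le> l then \<Prod>i<N. w (ys ! i) else 0)
          \<le> (\<Prod>i<N. qb P (ys ! i)) * (if ?s ys \<le> l then exp (?s ys) else 0)" by simp
    qed
    also have "(\<Sum>m\<in>{1..M}. A m) < (\<Sum>m\<in>{1..M}. 1 - \<epsilon> - E / real M)"
      using A_less M by (intro sum_strict_mono) auto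
    finally show False using M by (simp add: right_diff_distrib)
  qed
  with P that show ?thesis by blast
qed

text \<open>Here \<open>\<alpha>\<close> stands for the probability of a score above
  \<open>l\<close> given a codeword of composition \<open>P\<close>, and \<open>\<beta>\<close> for
  the mean of \<open>exp (score - l)\<close> on the words below \<open>l\<close> under the product
  of \<open>qb P\<close>. They are quantified after \<open>l\<close> because the codeword may change
  with it. The alternative bounds serve different regimes of types.\<close>

definition tail_bounds :: "real \<Rightarrow> nat \<Rightarrow> nat \<Rightarrow> real \<Rightarrow> ('x \<Rightarrow> real) \<Rightarrow> bool" where
  "tail_bounds K N M \<epsilon> P \<longleftrightarrow> (\<forall>l. \<exists>\<alpha> \<beta>. 1 - \<epsilon> \<le> \<alpha> + \<beta> * exp l / real M \<and>
        (\<forall>t>0. l = real N * rate P + t \<longrightarrow> \<alpha> \<le> real N * disp P / t\<^sup>2) \<and>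
        (0 < disp P \<longrightarrow> \<alpha> \<le> 1 - Phi ((l - real N * rate P) / sqrt (real N * disp P)) + K / sqrt (real N * disp P)) \<and>
        \<beta> \<le> 1 \<and>
        (0 < var (qb P) (score (qb P)) \<longrightarrow> \<beta> \<le> K / sqrt (real N * var (qb P) (score (qb P)))))"

lemma tail_boundsE:
  assumes "tail_bounds K N M \<epsilon> P"
  obtains \<alpha> \<beta> where "1 - \<epsilon> \<le> \<alpha> + \<beta> * exp l / real M"
    "\<And>t. 0 < t \<Longrightarrow> l = real N * rate P + t \<Longrightarrow> \<alpha> \<le> real N * disp P / t\<^sup>2"
    "0 < disp P \<Longrightarrow> \<alpha> \<le> 1 - Phi ((l - real N * rate P) / sqrt (real N * disp P)) + K / sqrt (real N * disp P)"
    "\<beta> \<le> 1"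
    "0 < var (qb P) (score (qb P)) \<Longrightarrow> \<beta> \<le> K / sqrt (real N * var (qb P) (score (qb P)))"
proof -
  have "\<exists>\<alpha> \<beta>. 1 - \<epsilon> \<le> \<alpha> + \<beta> * exp l / real M \<and>
        (\<forall>t>0. l = real N * rate P + t \<longrightarrow> \<alpha> \<le> real N * disp P / t\<^sup>2) \<and>
        (0 < disp P \<longrightarrow> \<alpha> \<le> 1 - Phi ((l - real N * rate P) / sqrt (real N * disp P)) + K / sqrt (real N * disp P)) \<and>
        \<beta> \<le> 1 \<and>
        (0 < var (qb P) (score (qb P)) \<longrightarrow> \<beta> \<le> K / sqrt (real N * var (qb P) (score (qb P))))"
    using assms unfolding tail_bounds_def by (rule spec)
  then obtain \<alpha> \<beta> where "1 - \<epsilon> \<le> \<alpha> + \<beta> * exp l / real M \<and>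
        (\<forall>t>0. l = real N * rate P + t \<longrightarrow> \<alpha> \<le> real N * disp P / t\<^sup>2) \<and>
        (0 < disp P \<longrightarrow> \<alpha> \<le> 1 - Phi ((l - real N * rate P) / sqrt (real N * disp P)) + K / sqrt (real N * disp P)) \<and>
        \<beta> \<le> 1 \<and>
        (0 < var (qb P) (score (qb P)) \<longrightarrow> \<beta> \<le> K / sqrt (real N * var (qb P) (score (qb P))))"
    by (elim exE)
  then show ?thesis by (intro that[of \<alpha> \<beta>]) simp_all
qed

lemma code_tail:
  obtains K where "0 < K"
    "\<And>N M \<epsilon>. 0 < N \<Longrightarrow> 0 < M \<Longrightarrow> cc_code W N M \<epsilon> \<Longrightarrow> \<exists>P. prob_vec P \<and> disp P \<le> K\<^sup>2 \<and>
      tail_bounds K N M \<epsilon> P"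
proof -
  obtain b where b: "0 < b" "\<And>P y. prob_vec P \<Longrightarrow> \<bar>score (qb P) y\<bar> \<le> b"
    by (rule score_bounded) (rule that)
  obtain B where B: "0 < B" "\<And>z w. stein_sol z w \<le> B" using stein_sol_bounded by blast
  define K where "K = b + (36 + 2 * B) * (2 * b) + exp (4 * b) * (1 + 2 * b)"
  have K: "b \<le> K" "(36 + 2 * B) * (2 * b) \<le> K" "exp (4 * b) * (1 + 2 * b) \<le> K" "0 < K"
    using b(1) B(1) by (auto simp: K_def add_pos_pos intro!: add_nonneg_nonneg)
  show ?thesis
  proof
    show "0 < K" by (rule K)
    fix N M \<epsilon> assume N: "0 < N" and M: "0 < M" and code: "cc_code W N M \<epsilon>"
    obtain P where P: "prob_vec P" and bound:
      "\<And>l. \<exists>xs. length xs = N \<and> (\<forall>x. real (count_list xs x) = real N * P x) \<and>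
      1 - \<epsilon> \<le> word_sum N (\<lambda>i. W (xs ! i)) (\<lambda>ys. if word_score (score (qb P)) ys > l then 1 else 0)
        + word_sum N (\<lambda>_. qb P) (\<lambda>ys. if word_score (score (qb P)) ys \<le> l
            then exp (word_score (score (qb P)) ys) else 0) / real M"
      by (rule code_bound[OF N M code]) (rule that)
    let ?s = "score (qb P)"
    have "disp P \<le> b\<^sup>2"
    proof -
      have "disp P \<le> (\<Sum>x\<in>UNIV. P x * b\<^sup>2)"
        unfolding disp_def using P var_le[OF prob_W b(2)[OF P]]
        by (intro sum_mono mult_left_mono) (auto simp: prob_vec_def)
      then show ?thesis using P by (simp add: prob_vec_def flip: sum_distrib_right)
    qed
    also have "\<dots> \<le> K\<^sup>2" using K b by (intro power_mono) auto
    finally have dK: "disp P \<le> K\<^sup>2" .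
    have main: "\<exists>\<alpha> \<beta>. 1 - \<epsilon> \<le> \<alpha> + \<beta> * exp l / real M \<and>
        (\<forall>t>0. l = real N * rate P + t \<longrightarrow> \<alpha> \<le> real N * disp P / t\<^sup>2) \<and>
        (0 < disp P \<longrightarrow> \<alpha> \<le> 1 - Phi ((l - real N * rate P) / sqrt (real N * disp P)) + K / sqrt (real N * disp P)) \<and>
        \<beta> \<le> 1 \<and>
        (0 < var (qb P) ?s \<longrightarrow> \<beta> \<le> K / sqrt (real N * var (qb P) ?s))" for l
    proof -
      obtain xs where len: "length xs = N" and cnt: "\<And>x. real (count_list xs x) = real N * P x"
        and ineq: "1 - \<epsilon> \<le> word_sum N (\<lambda>i. W (xs ! i)) (\<lambda>ys. if word_score ?s ys > l then 1 else 0)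
          + word_sum N (\<lambda>_. qb P) (\<lambda>ys. if word_score ?s ys \<le> l then exp (word_score ?s ys) else 0) / real M"
        using bound[of l] by blast
      define \<alpha> where "\<alpha> = word_sum N (\<lambda>i. W (xs ! i)) (\<lambda>ys. if word_score ?s ys > l then 1 else 0)"
      define \<beta> where "\<beta> = word_sum N (\<lambda>_. qb P) (\<lambda>ys. if word_score ?s ys \<le> l then exp (word_score ?s ys - l) else 0)"
      \<comment> \<open>Sums over the positions of a codeword depend only on its composition; this
        turns means and variances into \<open>rate P\<close> and \<open>disp P\<close>.\<close>
      have tot: "(\<Sum>i<N. g (xs ! i)) = real N * (\<Sum>x\<in>UNIV. P x * g x)" for g :: "'x \<Rightarrow> real"
        using sum_list_count[of g xs] by (simp add: len cnt sum_distrib_left mult.assoc)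
      have m: "real N * rate P = (\<Sum>i<N. mean (W (xs ! i)) ?s)" unfolding rate_def by (rule tot[symmetric])
      have V: "real N * disp P = (\<Sum>i<N. var (W (xs ! i)) ?s)" unfolding disp_def by (rule tot[symmetric])
      note word = prob_W b(2)[OF P] m V
      have "word_sum N (\<lambda>_. qb P) (\<lambda>ys. if word_score ?s ys \<le> l then exp (word_score ?s ys) else 0) = \<beta> * exp l"
        unfolding \<beta>_def word_sum_def sum_distrib_right
        by (intro sum.cong refl) (simp add: exp_diff)
      with ineq have f1: "1 - \<epsilon> \<le> \<alpha> + \<beta> * exp l / real M" by (simp add: \<alpha>_def)
      have f2: "\<alpha> \<le> real N * disp P / t\<^sup>2" if "0 < t" "l = real N * rate P + t" for t
        using word_chebyshev[OF word that(1)] that(2) by (simp add: \<alpha>_def)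
      have f3: "\<alpha> \<le> 1 - Phi ((l - real N * rate P) / sqrt (real N * disp P)) + K / sqrt (real N * disp P)"
        if "0 < disp P"
      proof -
        have "\<alpha> \<le> 1 - Phi ((l - real N * rate P) / sqrt (real N * disp P))
            + (36 + 2 * B) * (2 * b / sqrt (real N * disp P))"
          unfolding \<alpha>_def using that N by (intro word_berry_esseen[OF word _ B(2)]) auto
        also have "(36 + 2 * B) * (2 * b / sqrt (real N * disp P)) \<le> K / sqrt (real N * disp P)"
          unfolding times_divide_eq_right using K(2) that by (intro divide_right_mono) auto
        finally show ?thesis by simp
      qed
      have f4: "\<beta> \<le> 1"
      proof -
        have "\<beta> \<le> word_sum N (\<lambda>_. qb P) (\<lambda>_. 1)"
          unfolding \<beta>_def using prob_qb[OF P] by (intro word_sum_mono) (auto simp: prob_vec_def)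
        then show ?thesis using prob_qb[OF P] by (simp add: word_sum_const)
      qed
      have f5: "\<beta> \<le> K / sqrt (real N * var (qb P) ?s)" if "0 < var (qb P) ?s"
      proof -
        have "\<beta> \<le> exp (4 * b) * (1 + 2 * b) / sqrt (real N * var (qb P) ?s)"
          unfolding \<beta>_def using that N prob_qb[OF P] b(2)[OF P]
          by (intro word_exponential[where p="\<lambda>_. qb P" and m="real N * mean (qb P) ?s"]) auto
        also have "\<dots> \<le> K / sqrt (real N * var (qb P) ?s)"
          using K(3) that by (intro divide_right_mono) auto
        finally show ?thesis .
      qed
      show ?thesis
        by (intro exI[of _ \<alpha>] exI[of _ \<beta>] conjI allI impI f1 f2 f3 f4 f5)
    qed
    show "\<exists>P. prob_vec P \<and> disp P \<le> K\<^sup>2 \<and>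
      tail_bounds K N M \<epsilon> P"
      unfolding tail_bounds_def by (intro exI[of _ P] conjI P dK allI main)
  qed
qed

end

section \<open>Optimisation over types\<close>

text \<open>Completing the square; it caps a gain of order \<open>sqrt N\<close> against a loss of
  order \<open>N\<close> by a constant.\<close>

lemma quadratic_bound:
  fixes p q x :: real
  assumes "0 < q"
  shows "p * x - q * x\<^sup>2 \<le> p\<^sup>2 / (4 * q)"
proof -
  have "0 \<le> (2 * q * x - p)\<^sup>2" by simp
  then have "4 * q * (p * x - q * x\<^sup>2) \<le> p\<^sup>2" by (simp add: power2_eq_square algebra_simps)
  then show ?thesis using assms by (simp add: pos_le_divide_eq mult.commute)
qed

lemma sqrt_diff_le:
  assumes "0 < V" "0 \<le> v"
  shows "\<bar>sqrt v - sqrt V\<bar> \<le> \<bar>v - V\<bar> / sqrt V"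
proof -
  have "(sqrt v - sqrt V) * (sqrt v + sqrt V) = v - V" using assms by (simp add: algebra_simps)
  then have "\<bar>sqrt v - sqrt V\<bar> * (sqrt v + sqrt V) = \<bar>v - V\<bar>"
    using assms by (metis abs_mult abs_of_nonneg add_nonneg_nonneg less_imp_le real_sqrt_ge_zero)
  moreover have "\<bar>sqrt v - sqrt V\<bar> * sqrt V \<le> \<bar>sqrt v - sqrt V\<bar> * (sqrt v + sqrt V)"
    using assms by (intro mult_left_mono) auto
  ultimately show ?thesis using assms by (simp add: pos_le_divide_eq)
qed

context optimal_dmc
begin

text \<open>With \<open>l\<close> chosen as below, the second term takes at most half of
  \<open>1 - \<epsilon>\<close>, and Chebyshev handles the other half. The result is off by order
  \<open>sqrt N\<close> but does not ask for positive dispersion; it serves types with a clear rate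
  loss or small dispersion, and bounded \<open>N\<close>.\<close>

lemma code_crude:
  assumes e: "\<epsilon> < 1" and M: "0 < M"
    and T: "tail_bounds K N M \<epsilon> P" and P: "0 \<le> disp P"
  shows "ln (real M) \<le> real N * rate P + sqrt (2 / (1 - \<epsilon>) * (real N * disp P)) + ln (2 / (1 - \<epsilon>))"
proof -
  define r d where "r = real N * rate P" and "d = real N * disp P"
  have d: "0 \<le> d" using P by (simp add: d_def)
  define l where "l = ln (real M) - ln (2 / (1 - \<epsilon>))"
  obtain \<alpha> \<beta> where ab: "1 - \<epsilon> \<le> \<alpha> + \<beta> * exp l / real M" "\<And>t. 0 < t \<Longrightarrow> l = r + t \<Longrightarrow> \<alpha> \<le> d / t\<^sup>2" "\<beta> \<le> 1"
    by (rule tail_boundsE[OF T, of l]) (rule that, auto simp: r_def d_def)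
  have "exp l / real M = (1 - \<epsilon>) / 2" using M e by (simp add: l_def exp_diff)
  then have "\<beta> * exp l / real M = \<beta> * ((1 - \<epsilon>) / 2)" by (metis times_divide_eq_right)
  also have "\<dots> \<le> 1 * ((1 - \<epsilon>) / 2)" using ab(3) e by (intro mult_right_mono) auto
  finally have al: "(1 - \<epsilon>) / 2 \<le> \<alpha>" using ab(1) by argo
  have "l \<le> r + sqrt (2 / (1 - \<epsilon>) * d)"
  proof (cases "l \<le> r")
    case True
    moreover have "0 \<le> sqrt (2 / (1 - \<epsilon>) * d)" using e d by simp
    ultimately show ?thesis by linarith
  next
    case False
    then have t: "0 < l - r" by simp
    have "\<alpha> \<le> d / (l - r)\<^sup>2" using ab(2)[OF t] by simp
    with al have "(1 - \<epsilon>) / 2 \<le> d / (l - r)\<^sup>2" by linarith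
    then have "(l - r)\<^sup>2 \<le> 2 / (1 - \<epsilon>) * d" using t e by (simp add: field_simps)
    then have "l - r \<le> sqrt (2 / (1 - \<epsilon>) * d)" by (rule real_le_rsqrt)
    then show ?thesis by simp
  qed
  then show ?thesis by (simp add: l_def r_def d_def)
qed

text \<open>For \<open>V > 0\<close>, types far from the optimal inputs lose a term linear in
  \<open>N\<close>, so the crude bound suffices. Near types of small dispersion occur only for
  \<open>\<epsilon> > 1/2\<close>, where their deviation term is below
  \<open>sqrt (N * V) * z\<close>. For all others the normal approximation has a uniform error. For
  \<open>V = 0\<close> the target has no second-order term, and comparison with the median is
  enough.\<close>

lemma code_size_bound:
  assumes e: "0 < \<epsilon>" "\<epsilon> < 1" and case_eps: "\<epsilon> < 1/2 \<or> (1/2 < \<epsilon> \<and> 0 < V_eps W \<epsilon>)"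
  obtains K where "\<And>N M. 0 < N \<Longrightarrow> 0 < M \<Longrightarrow> cc_code W N M \<epsilon> \<Longrightarrow>
    ln (real M) \<le> real N * C + sqrt (real N * V_eps W \<epsilon>) * Phi_inv \<epsilon> + K"
proof -
  obtain K1 where K1: "0 < K1"
    and tail: "\<And>N M. 0 < N \<Longrightarrow> 0 < M \<Longrightarrow> cc_code W N M \<epsilon> \<Longrightarrow> \<exists>P. prob_vec P \<and> disp P \<le> K1\<^sup>2 \<and>
      tail_bounds K1 N M \<epsilon> P"
    by (rule code_tail) (rule that)
  obtain g c where gc: "0 < g" "0 < c"
    and rate: "\<And>P. prob_vec P \<Longrightarrow> rate P \<le> C - g * excess P - c * (gap P)\<^sup>2"
    by (rule rate_le) (rule that)
  define V z k0 \<kappa> where "V = V_eps W \<epsilon>" and "z = Phi_inv \<epsilon>" and "k0 = ln (2 / (1 - \<epsilon>))" and "\<kappa> = 2 / (1 - \<epsilon>)"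
  have \<kappa>: "0 < \<kappa>" using e by (simp add: \<kappa>_def)
  have disp_nonneg: "0 \<le> disp P" if "prob_vec P" for P
    unfolding disp_def using that var_nonneg[OF prob_W] by (intro sum_nonneg) (auto simp: prob_vec_def)
  have disp0_nonneg: "0 \<le> disp0 P" if "prob_vec P" for P
    unfolding disp0_def using that var_nonneg[OF prob_W] by (intro sum_nonneg) (auto simp: prob_vec_def)
  have rate_le_C: "rate P \<le> C" if "prob_vec P" for P
  proof -
    have "0 \<le> g * excess P" "0 \<le> c * (gap P)\<^sup>2" using gc excess_bounds[OF that] by auto
    then show ?thesis using rate[OF that] by linarith
  qed
  have Nrate: "real N * rate P \<le> real N * C" if "prob_vec P" for P N
    using rate_le_C[OF that] by (intro mult_left_mono) auto
  have ne: "cap_achieving W \<noteq> {}"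
    using prob_Qs Qs_opt by (auto simp: cap_achieving_def input_dists_eq)
  show ?thesis
  proof (cases "V = 0")
    case True
    then have e2: "\<epsilon> < 1/2" using case_eps by (auto simp: V_def)
    \<comment> \<open>Two errors of size \<open>h\<close> raise \<open>\<epsilon>\<close> to exactly
      1/2, so \<open>l\<close> is at most \<open>N * rate P\<close> whatever the dispersion
      is.\<close>
    define h where "h = (1/2 - \<epsilon>) / 2"
    have h: "0 < h" "1 - \<epsilon> - 2 * h = 1 / 2" using e2 by (auto simp: h_def field_simps)
    define K where "K = sqrt (\<kappa> * (K1 / h)\<^sup>2) + \<bar>k0\<bar> + \<bar>ln h\<bar>"
    show ?thesis
    proof
      fix N M :: nat assume N: "0 < N" and M: "0 < M" and code: "cc_code W N M \<epsilon>"
      obtain P where P: "prob_vec P" and ineq: "tail_bounds K1 N M \<epsilon> P"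
        using tail[OF N M code] by blast
      have crude: "ln (real M) \<le> real N * rate P + sqrt (\<kappa> * (real N * disp P)) + k0"
        unfolding \<kappa>_def k0_def by (rule code_crude[OF e(2) M ineq disp_nonneg[OF P]])
      have "ln (real M) \<le> real N * C + K"
      \<comment> \<open>Either the total dispersion is bounded and Chebyshev loses a constant, or it
        is so large that the normal approximation error is at most \<open>h\<close>.\<close>
      proof (cases "real N * disp P \<le> (K1 / h)\<^sup>2")
        case True
        then have "sqrt (\<kappa> * (real N * disp P)) \<le> sqrt (\<kappa> * (K1 / h)\<^sup>2)"
          using \<kappa> by (simp add: mult_left_mono)
        then show ?thesis
          using crude Nrate[OF P, of N] abs_ge_self[of k0] abs_ge_zero[of "ln h"] unfolding K_def by linarith
      next
        case False
        then have d: "K1 / h < sqrt (real N * disp P)" using real_less_rsqrt by simp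
        moreover have "0 < K1 / h" using K1 h by simp
        ultimately have s0: "0 < sqrt (real N * disp P)" by linarith
        then have d0: "0 < disp P" using N by (simp add: zero_less_mult_iff)
        have small: "K1 / sqrt (real N * disp P) \<le> h" using d s0 h by (simp add: field_simps)
        define l where "l = ln (real M) + ln h"
        obtain \<alpha> \<beta> where ab: "1 - \<epsilon> \<le> \<alpha> + \<beta> * exp l / real M" "\<beta> \<le> 1"
          "\<alpha> \<le> 1 - Phi ((l - real N * rate P) / sqrt (real N * disp P)) + K1 / sqrt (real N * disp P)"
          by (rule tail_boundsE[OF ineq, of l]) (rule that, use d0 in auto)
        have "exp l / real M = h" using M h by (simp add: l_def exp_add)
        then have "\<beta> * exp l / real M = \<beta> * h" by (metis times_divide_eq_right)
        then have "\<beta> * exp l / real M \<le> h" using ab(2) h by simp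
        then have "Phi ((l - real N * rate P) / sqrt (real N * disp P)) \<le> Phi 0"
          using ab small h unfolding Phi_0 by linarith
        then have "l \<le> real N * rate P" using s0 unfolding Phi_le_iff by (simp add: divide_le_0_iff)
        then have "ln (real M) \<le> real N * C + \<bar>ln h\<bar>" using Nrate[OF P, of N] by (simp add: l_def)
        moreover have "0 \<le> sqrt (\<kappa> * (K1 / h)\<^sup>2)" using \<kappa> by simp
        ultimately show ?thesis using abs_ge_zero[of k0] unfolding K_def by linarith
      qed
      then show "ln (real M) \<le> real N * C + sqrt (real N * V_eps W \<epsilon>) * Phi_inv \<epsilon> + K"
        using True by (simp add: V_def)
    qed
  next
    case V_ne: False
    \<comment> \<open>Only the change of dispersion that favours the code is bounded: a decrease
      when \<open>Phi_inv \<epsilon>\<close> is negative, an increase when it is positive.\<close>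
    obtain K2 where K2: "0 \<le> K2" and pen:
      "\<And>P. prob_vec P \<Longrightarrow> \<epsilon> < 1/2 \<Longrightarrow> V - K2 * (excess P + gap P) \<le> disp0 P"
      "\<And>P. prob_vec P \<Longrightarrow> 1/2 < \<epsilon> \<Longrightarrow> disp0 P \<le> V + K2 * (excess P + gap P)"
    proof (cases "\<epsilon> < 1/2")
      case True
      obtain K where K: "0 \<le> K"
        "\<And>P. prob_vec P \<Longrightarrow> (INF Q\<in>cap_achieving W. 1 * disp0 Q) - K * (excess P + gap P) \<le> 1 * disp0 P"
        by (rule dispersion_penalty[of 1]) (simp, rule that)
      have "V - K * (excess P + gap P) \<le> disp0 P" if "prob_vec P" for P
        using K(2)[OF that] V_eps_eq(1)[OF True] unfolding V_def by simp
      then show ?thesis using that[of K] K True by simp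
    next
      case False
      then have e2: "1/2 < \<epsilon>" using case_eps by auto
      obtain K where K: "0 \<le> K"
        "\<And>P. prob_vec P \<Longrightarrow> (INF Q\<in>cap_achieving W. (-1) * disp0 Q) - K * (excess P + gap P) \<le> (-1) * disp0 P"
        by (rule dispersion_penalty[of "-1"]) (simp, rule that)
      have "disp0 P \<le> V + K * (excess P + gap P)" if "prob_vec P" for P
        using K(2)[OF that] V_eps_eq(2)[OF e2] unfolding V_def by linarith
      then show ?thesis using that[of K] K False by simp
    qed
    obtain L where L: "0 \<le> L" "\<And>P. prob_vec P \<Longrightarrow> \<bar>disp P - disp0 P\<bar> \<le> L * gap P"
      "\<And>P. prob_vec P \<Longrightarrow> var qs (score qs) / 2 - L * gap P \<le> var (qb P) (score (qb P))"
      by (rule disp_close) (rule that)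
    have Vpos: "0 < V"
    proof (cases "\<epsilon> < 1/2")
      case True
      have "0 \<le> V" unfolding V_def V_eps_eq(1)[OF True]
        using ne disp0_nonneg by (intro cINF_greatest) (auto simp: cap_achieving_iff)
      then show ?thesis using V_ne by simp
    qed (use case_eps V_def in auto)
    have vpos: "0 < var qs (score qs)"
    proof (rule ccontr)
      assume "\<not> ?thesis"
      then have "var qs (score qs) = 0" using var_nonneg[OF prob_qs, of "score qs"] by simp
      then have "disp0 P = 0" for P by (rule disp0_eq_0)
      then have "V = 0"
        using case_eps V_eps_eq[of \<epsilon>] ne unfolding V_def by auto
      with V_ne show False by simp
    qed
    \<comment> \<open>Within radius \<open>\<eta>\<close> in \<open>excess + gap\<close>, the
      variance under \<open>qb P\<close> stays above \<open>v0\<close>, half of what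
      \<open>disp_close\<close> gives at gap 0. The level \<open>v1\<close> marks small dispersion:
      for \<open>\<epsilon> < 1/2\<close> none occurs within the radius, for
      \<open>\<epsilon> > 1/2\<close> it makes \<open>sqrt (\<kappa> * disp P)\<close> at most
      \<open>sqrt V * z\<close>.\<close>
    define v0 where "v0 = var qs (score qs) / 4"
    define K3 where "K3 = K2 + L"
    define v1 where "v1 = (if \<epsilon> < 1/2 then V / 2 else V * z\<^sup>2 / \<kappa>)"
    define \<eta> where "\<eta> = min (v0 / (L + 1)) (V / (2 * (K3 + 1)))"
    have z: "\<epsilon> < 1/2 \<Longrightarrow> z < 0" "1/2 < \<epsilon> \<Longrightarrow> 0 < z"
      using Phi_inv_neg[of \<epsilon>] Phi_inv_pos[of \<epsilon>] e by (auto simp: z_def)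
    have K3: "0 \<le> K3" using K2 L by (simp add: K3_def)
    have v0: "0 < v0" using vpos by (simp add: v0_def)
    have v1: "0 < v1" using Vpos z \<kappa> case_eps by (auto simp: v1_def)
    have \<eta>: "0 < \<eta>" "L * \<eta> \<le> v0" "K3 * \<eta> \<le> V / 2"
    proof -
      show "0 < \<eta>" using v0 Vpos L K3 by (simp add: \<eta>_def)
      have "L * \<eta> \<le> (L + 1) * (v0 / (L + 1))" using L v0 \<open>0 < \<eta>\<close> by (intro mult_mono) (auto simp: \<eta>_def)
      then show "L * \<eta> \<le> v0" using L by simp
      have "K3 * \<eta> \<le> (K3 + 1) * (V / (2 * (K3 + 1)))"
        using K3 Vpos \<open>0 < \<eta>\<close> by (intro mult_mono) (auto simp: \<eta>_def)
      also have "\<dots> = V / 2" using K3 by (simp add: field_simps)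
      finally show "K3 * \<eta> \<le> V / 2" .
    qed
    obtain pc h where pc: "0 < pc" "0 < h"
      and perturb': "\<And>x d. 0 \<le> d \<Longrightarrow> d \<le> h \<Longrightarrow> Phi x \<le> \<epsilon> + d \<Longrightarrow> x \<le> Phi_inv \<epsilon> + pc * d"
      by (rule Phi_inv_perturb[OF e]) (rule that)
    note perturb = perturb'[folded z_def]
    define \<zeta> where "\<zeta> = min (g * (\<eta> / 2)) (c * (\<eta> / 2)\<^sup>2)"
    have \<zeta>: "0 < \<zeta>" using gc \<eta> by (simp add: \<zeta>_def)
    \<comment> \<open>Bounds the factor of \<open>sqrt N\<close> by which the crude bound can exceed
      the target at equal rate.\<close>
    define p where "p = sqrt \<kappa> * K1 + sqrt V * \<bar>z\<bar>"
    have p0: "0 \<le> p" using \<kappa> K1 Vpos by (simp add: p_def)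
    define K4 where "K4 = K1 / sqrt v0 + K1 / sqrt v1"
    have K4: "0 < K4" using K1 v0 v1 by (simp add: K4_def add_pos_pos)
    \<comment> \<open>Bounds the growth of \<open>sqrt (disp P) * z\<close> per unit of
      \<open>excess + gap\<close>; the quotients with \<open>E\<^sup>2\<close> below come from
      \<open>quadratic_bound\<close>.\<close>
    define E where "E = \<bar>z\<bar> * K3 / sqrt V"
    define Kfar where "Kfar = p\<^sup>2 / (4 * \<zeta>) + \<bar>k0\<bar>"
    define Ksmall where "Ksmall = p * (K4 / h) + \<bar>k0\<bar>"
    define Kbe where "Kbe = pc * K4 * K1 + E\<^sup>2 / (4 * g) + E\<^sup>2 / (4 * c)"
    have Kn: "0 \<le> Kfar" "0 \<le> Ksmall" "0 \<le> Kbe"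
      using gc \<zeta> p0 K4 K1 pc by (auto simp: Kfar_def Ksmall_def Kbe_def)
    show ?thesis
    proof
      fix N M :: nat assume N: "0 < N" and M: "0 < M" and code: "cc_code W N M \<epsilon>"
      obtain P where P: "prob_vec P" and dK: "disp P \<le> K1\<^sup>2" and ineq: "tail_bounds K1 N M \<epsilon> P"
        using tail[OF N M code] by blast
      define x where "x = sqrt (real N)"
      have x: "0 < x" "x\<^sup>2 = real N" using N by (auto simp: x_def)
      define goal where "goal = real N * C + x * sqrt V * z"
      have goal: "real N * C + sqrt (real N * V_eps W \<epsilon>) * Phi_inv \<epsilon> = goal"
        by (simp add: goal_def x_def V_def z_def real_sqrt_mult)
      define a b where "a = excess P" and "b = gap P"
      have ab: "0 \<le> a" "a \<le> 1" "0 \<le> b" using excess_bounds[OF P] gap_nonneg by (auto simp: a_def b_def)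
      have rateP: "rate P \<le> C - g * a - c * b\<^sup>2" using rate[OF P] by (simp add: a_def b_def)
      have d0: "0 \<le> disp P" by (rule disp_nonneg[OF P])
      have sd: "sqrt (disp P) \<le> K1" using dK K1 by (simp add: real_le_lsqrt)
      have sqrtN: "sqrt (real N * r) = x * sqrt r" for r by (simp add: x_def real_sqrt_mult)
      have crude: "ln (real M) \<le> real N * rate P + sqrt (\<kappa> * (real N * disp P)) + k0"
        unfolding \<kappa>_def k0_def by (rule code_crude[OF e(2) M ineq disp_nonneg[OF P]])
      have sqk: "sqrt (\<kappa> * (real N * disp P)) = x * (sqrt \<kappa> * sqrt (disp P))"
        by (simp add: x_def real_sqrt_mult)
      have "sqrt \<kappa> * sqrt (disp P) \<le> sqrt \<kappa> * K1" using sd \<kappa> by (intro mult_left_mono) auto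
      then have "x * (sqrt \<kappa> * sqrt (disp P)) \<le> x * (sqrt \<kappa> * K1)" by (rule mult_left_mono) (use x in auto)
      moreover have "- (sqrt V * z) \<le> sqrt V * \<bar>z\<bar>" using Vpos by (simp add: abs_if)
      then have "x * (- (sqrt V * z)) \<le> x * (sqrt V * \<bar>z\<bar>)" by (rule mult_left_mono) (use x in auto)
      ultimately have crude2: "ln (real M) \<le> real N * rate P + x * sqrt V * z + p * x + \<bar>k0\<bar>"
        using crude unfolding sqk p_def by (simp add: algebra_simps)
      consider (far) "\<eta> < a + b" | (small) "a + b \<le> \<eta>" "disp P < v1" | (large) "a + b \<le> \<eta>" "v1 \<le> disp P" by linarith
      then have "ln (real M) \<le> goal + (Kfar + Ksmall + Kbe)"
      proof cases
        case far
        \<comment> \<open>One of the two quantities is at least \<open>\<eta> / 2\<close>, which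
          forces a rate loss of at least \<open>\<zeta>\<close> per letter.\<close>
        have "\<zeta> \<le> g * a + c * b\<^sup>2"
        proof (cases "\<eta> / 2 \<le> a")
          case True
          then have "g * (\<eta> / 2) \<le> g * a" using gc by (intro mult_left_mono) auto
          moreover have "0 \<le> c * b\<^sup>2" using gc by simp
          ultimately show ?thesis by (simp add: \<zeta>_def)
        next
          case False
          then have "(\<eta> / 2)\<^sup>2 \<le> b\<^sup>2" using far \<eta> by (intro power_mono) auto
          then have "c * (\<eta> / 2)\<^sup>2 \<le> c * b\<^sup>2" using gc by (intro mult_left_mono) auto
          moreover have "0 \<le> g * a" using gc ab by simp
          ultimately show ?thesis by (simp add: \<zeta>_def)
        qed
        then have "real N * rate P \<le> x\<^sup>2 * (C - \<zeta>)" unfolding x(2) using rateP by (intro mult_left_mono) auto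
        then have "ln (real M) \<le> goal + (p * x - \<zeta> * x\<^sup>2) + \<bar>k0\<bar>"
          using crude2 x(2) by (simp add: goal_def algebra_simps)
        then have "ln (real M) \<le> goal + Kfar" using quadratic_bound[OF \<zeta>, of p x] by (simp add: Kfar_def)
        then show ?thesis using Kn by linarith
      next
        case small
        have K3b: "\<bar>disp P - disp0 P\<bar> \<le> L * (a + b)"
          using L(2)[OF P] mult_left_mono[of b "a + b" L] ab L by (simp add: b_def)
        have e2: "1/2 < \<epsilon>"
        proof (rule ccontr)
          assume "\<not> ?thesis"
          then have e2: "\<epsilon> < 1/2" using case_eps by auto
          have "V - K3 * (a + b) \<le> disp P" using pen(1)[OF P e2] K3b by (simp add: K3_def a_def b_def algebra_simps)
          moreover have "K3 * (a + b) \<le> K3 * \<eta>" using small K3 by (intro mult_left_mono)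
          ultimately show False using small \<eta> e2 by (simp add: v1_def)
        qed
        then have z0: "0 < z" by (rule z)
        have "\<kappa> * disp P \<le> V * z\<^sup>2" using small e2 \<kappa> by (simp add: v1_def field_simps)
        then have "sqrt (\<kappa> * disp P) \<le> sqrt (V * z\<^sup>2)" by simp
        then have "sqrt \<kappa> * sqrt (disp P) \<le> sqrt V * z" using z0 by (simp add: real_sqrt_mult)
        then have "x * (sqrt \<kappa> * sqrt (disp P)) \<le> x * (sqrt V * z)" by (rule mult_left_mono) (use x in auto)
        then have "ln (real M) \<le> goal + \<bar>k0\<bar>"
          using crude Nrate[OF P, of N] unfolding sqk goal_def by (simp add: mult.assoc)
        moreover have "\<bar>k0\<bar> \<le> Kfar" using \<zeta> by (simp add: Kfar_def)
        ultimately show ?thesis using Kn by linarith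
      next
        case large
        have vq: "v0 \<le> var (qb P) (score (qb P))"
        proof -
          have "L * gap P \<le> L * \<eta>" using large ab L by (intro mult_left_mono) (auto simp: b_def)
          then show ?thesis using L(3)[OF P] \<eta> by (simp add: v0_def)
        qed
        have dpos: "0 < disp P" using large v1 by linarith
        show ?thesis
        proof (cases "K4 / x \<le> h")
          \<comment> \<open>Here \<open>N\<close> is bounded, so the crude bound is within a
            constant of the target.\<close>
          case False
          then have "x \<le> K4 / h" using x pc by (simp add: field_simps)
          then have "p * x \<le> p * (K4 / h)" using p0 by (intro mult_left_mono)
          then have "ln (real M) \<le> goal + Ksmall"
            using crude2 Nrate[OF P, of N] by (simp add: goal_def Ksmall_def)
          then show ?thesis using Kn by linarith
        next
          case True
          define l where "l = ln (real M)"
          obtain \<alpha> \<beta> where al: "1 - \<epsilon> \<le> \<alpha> + \<beta> * exp l / real M"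
            "\<alpha> \<le> 1 - Phi ((l - real N * rate P) / sqrt (real N * disp P)) + K1 / sqrt (real N * disp P)"
            "\<beta> \<le> K1 / sqrt (real N * var (qb P) (score (qb P)))"
            by (rule tail_boundsE[OF ineq, of l]) (rule that, use dpos vq v0 in auto)
          have "K1 / sqrt (real N * disp P) \<le> K1 / sqrt (real N * v1)"
            using large v1 N K1 by (intro divide_left_mono) auto
          moreover have "K1 / sqrt (real N * var (qb P) (score (qb P))) \<le> K1 / sqrt (real N * v0)"
            using vq v0 N K1 by (intro divide_left_mono) auto
          moreover have "exp l / real M = 1" using M by (simp add: l_def)
          then have "\<beta> * exp l / real M = \<beta>" by (metis mult.right_neutral times_divide_eq_right)
          moreover have "K1 / sqrt (real N * v1) + K1 / sqrt (real N * v0) = K4 / x"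
            by (simp add: K4_def x_def real_sqrt_mult add_divide_distrib mult.commute)
          ultimately have "Phi ((l - real N * rate P) / sqrt (real N * disp P)) \<le> \<epsilon> + K4 / x"
            using al by linarith
          then have "(l - real N * rate P) / sqrt (real N * disp P) \<le> z + pc * (K4 / x)"
            using True K4 x by (intro perturb) auto
          then have "l - real N * rate P \<le> (z + pc * (K4 / x)) * (x * sqrt (disp P))"
            using dpos x by (simp add: pos_divide_le_eq sqrtN)
          also have "\<dots> = x * (sqrt (disp P) * z) + pc * K4 * sqrt (disp P)"
            using x by (simp add: field_simps)
          also have "pc * K4 * sqrt (disp P) \<le> pc * K4 * K1" using sd pc K4 by (intro mult_left_mono) auto
          finally have 1: "l \<le> real N * rate P + x * (sqrt (disp P) * z) + pc * K4 * K1" by simp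
          have K3b: "\<bar>disp P - disp0 P\<bar> \<le> L * (a + b)"
            using L(2)[OF P] mult_left_mono[of b "a + b" L] ab L by (simp add: b_def)
          \<comment> \<open>If the dispersion deviates in the harmless direction, the left side is
            nonpositive; otherwise \<open>pen\<close> bounds the deviation.\<close>
          have sq: "(sqrt (disp P) - sqrt V) * z \<le> E * (a + b)"
          proof (cases "0 \<le> (V - disp P) * (- z)")
            case False
            then have s: "0 < (V - disp P) * z" by simp
            have "(sqrt (disp P) - sqrt V) * z \<le> 0"
            proof (cases "0 < z")
              case True
              then have "disp P \<le> V" using s by (simp add: zero_less_mult_iff)
              then show ?thesis using True by (simp add: mult_le_0_iff)
            next
              case False
              then have "V \<le> disp P" using s by (simp add: zero_less_mult_iff)
              then show ?thesis using False by (simp add: mult_le_0_iff)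
            qed
            also have "0 \<le> E * (a + b)" using ab K3 Vpos by (simp add: E_def)
            finally show ?thesis .
          next
            case True
            have "\<bar>disp P - V\<bar> * \<bar>z\<bar> \<le> K3 * (a + b) * \<bar>z\<bar>"
            proof (cases "\<epsilon> < 1/2")
              case e2: True
              then have "disp P \<le> V" using True z(1) by (auto simp: mult_le_0_iff)
              moreover have "V - disp P \<le> K3 * (a + b)"
                using pen(1)[OF P e2] K3b by (simp add: K3_def a_def b_def algebra_simps)
              ultimately show ?thesis by (intro mult_right_mono) auto
            next
              case False
              then have e2: "1/2 < \<epsilon>" using case_eps by auto
              then have "V \<le> disp P" using True z(2) by (auto simp: mult_le_0_iff)
              moreover have "disp P - V \<le> K3 * (a + b)"
                using pen(2)[OF P e2] K3b by (simp add: K3_def a_def b_def algebra_simps)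
              ultimately show ?thesis by (intro mult_right_mono) auto
            qed
            then have 2: "\<bar>disp P - V\<bar> * \<bar>z\<bar> / sqrt V \<le> K3 * (a + b) * \<bar>z\<bar> / sqrt V"
              using Vpos by (intro divide_right_mono) auto
            have "(sqrt (disp P) - sqrt V) * z \<le> \<bar>sqrt (disp P) - sqrt V\<bar> * \<bar>z\<bar>"
              by (metis abs_ge_self abs_mult)
            also have "\<dots> \<le> \<bar>disp P - V\<bar> / sqrt V * \<bar>z\<bar>"
              using sqrt_diff_le[OF Vpos d0] by (intro mult_right_mono) auto
            also have "\<dots> \<le> E * (a + b)" using 2 by (simp add: E_def mult_ac)
            finally show ?thesis .
          qed
          then have "x * ((sqrt (disp P) - sqrt V) * z) \<le> x * (E * (a + b))" by (rule mult_left_mono) (use x in auto)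
          moreover have "real N * rate P \<le> x\<^sup>2 * (C - g * a - c * b\<^sup>2)" unfolding x(2) using rateP by (intro mult_left_mono) auto
          \<comment> \<open>\<open>excess\<close> enters gain and loss linearly, so it factors out
            and is bounded by 1; for \<open>gap\<close> the square is completed in
            \<open>x * b\<close>.\<close>
          ultimately have 3: "real N * rate P + x * (sqrt (disp P) * z)
              \<le> goal + a * (E * x - g * x\<^sup>2) + (E * (x * b) - c * (x * b)\<^sup>2)"
            unfolding goal_def x(2)[symmetric] by (simp add: algebra_simps power_mult_distrib)
          have "a * (E * x - g * x\<^sup>2) \<le> a * (E\<^sup>2 / (4 * g))"
            using quadratic_bound[OF gc(1)] ab by (intro mult_left_mono)
          also have "\<dots> \<le> 1 * (E\<^sup>2 / (4 * g))" using ab gc by (intro mult_right_mono) auto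
          finally have "l \<le> goal + Kbe" using 1 3 quadratic_bound[OF gc(2), of E "x * b"] by (simp add: Kbe_def)
          then show ?thesis using Kn by (simp add: l_def)
        qed
      qed
      then show "ln (real M) \<le> real N * C + sqrt (real N * V_eps W \<epsilon>) * Phi_inv \<epsilon> + (Kfar + Ksmall + Kbe)"
        unfolding goal .
    qed
  qed
qed

text \<open>\<open>M_star_c\<close> is a \<open>Max\<close>, so its set must be finite and nonempty:
  the size bound gives finiteness, the one-message code is always admissible. At block length 0,
  outside the size bound, \<open>exp (N * R)\<close> is 1 and only one message is possible.\<close>

lemma M_star_bound:
  assumes e: "0 < \<epsilon>" "\<epsilon> < 1" and case_eps: "\<epsilon> < 1/2 \<or> (1/2 < \<epsilon> \<and> 0 < V_eps W \<epsilon>)"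
  shows "\<exists>K>0. \<forall>N::nat. ln (real (M_star_c W N \<epsilon>))
    \<le> real N * capacity W + sqrt (real N * V_eps W \<epsilon>) * Phi_inv \<epsilon> + K"
proof -
  obtain K where K: "\<And>N M. 0 < N \<Longrightarrow> 0 < M \<Longrightarrow> cc_code W N M \<epsilon> \<Longrightarrow>
      ln (real M) \<le> real N * C + sqrt (real N * V_eps W \<epsilon>) * Phi_inv \<epsilon> + K"
    by (rule code_size_bound[OF assms]) (rule that)
  have "ln (real (M_star_c W N \<epsilon>)) \<le> real N * C + sqrt (real N * V_eps W \<epsilon>) * Phi_inv \<epsilon> + (\<bar>K\<bar> + 1)" for N :: nat
  proof (cases "N = 0")
    case True
    have "cc_code W 0 1 \<epsilon>"
      unfolding cc_code_def avg_error_def using e by (intro exI[of _ "\<lambda>_. []"] exI[of _ "\<lambda>_. 1"]) auto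
    then have "{M. \<exists>R::real. M = nat \<lceil>exp (real 0 * R)\<rceil> \<and> cc_code W 0 M \<epsilon>} = {1}" by auto
    then have "M_star_c W 0 \<epsilon> = 1" by (simp only: M_star_c_def Max_singleton)
    then show ?thesis using True by simp
  next
    case False
    define A where "A = {M. \<exists>R::real. M = nat \<lceil>exp (real N * R)\<rceil> \<and> cc_code W N M \<epsilon>}"
    have pos: "0 < M" if "M \<in> A" for M using that by (auto simp: A_def)
    have bound: "ln (real M) \<le> real N * C + sqrt (real N * V_eps W \<epsilon>) * Phi_inv \<epsilon> + K" if "M \<in> A" for M
      using K[of N M] False pos[OF that] that by (auto simp: A_def)
    have "finite A"
    proof (rule finite_subset)
      show "A \<subseteq> {..nat \<lceil>exp (real N * C + sqrt (real N * V_eps W \<epsilon>) * Phi_inv \<epsilon> + K)\<rceil>}"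
      proof
        fix M assume M: "M \<in> A"
        then have "real M \<le> exp (real N * C + sqrt (real N * V_eps W \<epsilon>) * Phi_inv \<epsilon> + K)"
          using bound[OF M] pos[OF M] by (simp add: ln_le_cancel_iff[symmetric] del: ln_le_cancel_iff)
        then show "M \<in> {..nat \<lceil>exp (real N * C + sqrt (real N * V_eps W \<epsilon>) * Phi_inv \<epsilon> + K)\<rceil>}"
          by simp linarith
      qed
    qed simp
    moreover have "1 \<in> A"
    proof -
      have "cc_code W N 1 \<epsilon>"
        unfolding cc_code_def avg_error_def using e
        by (intro exI[of _ "\<lambda>_. replicate N undefined"] exI[of _ "\<lambda>_. 1"]) auto
      then show ?thesis unfolding A_def by (intro CollectI exI[of _ 0]) auto
    qed
    ultimately have "Max A \<in> A" by (intro Max_in) auto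
    from bound[OF this] show ?thesis unfolding M_star_c_def A_def[symmetric] by linarith
  qed
  then show ?thesis unfolding C_def by (intro exI[of _ "\<bar>K\<bar> + 1"]) auto
qed

end

theorem theorem4:
  fixes W :: "'x::finite \<Rightarrow> 'y::finite \<Rightarrow> real"
  assumes "channel W"
    and "singular_channel W"
    and "\<not> gallager_symmetric W"
  shows "(\<forall>\<epsilon>. 0 < \<epsilon> \<and> \<epsilon> < 1/2 \<longrightarrow>
            (\<exists>K>0. \<forall>N::nat. ln (real (M_star_c W N \<epsilon>))
                 \<le> real N * capacity W + sqrt (real N * V_eps W \<epsilon>) * Phi_inv \<epsilon> + K))
       \<and> (\<forall>\<epsilon>. 1/2 < \<epsilon> \<and> \<epsilon> < 1 \<and> V_eps W \<epsilon> > 0 \<longrightarrow>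
            (\<exists>K>0. \<forall>N::nat. ln (real (M_star_c W N \<epsilon>))
                 \<le> real N * capacity W + sqrt (real N * V_eps W \<epsilon>) * Phi_inv \<epsilon> + K))"
proof -
  interpret dmc W by unfold_locales (rule assms)
  obtain Q where "prob_vec Q" "mutual_info Q W = capacity W" using capacity_attained by blast
  then interpret optimal_dmc W Q using assms(2) by unfold_locales
  show ?thesis using M_star_bound by auto
qed

end
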